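(* For each $n \ge 1$ let $X_n = n^{-1/2} Y_n$ be an $n\times n$ generalized Gaussian random matrix with covariances $c_k(i,j)$ (which may depend on $n$), where all the $X_n$ are of one and the same type among: Toeplitz, circulant, symmetric circulant, reverse circulant, Hankel. Assume there are constants $m, M \in (0,\infty)$ with $m \le \mathbb{E}((Y_n)_{ij}^2) \le M$ for all $i,j$ and all $n$, and assume there is $\gamma > 0$ such that $c_k(i,j) \ge \gamma$ for all $n$ and all admissible indices $k,i,j$ (including $i=j$). Let $p$ be a positive integer and let $W_n = \mathrm{Tr}(X_n^p)$. If the type is reverse circulant or Hankel, assume further that $p$ is even. Then, as $n \to \infty$, $$\frac{W_n - \mathbb{E}(W_n)}{\sqrt{\mathrm{Var}(W_n)}} \text{ converges in total variation to } N(0,1).$$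
   Context: Total variation distance between real random variables: $d_{TV}(X,Y) = \sup_{A}|\mathbb{P}(X\in A) - \mathbb{P}(Y \in A)|$ over Borel sets $A \subseteq \mathbb{R}$; convergence in total variation to $N(0,1)$ means that $d_{TV}$ to a standard normal variable tends to $0$. Generalized Gaussian random matrices. Each model is built from a family of vectors $\mathbf{X}_k$, independent for different $k$, each being a centered jointly Gaussian real random vector with otherwise arbitrary covariance matrix (the vectors may depend on $n$). Write $[\mathbf{X}_k]_i$ for the $i$-th coordinate and $c_k(i,j) = \mathrm{Cov}([\mathbf{X}_k]_i,[\mathbf{X}_k]_j) = \mathbb{E}([\mathbf{X}_k]_i[\mathbf{X}_k]_j)$. The vectors determine an unnormalized real $n\times n$ matrix $Y_n$ as follows, and $X_n = n^{-1/2}Y_n$ (indices $1\le i,j\le n$). (Toeplitz) $\mathbf{X}_k \in \mathbb{R}^{n-k}$, $k=0,\dots,n-1$; $(Y_n)_{ij} = [\mathbf{X}_{|i-j|}]_{\min(i,j)}$. (Circulant) $\mathbf{X}_k\in\mathbb{R}^n$, $k=1,\dots,n$; $(Y_n)_{ij} = [\mathbf{X}_k]_i$ where $k\in\{1,\dots,n\}$ and $k\equiv j-i+1 \pmod n$. (Reverse circulant) $\mathbf{X}_k\in\mathbb{R}^n$, $k=1,\dots,n$; $(Y_n)_{ij} = [\mathbf{X}_k]_i$ where $k\in\{1,\dots,n\}$ and $k\equiv i+j-1 \pmod n$. (Symmetric circulant) Vectors $\mathbf{X}_k$ for integers $0\le k\le n/2$, with $\mathbf{X}_k\in\mathbb{R}^n$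 if $k<n/2$, and $\mathbf{X}_{n/2}\in\mathbb{R}^{n/2}$ if $n$ is even. $Y_n$ is symmetric, and for $i\le j$: $(Y_n)_{ij} = [\mathbf{X}_{j-i}]_i$ if $j-i\le n/2$, and $(Y_n)_{ij} = [\mathbf{X}_{n-(j-i)}]_j$ if $j-i>n/2$. (Hankel) $\mathbf{X}_k\in\mathbb{R}^k$ for $1\le k\le n$ and $\mathbf{X}_k\in\mathbb{R}^{2n-k}$ for $n+1\le k\le 2n-1$; $(Y_n)_{ij} = [\mathbf{X}_{i+j-1}]_i$ if $i+j-1\le n$, and $(Y_n)_{ij} = [\mathbf{X}_{i+j-1}]_{n+1-j}$ if $i+j-1>n$. Circulant, reverse circulant and Hankel matrices of this kind need not be symmetric. *)

theory Defs
  imports "HOL-Probability.Probability" "Jordan_Normal_Form.Matrix"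
begin

text \<open>The two random variables may live on different probability spaces.\<close>

definition tv_dist :: "'a measure \<Rightarrow> ('a \<Rightarrow> real) \<Rightarrow> 'b measure \<Rightarrow> ('b \<Rightarrow> real) \<Rightarrow> real" where
  "tv_dist M X N Y =
     (SUP A\<in>sets (borel :: real measure).
        \<bar>measure M (X -` A \<inter> space M) - measure N (Y -` A \<inter> space N)\<bar>)"

definition tv_tendsto_std_normal :: "(nat \<Rightarrow> 'a measure) \<Rightarrow> (nat \<Rightarrow> 'a \<Rightarrow> real) \<Rightarrow> bool" where
  "tv_tendsto_std_normal M Z \<longleftrightarrow>
     (\<lambda>n. tv_dist (M n) (Z n) std_normal_distribution (\<lambda>x. x)) \<longlonglongrightarrow> 0"

text \<open>The second disjunct is the degenerate case \<open>N(0,0)\<close>; it is needed because covariance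
  matrices are allowed to be singular.\<close>

definition centered_gaussian :: "'a measure \<Rightarrow> ('a \<Rightarrow> real) \<Rightarrow> bool" where
  "centered_gaussian M Z \<longleftrightarrow> Z \<in> borel_measurable M \<and>
     ((\<exists>\<sigma>>0. distributed M lborel Z (normal_density 0 \<sigma>)) \<or> (AE \<omega> in M. Z \<omega> = 0))"

text \<open>A vector with coordinates indexed by \<open>{1..d}\<close> is jointly Gaussian iff all linear
  combinations of its coordinates are Gaussian.\<close>

definition centered_gaussian_vector ::
    "'a measure \<Rightarrow> nat \<Rightarrow> (nat \<Rightarrow> 'a \<Rightarrow> real) \<Rightarrow> bool" where
  "centered_gaussian_vector M d V \<longleftrightarrow>
     (\<forall>i\<in>{1..d}. V i \<in> borel_measurable M) \<and>
     (\<forall>a :: nat \<Rightarrow> real. centered_gaussian M (\<lambda>\<omega>. \<Sum>i\<in>{1..d}. a i * V i \<omega>))"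

datatype matrix_type = Toeplitz | Circulant | Reverse_Circulant | Symmetric_Circulant | Hankel

text \<open>The labels \<open>k\<close> of the vectors \<open>X\<^sub>k\<close> that build the \<open>n \<times> n\<close> matrix, and their dimensions.\<close>

fun vector_labels :: "matrix_type \<Rightarrow> nat \<Rightarrow> nat set" where
  "vector_labels Toeplitz n = {0..<n}"
| "vector_labels Circulant n = {1..n}"
| "vector_labels Reverse_Circulant n = {1..n}"
| "vector_labels Symmetric_Circulant n = {k. 2 * k \<le> n}"
| "vector_labels Hankel n = {1..2 * n - 1}"

fun vector_dim :: "matrix_type \<Rightarrow> nat \<Rightarrow> nat \<Rightarrow> nat" where
  "vector_dim Toeplitz n k = n - k"
| "vector_dim Circulant n k = n"
| "vector_dim Reverse_Circulant n k = n"
| "vector_dim Symmetric_Circulant n k = (if 2 * k < n then n else n div 2)"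
| "vector_dim Hankel n k = (if k \<le> n then k else 2 * n - k)"

text \<open>\<open>entry_index T n i j = (k, l)\<close> means that the \<open>(i,j)\<close> entry, with \<open>i\<close> and \<open>j\<close> in
  \<open>{1..n}\<close>, is the \<open>l\<close>-th coordinate of \<open>X\<^sub>k\<close>. The summand \<open>n\<close> in the circulant case
  avoids truncated subtraction.\<close>

fun entry_index :: "matrix_type \<Rightarrow> nat \<Rightarrow> nat \<Rightarrow> nat \<Rightarrow> nat \<times> nat" where
  "entry_index Toeplitz n i j = (nat \<bar>int i - int j\<bar>, min i j)"
| "entry_index Circulant n i j = ((n + j - i) mod n + 1, i)"
| "entry_index Reverse_Circulant n i j = ((i + j - 2) mod n + 1, i)"
| "entry_index Symmetric_Circulant n i j =
     (let a = min i j; b = max i j in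
      if 2 * (b - a) \<le> n then (b - a, a) else (n - (b - a), b))"
| "entry_index Hankel n i j =
     (if i + j - 1 \<le> n then (i + j - 1, i) else (i + j - 1, n + 1 - j))"

lemma entry_index_circulant_cong:
  assumes "i \<in> {1..n}" "j \<in> {1..n}" "(k, l) = entry_index Circulant n i j"
  shows "k \<in> {1..n} \<and> int k mod int n = (int j - int i + 1) mod int n"
proof -
  have k: "k = (n + j - i) mod n + 1" and n: "n > 0" using assms by auto
  have "int ((n + j - i) mod n) = (int n + int j - int i) mod int n"
    using assms by (simp add: zmod_int of_nat_diff)
  also have "\<dots> = (int j - int i) mod int n"
    by (metis add_diff_eq mod_add_self1)
  finally have "int k = (int j - int i) mod int n + 1" by (simp add: k)
  then have "int k mod int n = (int j - int i + 1) mod int n" by (simp add: mod_simps)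
  moreover have "k \<in> {1..n}" using n by (simp add: k Suc_leI)
  ultimately show ?thesis by blast
qed

lemma entry_index_reverse_circulant_cong:
  assumes "i \<in> {1..n}" "j \<in> {1..n}" "(k, l) = entry_index Reverse_Circulant n i j"
  shows "k \<in> {1..n} \<and> k mod n = (i + j - 1) mod n"
proof -
  have k: "k = (i + j - 2) mod n + 1" and n: "n > 0" using assms by auto
  have "k mod n = (i + j - 2 + 1) mod n" by (simp add: k mod_simps)
  moreover have "i + j - 2 + 1 = i + j - 1" using assms by auto
  moreover have "k \<in> {1..n}" using n by (simp add: k Suc_leI)
  ultimately show ?thesis by simp
qed

lemma entry_index_admissible:
  assumes "i \<in> {1..n}" "j \<in> {1..n}" "(k, l) = entry_index T n i j"
  shows "k \<in> vector_labels T n \<and> l \<in> {1..vector_dim T n k}"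
proof (cases T)
  case Circulant
  then show ?thesis using assms entry_index_circulant_cong[of i n j k l] by auto
next
  case Reverse_Circulant
  then show ?thesis using assms entry_index_reverse_circulant_cong[of i n j k l] by auto
qed (use assms in \<open>auto simp: Let_def min_def max_def split: if_splits\<close>)

definition gaussian_model ::
    "matrix_type \<Rightarrow> nat \<Rightarrow> 'a measure \<Rightarrow> (nat \<Rightarrow> nat \<Rightarrow> 'a \<Rightarrow> real) \<Rightarrow> bool" where
  "gaussian_model T n M X \<longleftrightarrow>
     prob_space M \<and>
     (\<forall>k\<in>vector_labels T n. centered_gaussian_vector M (vector_dim T n k) (X k)) \<and>
     prob_space.indep_vars M
       (\<lambda>k. \<Pi>\<^sub>M l\<in>{1..vector_dim T n k}. (borel :: real measure))
       (\<lambda>k \<omega>. \<lambda>l\<in>{1..vector_dim T n k}. X k l \<omega>)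
       (vector_labels T n)"

definition coord_cov ::
    "'a measure \<Rightarrow> (nat \<Rightarrow> nat \<Rightarrow> 'a \<Rightarrow> real) \<Rightarrow> nat \<Rightarrow> nat \<Rightarrow> nat \<Rightarrow> real" where
  "coord_cov M X k i j = prob_space.expectation M (\<lambda>\<omega>. X k i \<omega> * X k j \<omega>)"

text \<open>Entries of \<open>Y\<^sub>n\<close>, with 1-based row and column indices.\<close>

definition Y_entry ::
    "matrix_type \<Rightarrow> nat \<Rightarrow> (nat \<Rightarrow> nat \<Rightarrow> 'a \<Rightarrow> real) \<Rightarrow> nat \<Rightarrow> nat \<Rightarrow> 'a \<Rightarrow> real" where
  "Y_entry T n X i j \<omega> = (case entry_index T n i j of (k, l) \<Rightarrow> X k l \<omega>)"

text \<open>Matrices of type \<^typ>\<open>real mat\<close> are 0-based, hence the shift by one.\<close>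

definition Y_mat ::
    "matrix_type \<Rightarrow> nat \<Rightarrow> (nat \<Rightarrow> nat \<Rightarrow> 'a \<Rightarrow> real) \<Rightarrow> 'a \<Rightarrow> real mat" where
  "Y_mat T n X \<omega> = Matrix.mat n n (\<lambda>(i, j). Y_entry T n X (i + 1) (j + 1) \<omega>)"

definition X_mat ::
    "matrix_type \<Rightarrow> nat \<Rightarrow> (nat \<Rightarrow> nat \<Rightarrow> 'a \<Rightarrow> real) \<Rightarrow> 'a \<Rightarrow> real mat" where
  "X_mat T n X \<omega> = (1 / sqrt (real n)) \<cdot>\<^sub>m Y_mat T n X \<omega>"

definition mat_trace :: "'a :: comm_monoid_add mat \<Rightarrow> 'a" where
  "mat_trace A = (\<Sum>i<dim_row A. A $$ (i, i))"

definition trace_power ::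
    "matrix_type \<Rightarrow> nat \<Rightarrow> (nat \<Rightarrow> nat \<Rightarrow> 'a \<Rightarrow> real) \<Rightarrow> nat \<Rightarrow> 'a \<Rightarrow> real" where
  "trace_power T n X p \<omega> = mat_trace (X_mat T n X \<omega> ^\<^sub>m p)"

definition standardized :: "'a measure \<Rightarrow> ('a \<Rightarrow> real) \<Rightarrow> 'a \<Rightarrow> real" where
  "standardized M W \<omega> =
     (W \<omega> - prob_space.expectation M W) / sqrt (prob_space.variance M W)"

end

theory Submission
  imports Defs "HOL-Real_Asymp.Real_Asymp"
begin

text \<open>
  Expanding the trace writes \<open>W\<close> as a sum over closed walks of monomials in the Gaussian entries.
  Gaussian integration by parts, applied repeatedly to the monomials of one factor, produces a random
  variable \<open>T\<close> with \<open>E((W - E W) f(W)) = E(T f'(W))\<close> for all smooth Lipschitz \<open>f\<close>; \<open>T\<close> is a sum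
  over pairs of walks, some of whose steps are contracted, with at least one contraction joining the two
  walks. Stein's method bounds the total variation distance of the standardized \<open>W\<close> to the normal law
  by \<open>2 (Var T)\<^sup>1\<^sup>/\<^sup>2 / Var W\<close>.

  By Wick's formula a covariance of two terms of \<open>T\<close> vanishes unless the steps of the four walks involved
  can be matched in pairs of equal label so that the four walks become connected. Every walk but the last in
  a suitable order then has a step that is matched with a later walk; as its closing step this one costs
  nothing, which leaves \<open>O(n\<^sup>2\<^sup>p\<^sup>+\<^sup>1)\<close> quadruples of walks. In the other direction all covariances are
  nonnegative, and shifting a walk (alternately up and down for the reverse circulant and Hankel types,
  where \<open>p\<close> has to be even for the shifted walk to close up) gives of order \<open>n\<^sup>p\<^sup>+\<^sup>1\<close> pairs of walks
  with equal label sequences, each contributing at least \<open>\<gamma>\<^sup>p\<close> to the unnormalized variance of \<open>W\<close>. The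
  distance is therefore of order \<open>n\<^sup>-\<^sup>1\<^sup>/\<^sup>2\<close>.
\<close>

section \<open>Fourier uniqueness and independence\<close>

text \<open>Covariance matrices may be singular, so the entries need not have a joint density, and
  joint normality is given only through linear combinations. Both obstacles are bypassed by working
  in one entry at a time: its variance is at least \<gamma>, and characteristic functions show that
  what the projection on it leaves over is independent of it.

  The rate is a balance of exponents. Four walks have 4p vertices. A matching of their 4p steps has
  2p pairs, and the later step of a pair fixes its end vertex up to two choices; at most one pair is
  lost to a closing step, so 4p - (2p - 1) = 2p + 1 vertices stay free. Thus Var T is at most of
  order \<kappa>^4 n^(2p+1), while Var W is at least of order \<kappa>^2 n^(p+1). The normalization
  \<kappa> = n^(-p/2) cancels between the square root of Var T and Var W, and since a lower bound on
  Var W suffices, its limit never has to be computed. The lower bound meets no cancellation: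
  \<gamma> > 0 makes every covariance of entries nonnegative, hence also every term of the Wick
  expansions.\<close>

context prob_space begin

text \<open>As E U = 0 (the case t = 0) and 1 + U is nonnegative, 1 + U is a probability density.
  The hypothesis says that Y has the same characteristic function under the tilted measure as under
  M, and Levy's uniqueness theorem identifies the two laws of Y.\<close>

lemma weighted_fourier_zero_real:
  fixes U Y :: "'a \<Rightarrow> real"
  assumes [measurable]: "U \<in> borel_measurable M" "Y \<in> borel_measurable M"
    and bound: "\<And>\<omega>. \<bar>U \<omega>\<bar> \<le> 1"
    and zero: "\<And>t. (\<integral>\<omega>. complex_of_real (U \<omega>) * iexp (t * Y \<omega>) \<partial>M) = 0"
    and B: "B \<in> sets borel"
  shows "(\<integral>\<omega>. U \<omega> * indicator B (Y \<omega>) \<partial>M) = 0"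
proof -
  note [measurable] = B
  have intU: "integrable M U"
    by (rule integrable_const_bound[where B=1]) (use bound in auto)
  have intUe: "integrable M (\<lambda>\<omega>. complex_of_real (U \<omega>) * iexp (t * Y \<omega>))" for t
    by (rule integrable_const_bound[where B=1]) (use bound in \<open>auto simp: norm_mult\<close>)
  have intE: "integrable M (\<lambda>\<omega>. iexp (t * Y \<omega>))" for t
    by (rule integrable_const_bound[where B=1]) auto
  have EU: "(\<integral>\<omega>. U \<omega> \<partial>M) = 0"
    using zero[of 0] by simp
  have nonneg: "0 \<le> 1 + U \<omega>" for \<omega> using bound[of \<omega>] by linarith
  define D where "D = density M (\<lambda>\<omega>. ennreal (1 + U \<omega>))"
  have "emeasure D (space D) = (\<integral>\<^sup>+\<omega>. ennreal (1 + U \<omega>) \<partial>M)"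
    unfolding D_def by (simp add: emeasure_density cong: nn_integral_cong)
  also have "\<dots> = ennreal (\<integral>\<omega>. 1 + U \<omega> \<partial>M)"
    by (rule nn_integral_eq_integral) (use intU nonneg in auto)
  also have "\<dots> = 1" using intU EU by (simp add: prob_space)
  finally have "prob_space D" by (rule prob_spaceI)
  then interpret D: prob_space D .
  have [measurable]: "Y \<in> borel_measurable D" unfolding D_def by simp
  define N1 where "N1 = distr D borel Y"
  define N2 where "N2 = distr M borel Y"
  have r1: "real_distribution N1" unfolding N1_def
    by (intro real_distribution.intro D.prob_space_distr real_distribution_axioms.intro) auto
  have r2: "real_distribution N2" unfolding N2_def
    by (intro real_distribution.intro prob_space_distr real_distribution_axioms.intro) auto
  have "char N1 t = char N2 t" for t
  proof -
    have "char N1 t = (\<integral>\<omega>. iexp (t * Y \<omega>) \<partial>D)"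
      unfolding char_def N1_def by (subst integral_distr) auto
    also have "\<dots> = (\<integral>\<omega>. (1 + U \<omega>) *\<^sub>R iexp (t * Y \<omega>) \<partial>M)"
      unfolding D_def by (subst integral_density) (use nonneg in auto)
    also have "\<dots> = (\<integral>\<omega>. iexp (t * Y \<omega>) + complex_of_real (U \<omega>) * iexp (t * Y \<omega>) \<partial>M)"
      by (intro Bochner_Integration.integral_cong) (auto simp: scaleR_conv_of_real algebra_simps)
    also have "\<dots> = (\<integral>\<omega>. iexp (t * Y \<omega>) \<partial>M)"
      by (subst Bochner_Integration.integral_add[OF intE intUe]) (use zero[of t] in simp)
    also have "\<dots> = char N2 t"
      unfolding char_def N2_def by (subst integral_distr) auto
    finally show ?thesis .
  qed
  then have eq: "N1 = N2" by (intro Levy_uniqueness r1 r2) auto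
  have "(\<integral>y. indicator B y \<partial>N1 :: real) = (\<integral>\<omega>. (1 + U \<omega>) * indicator B (Y \<omega>) \<partial>M)"
  proof -
    have "(\<integral>y. indicator B y \<partial>N1 :: real) = (\<integral>\<omega>. indicator B (Y \<omega>) \<partial>D)"
      unfolding N1_def by (subst integral_distr) auto
    also have "\<dots> = (\<integral>\<omega>. (1 + U \<omega>) *\<^sub>R indicator B (Y \<omega>) \<partial>M)"
      unfolding D_def by (subst integral_density) (use nonneg in auto)
    finally show ?thesis by simp
  qed
  moreover have "(\<integral>y. indicator B y \<partial>N2 :: real) = (\<integral>\<omega>. indicator B (Y \<omega>) \<partial>M :: real)"
    unfolding N2_def by (subst integral_distr) auto
  moreover have "(\<integral>\<omega>. (1 + U \<omega>) * indicator B (Y \<omega>) \<partial>M) =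
      (\<integral>\<omega>. indicator B (Y \<omega>) \<partial>M) + (\<integral>\<omega>. U \<omega> * indicator B (Y \<omega>) \<partial>M)"
    unfolding distrib_right
    by (subst Bochner_Integration.integral_add)
       (auto intro!: integrable_const_bound[where B=1] simp: indicator_def bound)
  ultimately show ?thesis using eq by simp
qed

lemma borel_measurable_cnj [measurable]: "cnj \<in> borel_measurable borel"
  by (intro borel_measurable_continuous_onI continuous_intros)

text \<open>Conjugating the hypothesis at -t shows that \<open>cnj U\<close> satisfies it too, hence
  so do the real and imaginary parts of U. Complex weights are wanted because exponentials of
  further variables will be absorbed into U.\<close>

lemma weighted_fourier_zero:
  fixes U :: "'a \<Rightarrow> complex" and Y :: "'a \<Rightarrow> real"
  assumes [measurable]: "U \<in> borel_measurable M" "Y \<in> borel_measurable M"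
    and bound: "\<And>\<omega>. norm (U \<omega>) \<le> 1"
    and zero: "\<And>t. (\<integral>\<omega>. U \<omega> * iexp (t * Y \<omega>) \<partial>M) = 0"
    and B: "B \<in> sets borel"
  shows "(\<integral>\<omega>. U \<omega> * indicator B (Y \<omega>) \<partial>M) = 0"
proof -
  note [measurable] = B
  have int: "integrable M (\<lambda>\<omega>. U \<omega> * iexp (t * Y \<omega>))" for t
    by (rule integrable_const_bound[where B=1]) (use bound in \<open>auto simp: norm_mult\<close>)
  have intc: "integrable M (\<lambda>\<omega>. cnj (U \<omega>) * iexp (t * Y \<omega>))" for t
    by (rule integrable_const_bound[where B=1]) (use bound in \<open>auto simp: norm_mult\<close>)
  have zc: "(\<integral>\<omega>. cnj (U \<omega>) * iexp (t * Y \<omega>) \<partial>M) = 0" for t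
  proof -
    have "(\<integral>\<omega>. cnj (U \<omega> * iexp (- t * Y \<omega>)) \<partial>M) = cnj (\<integral>\<omega>. U \<omega> * iexp (- t * Y \<omega>) \<partial>M)"
      by (rule integral_bounded_linear[OF bounded_linear_cnj int])
    moreover have "cnj (U \<omega> * iexp (- t * Y \<omega>)) = cnj (U \<omega>) * iexp (t * Y \<omega>)" for \<omega>
      by (simp add: exp_cnj)
    ultimately show ?thesis using zero[of "- t"] by (simp only: complex_cnj_zero)
  qed
  have re: "(\<integral>\<omega>. Re (U \<omega>) * indicator B (Y \<omega>) \<partial>M) = 0"
  proof (rule weighted_fourier_zero_real)
    fix t
    have eq: "complex_of_real (Re (U \<omega>)) * iexp (t * Y \<omega>)
        = (1/2) * (U \<omega> * iexp (t * Y \<omega>) + cnj (U \<omega>) * iexp (t * Y \<omega>))" for \<omega>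
      by (simp add: complex_add_cnj flip: distrib_right)
    show "(\<integral>\<omega>. complex_of_real (Re (U \<omega>)) * iexp (t * Y \<omega>) \<partial>M) = 0"
      unfolding eq integral_mult_right_zero Bochner_Integration.integral_add[OF int intc] zero zc by simp
  qed (use bound abs_Re_le_cmod order_trans B in \<open>auto intro: order_trans\<close>)
  have ii: "\<i> * (z * (\<i> * w)) = - (z * w)" for z w
  proof -
    have "\<i> * (z * (\<i> * w)) = (\<i> * \<i>) * (z * w)" by (simp only: ac_simps)
    then show ?thesis by simp
  qed
  have im: "(\<integral>\<omega>. Im (U \<omega>) * indicator B (Y \<omega>) \<partial>M) = 0"
  proof (rule weighted_fourier_zero_real)
    fix t
    have eq: "complex_of_real (Im (U \<omega>)) * iexp (t * Y \<omega>)
        = (- \<i>/2) * (U \<omega> * iexp (t * Y \<omega>) - cnj (U \<omega>) * iexp (t * Y \<omega>))" for \<omega>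
      by (simp add: complex_diff_cnj ii flip: left_diff_distrib)
    show "(\<integral>\<omega>. complex_of_real (Im (U \<omega>)) * iexp (t * Y \<omega>) \<partial>M) = 0"
      unfolding eq integral_mult_right_zero Bochner_Integration.integral_diff[OF int intc] zero zc by simp
  qed (use bound abs_Im_le_cmod order_trans B in \<open>auto intro: order_trans\<close>)
  have i: "integrable M (\<lambda>\<omega>. U \<omega> * indicator B (Y \<omega>))"
    by (rule integrable_const_bound[where B=1]) (use bound in \<open>auto simp: norm_mult indicator_def\<close>)
  show ?thesis
  proof (rule complex_eqI)
    show "Re (\<integral>\<omega>. U \<omega> * indicator B (Y \<omega>) \<partial>M) = Re 0"
    proof -
      have "Re (U \<omega> * indicator B (Y \<omega>)) = Re (U \<omega>) * indicator B (Y \<omega>)" for \<omega>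
        by (auto simp: indicator_def)
      then show ?thesis using integral_Re[OF i] re by simp
    qed
    show "Im (\<integral>\<omega>. U \<omega> * indicator B (Y \<omega>) \<partial>M) = Im 0"
    proof -
      have "Im (U \<omega> * indicator B (Y \<omega>)) = Im (U \<omega>) * indicator B (Y \<omega>)" for \<omega>
        by (auto simp: indicator_def)
      then show ?thesis using integral_Im[OF i] im by simp
    qed
  qed
qed

text \<open>Exponentials are traded for indicators one coordinate at a time. The exponentials still
  present and the indicators already obtained are absorbed into the weight, whose norm stays at most
  1.\<close>

lemma weighted_fourier_zero_vector:
  fixes U :: "'a \<Rightarrow> complex" and Y :: "'i \<Rightarrow> 'a \<Rightarrow> real"
  assumes "finite J" and "U \<in> borel_measurable M"
    and Y: "\<And>y. y \<in> J \<Longrightarrow> Y y \<in> borel_measurable M"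
    and "\<And>\<omega>. norm (U \<omega>) \<le> 1"
    and "\<And>t. (\<integral>\<omega>. U \<omega> * iexp (\<Sum>y\<in>J. t y * Y y \<omega>) \<partial>M) = 0"
    and "\<And>y. y \<in> J \<Longrightarrow> B y \<in> sets borel"
  shows "(\<integral>\<omega>. U \<omega> * (\<Prod>y\<in>J. indicator (B y) (Y y \<omega>)) \<partial>M) = 0"
  using assms
proof (induction J arbitrary: U rule: finite_induct)
  case empty
  from empty.prems(4)[of undefined] show ?case by simp
next
  case (insert j J)
  note [measurable] = insert.prems(1)
  have [measurable]: "Y j \<in> borel_measurable M" "B j \<in> sets borel"
    "\<And>y. y \<in> J \<Longrightarrow> Y y \<in> borel_measurable M"
    using insert.prems by auto
  have "(\<integral>\<omega>. (U \<omega> * indicator (B j) (Y j \<omega>)) * (\<Prod>y\<in>J. indicator (B y) (Y y \<omega>)) \<partial>M) = 0"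
  proof (rule insert.IH)
    fix t
    have "(\<integral>\<omega>. (U \<omega> * iexp (\<Sum>y\<in>J. t y * Y y \<omega>)) * indicator (B j) (Y j \<omega>) \<partial>M) = 0"
    proof (rule weighted_fourier_zero)
      fix s
      have "(U \<omega> * iexp (\<Sum>y\<in>J. t y * Y y \<omega>)) * iexp (s * Y j \<omega>)
          = U \<omega> * iexp (\<Sum>y\<in>insert j J. (t(j := s)) y * Y y \<omega>)" for \<omega>
      proof -
        have "(\<Sum>y\<in>J. (t(j := s)) y * Y y \<omega>) = (\<Sum>y\<in>J. t y * Y y \<omega>)"
          using insert.hyps by (intro sum.cong) auto
        then show ?thesis
          using insert.hyps by (simp add: exp_add[symmetric] distrib_left algebra_simps)
      qed
      then show "(\<integral>\<omega>. (U \<omega> * iexp (\<Sum>y\<in>J. t y * Y y \<omega>)) * iexp (s * Y j \<omega>) \<partial>M) = 0"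
        using insert.prems(4)[of "t(j := s)"] by (simp only:)
    qed (use insert.prems in \<open>auto simp: norm_mult\<close>)
    then show "(\<integral>\<omega>. (U \<omega> * indicator (B j) (Y j \<omega>)) * iexp (\<Sum>y\<in>J. t y * Y y \<omega>) \<partial>M) = 0"
      by (simp add: ac_simps)
  next
    show "norm (U \<omega> * indicator (B j) (Y j \<omega>)) \<le> 1" for \<omega>
      using insert.prems(3)[of \<omega>] by (simp add: norm_mult indicator_def)
  qed (use insert.prems in auto)
  then show ?case using insert.hyps by (simp add: ac_simps)
qed

text \<open>The trade of exponentials for indicators is made for V, with the centred exponential of
  the other variables as weight, and then for those variables, with the centred indicator of the
  event that V lies in A as weight.\<close>

lemma prob_rectangle_from_char:
  fixes V :: "'a \<Rightarrow> real" and R :: "'i \<Rightarrow> 'a \<Rightarrow> real"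
  assumes J: "finite J" and [measurable]: "V \<in> borel_measurable M"
    and R [measurable]: "\<And>y. y \<in> J \<Longrightarrow> R y \<in> borel_measurable M"
    and char: "\<And>u t. (\<integral>\<omega>. iexp (u * V \<omega> + (\<Sum>y\<in>J. t y * R y \<omega>)) \<partial>M) =
      (\<integral>\<omega>. iexp (u * V \<omega>) \<partial>M) * (\<integral>\<omega>. iexp (\<Sum>y\<in>J. t y * R y \<omega>) \<partial>M)"
    and A [measurable]: "A \<in> sets borel" and B: "\<And>y. y \<in> J \<Longrightarrow> B y \<in> sets borel"
  shows "prob {\<omega>\<in>space M. V \<omega> \<in> A \<and> (\<forall>y\<in>J. R y \<omega> \<in> B y)} =
    prob {\<omega>\<in>space M. V \<omega> \<in> A} * prob {\<omega>\<in>space M. \<forall>y\<in>J. R y \<omega> \<in> B y}"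
proof -
  note [measurable] = B
  define pA where "pA = prob {\<omega>\<in>space M. V \<omega> \<in> A}"
  have pA: "0 \<le> pA" "pA \<le> 1" by (auto simp: pA_def)
  have i1: "(\<integral>\<omega>. of_bool (Q \<omega>) \<partial>M :: complex) = prob {\<omega>\<in>space M. Q \<omega>}"
    if [measurable]: "Measurable.pred M Q" for Q
  proof -
    have "(\<integral>\<omega>. of_bool (Q \<omega>) \<partial>M :: complex) = (\<integral>\<omega>. complex_of_real (indicator {\<omega>\<in>space M. Q \<omega>} \<omega>) \<partial>M)"
      by (intro Bochner_Integration.integral_cong) (auto simp: indicator_def)
    also have "\<dots> = complex_of_real (\<integral>\<omega>. indicator {\<omega>\<in>space M. Q \<omega>} \<omega> \<partial>M)"
      by (rule integral_complex_of_real)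
    finally show ?thesis by simp
  qed
  have iA: "(\<integral>\<omega>. indicator A (V \<omega>) \<partial>M :: complex) = pA"
    using i1[of "\<lambda>\<omega>. V \<omega> \<in> A"] unfolding pA_def by (simp add: indicator_def)
  have int: "integrable M (\<lambda>\<omega>. iexp (\<Sum>y\<in>J. t y * R y \<omega>))" for t
    by (rule integrable_const_bound[where B=1]) auto
  have intu: "integrable M (\<lambda>\<omega>. iexp (u * V \<omega>))" for u
    by (rule integrable_const_bound[where B=1]) auto
  have intut: "integrable M (\<lambda>\<omega>. iexp (u * V \<omega> + (\<Sum>y\<in>J. t y * R y \<omega>)))" for u t
    by (rule integrable_const_bound[where B=1]) auto
  have intA: "integrable M (\<lambda>\<omega>. indicator A (V \<omega>) :: complex)"
    by (rule integrable_const_bound[where B=1]) (auto simp: indicator_def)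
  have intAt: "integrable M (\<lambda>\<omega>. iexp (\<Sum>y\<in>J. t y * R y \<omega>) * indicator A (V \<omega>))" for t
    by (rule integrable_const_bound[where B=1]) (auto simp: indicator_def)
  have step1: "(\<integral>\<omega>. iexp (\<Sum>y\<in>J. t y * R y \<omega>) * indicator A (V \<omega>) \<partial>M) =
      (\<integral>\<omega>. iexp (\<Sum>y\<in>J. t y * R y \<omega>) \<partial>M) * pA" for t
  proof -
    define E where "E = (\<integral>\<omega>. iexp (\<Sum>y\<in>J. t y * R y \<omega>) \<partial>M)"
    have E: "norm E \<le> 1"
    proof -
      have "norm E \<le> (\<integral>\<omega>. norm (iexp (\<Sum>y\<in>J. t y * R y \<omega>)) \<partial>M)"
        unfolding E_def by (rule integral_norm_bound)
      then show ?thesis by (simp add: prob_space)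
    qed
    \<comment> \<open>The factor 1/2 brings the norm of the centred weight down to at most
      1.\<close>
    have "(\<integral>\<omega>. (iexp (\<Sum>y\<in>J. t y * R y \<omega>) - E) / 2 * indicator A (V \<omega>) \<partial>M) = 0"
    proof (rule weighted_fourier_zero)
      show "norm ((iexp (\<Sum>y\<in>J. t y * R y \<omega>) - E) / 2) \<le> 1" for \<omega>
        using norm_triangle_ineq4[of "iexp (\<Sum>y\<in>J. t y * R y \<omega>)" E] E by (simp add: norm_divide)
      fix u
      have eq: "(iexp (\<Sum>y\<in>J. t y * R y \<omega>) - E) / 2 * iexp (u * V \<omega>) =
          (iexp (u * V \<omega> + (\<Sum>y\<in>J. t y * R y \<omega>)) - E * iexp (u * V \<omega>)) / 2" for \<omega>
        by (simp add: field_simps exp_add)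
      show "(\<integral>\<omega>. (iexp (\<Sum>y\<in>J. t y * R y \<omega>) - E) / 2 * iexp (u * V \<omega>) \<partial>M) = 0"
        unfolding eq integral_divide_zero
          Bochner_Integration.integral_diff[OF intut integrable_mult_right[OF intu]] char
        by (simp add: E_def del: of_real_add of_real_sum of_real_mult)
    qed auto
    then have "(\<integral>\<omega>. (iexp (\<Sum>y\<in>J. t y * R y \<omega>) * indicator A (V \<omega>) - E * indicator A (V \<omega>)) / 2 \<partial>M) = 0"
      by (simp add: field_simps)
    then show ?thesis
      unfolding integral_divide_zero
          Bochner_Integration.integral_diff[OF intAt integrable_mult_right[OF intA]]
      by (simp add: E_def iA del: of_real_add of_real_sum of_real_mult)
  qed
  have step2: "(\<integral>\<omega>. (indicator A (V \<omega>) - complex_of_real pA) * (\<Prod>y\<in>J. indicator (B y) (R y \<omega>)) \<partial>M) = 0"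
  proof (rule weighted_fourier_zero_vector[OF J])
    show "norm (indicator A (V \<omega>) - complex_of_real pA) \<le> 1" for \<omega>
    proof -
      have "indicator A (V \<omega>) - complex_of_real pA = of_real (indicator A (V \<omega>) - pA)"
        by (simp add: indicator_def)
      then have "norm (indicator A (V \<omega>) - complex_of_real pA) = \<bar>indicator A (V \<omega>) - pA\<bar>"
        by (metis norm_of_real)
      then show ?thesis using pA by (auto simp: indicator_def)
    qed
    fix t
    have eq: "(indicator A (V \<omega>) - complex_of_real pA) * iexp (\<Sum>y\<in>J. t y * R y \<omega>) =
        iexp (\<Sum>y\<in>J. t y * R y \<omega>) * indicator A (V \<omega>) - pA * iexp (\<Sum>y\<in>J. t y * R y \<omega>)" for \<omega>
      by (simp add: algebra_simps)
    show "(\<integral>\<omega>. (indicator A (V \<omega>) - complex_of_real pA) * iexp (\<Sum>y\<in>J. t y * R y \<omega>) \<partial>M) = 0"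
      unfolding eq Bochner_Integration.integral_diff[OF intAt integrable_mult_right[OF int]] step1
      by simp
  qed auto
  have ind: "(\<Prod>y\<in>J. indicator (B y) (R y \<omega>) :: complex) = of_bool (\<forall>y\<in>J. R y \<omega> \<in> B y)" for \<omega>
    using J by (auto simp: indicator_def of_bool_def prod_zero_iff intro!: prod.neutral)
  have ib: "integrable M (\<lambda>\<omega>. of_bool (Q \<omega>) :: complex)" if [measurable]: "Measurable.pred M Q" for Q
    by (rule integrable_const_bound[where B=1]) auto
  have [measurable]: "Measurable.pred M (\<lambda>\<omega>. \<forall>y\<in>J. R y \<omega> \<in> B y)"
    using J by measurable
  have "(\<integral>\<omega>. of_bool (V \<omega> \<in> A \<and> (\<forall>y\<in>J. R y \<omega> \<in> B y)) - complex_of_real pA * of_bool (\<forall>y\<in>J. R y \<omega> \<in> B y) \<partial>M) =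
    (\<integral>\<omega>. (indicator A (V \<omega>) - complex_of_real pA) * (\<Prod>y\<in>J. indicator (B y) (R y \<omega>)) \<partial>M)"
    unfolding ind by (intro Bochner_Integration.integral_cong) (auto simp: indicator_def algebra_simps)
  also have "\<dots> = 0" by (rule step2)
  finally have "complex_of_real (prob {\<omega>\<in>space M. V \<omega> \<in> A \<and> (\<forall>y\<in>J. R y \<omega> \<in> B y)}) =
     complex_of_real (pA * prob {\<omega>\<in>space M. \<forall>y\<in>J. R y \<omega> \<in> B y})"
    by (subst (asm) Bochner_Integration.integral_diff)
       (auto simp: i1 intro!: ib integrable_mult_right)
  then show ?thesis unfolding pA_def of_real_eq_iff .
qed

text \<open>Kac's theorem. For a fixed A, the law of R restricted to the event that V lies in A
  agrees on boxes with a multiple of the law of R, hence everywhere. The conclusion is an equality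
  of measures because Fubini's theorem will be applied to it.\<close>

theorem kac_independence:
  fixes V :: "'a \<Rightarrow> real" and R :: "'i \<Rightarrow> 'a \<Rightarrow> real"
  assumes J: "finite J" and V [measurable]: "V \<in> borel_measurable M"
    and R [measurable]: "\<And>y. y \<in> J \<Longrightarrow> R y \<in> borel_measurable M"
    and char: "\<And>u t. (\<integral>\<omega>. iexp (u * V \<omega> + (\<Sum>y\<in>J. t y * R y \<omega>)) \<partial>M) =
      (\<integral>\<omega>. iexp (u * V \<omega>) \<partial>M) * (\<integral>\<omega>. iexp (\<Sum>y\<in>J. t y * R y \<omega>) \<partial>M)"
  shows "distr M borel V \<Otimes>\<^sub>M distr M (Pi\<^sub>M J (\<lambda>_. borel)) (\<lambda>\<omega>. \<lambda>y\<in>J. R y \<omega>) =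
    distr M (borel \<Otimes>\<^sub>M Pi\<^sub>M J (\<lambda>_. borel)) (\<lambda>\<omega>. (V \<omega>, \<lambda>y\<in>J. R y \<omega>))"
proof -
  let ?P = "Pi\<^sub>M J (\<lambda>_. borel :: real measure)"
  let ?R = "\<lambda>\<omega>. \<lambda>y\<in>J. R y \<omega>"
  have mR [measurable]: "?R \<in> measurable M ?P" by measurable
  have "emeasure (distr M borel V) A * emeasure (distr M ?P ?R) B =
      emeasure (distr M (borel \<Otimes>\<^sub>M ?P) (\<lambda>\<omega>. (V \<omega>, ?R \<omega>))) (A \<times> B)"
    if A [measurable]: "A \<in> sets (distr M borel V)" and B: "B \<in> sets (distr M ?P ?R)" for A B
  proof -
    have [measurable]: "A \<in> sets borel" using A by simp
    have [measurable]: "B \<in> sets ?P" using B by simp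
    \<comment> \<open>\<open>D\<close> is M restricted to the event that V lies in A. Its total mass
      is the probability of that event, which \<open>scale_measure\<close> accounts for.\<close>
    define D where "D = density M (\<lambda>\<omega>. indicator A (V \<omega>))"
    define c where "c = emeasure (distr M borel V) A"
    have mD [measurable]: "?R \<in> measurable D ?P" unfolding D_def by simp
    have "distr D ?P ?R = scale_measure c (distr M ?P ?R)"
    proof (rule measure_eqI_PiM_finite[OF J, where A="\<lambda>_. Pi\<^sub>E J (\<lambda>_. UNIV)"])
      fix E assume E: "\<And>i. i \<in> J \<Longrightarrow> E i \<in> sets (borel :: real measure)"
      have mE [measurable]: "Pi\<^sub>E J E \<in> sets ?P" using E J by (intro sets_PiM_I_finite) auto
      have eq: "?R -` Pi\<^sub>E J E \<inter> space M = {\<omega>\<in>space M. \<forall>y\<in>J. R y \<omega> \<in> E y}"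
        by (auto simp: PiE_def Pi_def)
      have [measurable]: "{\<omega>\<in>space M. \<forall>y\<in>J. R y \<omega> \<in> E y} \<in> sets M"
        using measurable_sets[OF mR mE] unfolding eq .
      have "emeasure (distr D ?P ?R) (Pi\<^sub>E J E) = emeasure D (?R -` Pi\<^sub>E J E \<inter> space D)"
        by (rule emeasure_distr) auto
      also have "?R -` Pi\<^sub>E J E \<inter> space D = {\<omega>\<in>space M. \<forall>y\<in>J. R y \<omega> \<in> E y}"
        using eq by (simp add: D_def)
      also have "emeasure D \<dots> = (\<integral>\<^sup>+\<omega>. indicator A (V \<omega>) * indicator {\<omega>\<in>space M. \<forall>y\<in>J. R y \<omega> \<in> E y} \<omega> \<partial>M)"
        unfolding D_def by (rule emeasure_density) auto
      also have "\<dots> = (\<integral>\<^sup>+\<omega>. indicator {\<omega>\<in>space M. V \<omega> \<in> A \<and> (\<forall>y\<in>J. R y \<omega> \<in> E y)} \<omega> \<partial>M)"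
        by (intro nn_integral_cong) (auto simp: indicator_def)
      also have "\<dots> = emeasure M {\<omega>\<in>space M. V \<omega> \<in> A \<and> (\<forall>y\<in>J. R y \<omega> \<in> E y)}"
        by (rule nn_integral_indicator) (use J E in measurable)
      also have "\<dots> = ennreal (prob {\<omega>\<in>space M. V \<omega> \<in> A}) * ennreal (prob {\<omega>\<in>space M. \<forall>y\<in>J. R y \<omega> \<in> E y})"
        using prob_rectangle_from_char[OF J V R char \<open>A \<in> sets borel\<close> E]
        by (simp add: emeasure_eq_measure ennreal_mult)
      also have "ennreal (prob {\<omega>\<in>space M. V \<omega> \<in> A}) = c"
        unfolding c_def by (simp add: emeasure_distr emeasure_eq_measure vimage_def Int_def conj_commute)
      also have "ennreal (prob {\<omega>\<in>space M. \<forall>y\<in>J. R y \<omega> \<in> E y}) = emeasure (distr M ?P ?R) (Pi\<^sub>E J E)"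
        by (subst emeasure_distr[OF mR mE]) (simp add: eq emeasure_eq_measure)
      finally show "emeasure (distr D ?P ?R) (Pi\<^sub>E J E) = emeasure (scale_measure c (distr M ?P ?R)) (Pi\<^sub>E J E)"
        unfolding emeasure_scale_measure .
    next
      have "emeasure D (space D) = (\<integral>\<^sup>+\<omega>. indicator A (V \<omega>) * indicator (space M) \<omega> \<partial>M)"
        unfolding D_def by (simp add: emeasure_density)
      also have "\<dots> \<le> (\<integral>\<^sup>+\<omega>. 1 \<partial>M)"
        by (intro nn_integral_mono) (auto simp: indicator_def)
      also have "\<dots> = 1" by (simp add: emeasure_space_1)
      finally have "emeasure D (space D) \<le> 1" .
      then have "emeasure D (space D) \<noteq> \<infinity>" using ennreal_one_less_top leD by fastforce
      moreover have "?R -` space ?P \<inter> space D = space D" using measurable_space[OF mD] by auto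
      ultimately show "emeasure (distr D ?P ?R) (Pi\<^sub>E J (\<lambda>_. UNIV)) \<noteq> \<infinity>" for i :: nat
        using emeasure_distr[OF mD sets.top] by (simp add: space_PiM)
      show "range (\<lambda>_::nat. Pi\<^sub>E J (\<lambda>_. UNIV)) \<subseteq> prod_algebra J (\<lambda>_. borel)"
        by (auto intro!: prod_algebraI_finite J)
    qed (auto simp: space_PiM)
    then have "emeasure (distr D ?P ?R) B = c * emeasure (distr M ?P ?R) B"
      by simp
    moreover have "emeasure (distr D ?P ?R) B = emeasure (distr M (borel \<Otimes>\<^sub>M ?P) (\<lambda>\<omega>. (V \<omega>, ?R \<omega>))) (A \<times> B)"
    proof -
      have s [measurable]: "?R -` B \<inter> space M \<in> sets M" "V -` A \<inter> space M \<in> sets M" by measurable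
      have "emeasure (distr D ?P ?R) B = emeasure D (?R -` B \<inter> space D)"
        by (rule emeasure_distr) auto
      also have "\<dots> = (\<integral>\<^sup>+\<omega>. indicator A (V \<omega>) * indicator (?R -` B \<inter> space M) \<omega> \<partial>M)"
        unfolding D_def by (subst emeasure_density) auto
      also have "\<dots> = (\<integral>\<^sup>+\<omega>. indicator ((V -` A \<inter> space M) \<inter> (?R -` B \<inter> space M)) \<omega> \<partial>M)"
        by (intro nn_integral_cong) (auto simp: indicator_def)
      also have "\<dots> = emeasure M ((V -` A \<inter> space M) \<inter> (?R -` B \<inter> space M))"
        by (rule nn_integral_indicator) auto
      also have "\<dots> = emeasure (distr M (borel \<Otimes>\<^sub>M ?P) (\<lambda>\<omega>. (V \<omega>, ?R \<omega>))) (A \<times> B)"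
        by (subst emeasure_distr) (auto intro!: arg_cong2[where f=emeasure])
      finally show ?thesis .
    qed
    ultimately show ?thesis unfolding c_def by simp
  qed
  then show ?thesis
    by (intro pair_measure_eqI prob_space_imp_sigma_finite prob_space_distr V mR)
       (auto cong: sets_pair_measure_cong)
qed

end

section \<open>Moments and one-dimensional integration by parts\<close>

text \<open>A class closed under sums, products and powers, which turns the integrability conditions
  for polynomials in the entries into applications of \<open>all_moments_intros\<close>.\<close>

definition (in prob_space) all_moments :: "('a \<Rightarrow> real) \<Rightarrow> bool" where
  "all_moments Z \<longleftrightarrow> Z \<in> borel_measurable M \<and> (\<forall>k::nat. integrable M (\<lambda>\<omega>. \<bar>Z \<omega>\<bar> ^ k))"

context prob_space begin

lemma all_moments_measurable: "all_moments Z \<Longrightarrow> Z \<in> borel_measurable M"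
  by (simp add: all_moments_def)

lemma all_moments_integrable: "all_moments Z \<Longrightarrow> integrable M Z"
proof -
  assume Z: "all_moments Z"
  then have "integrable M (\<lambda>\<omega>. \<bar>Z \<omega>\<bar> ^ 1)" unfolding all_moments_def by blast
  then have "integrable M (\<lambda>\<omega>. \<bar>Z \<omega>\<bar>)" by simp
  then show "integrable M Z" by (rule integrable_abs_cancel) (use Z in \<open>simp add: all_moments_def\<close>)
qed

lemma all_moments_bound:
  assumes "all_moments V" and [measurable]: "Z \<in> borel_measurable M" and "\<And>\<omega>. \<bar>Z \<omega>\<bar> \<le> V \<omega>"
  shows "all_moments Z"
  unfolding all_moments_def
proof safe
  fix k
  show "integrable M (\<lambda>\<omega>. \<bar>Z \<omega>\<bar> ^ k)"
  proof (rule Bochner_Integration.integrable_bound)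
    show "integrable M (\<lambda>\<omega>. \<bar>V \<omega>\<bar> ^ k)" using assms(1) by (simp add: all_moments_def)
    show "AE \<omega> in M. norm (\<bar>Z \<omega>\<bar> ^ k) \<le> norm (\<bar>V \<omega>\<bar> ^ k)"
    proof (rule AE_I2)
      fix \<omega>
      have "\<bar>Z \<omega>\<bar> \<le> \<bar>V \<omega>\<bar>" using assms(3)[of \<omega>] by linarith
      then show "norm (\<bar>Z \<omega>\<bar> ^ k) \<le> norm (\<bar>V \<omega>\<bar> ^ k)" by (simp add: power_mono)
    qed
  qed measurable
qed measurable

lemma all_moments_const [simp]: "all_moments (\<lambda>_. c)"
  unfolding all_moments_def by auto

lemma all_moments_mult:
  assumes "all_moments Z" "all_moments V"
  shows "all_moments (\<lambda>\<omega>. Z \<omega> * V \<omega>)"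
  unfolding all_moments_def
proof safe
  note [measurable] = all_moments_measurable[OF assms(1)] all_moments_measurable[OF assms(2)]
  fix k
  show "integrable M (\<lambda>\<omega>. \<bar>Z \<omega> * V \<omega>\<bar> ^ k)"
  proof (rule Bochner_Integration.integrable_bound)
    show "integrable M (\<lambda>\<omega>. \<bar>Z \<omega>\<bar> ^ (2*k) + \<bar>V \<omega>\<bar> ^ (2*k))"
      using assms by (auto simp: all_moments_def)
    have "u * v \<le> u\<^sup>2 + v\<^sup>2" if "0 \<le> u" "0 \<le> v" for u v :: real
      using sum_squares_bound[of u v] mult_nonneg_nonneg[OF that] by linarith
    then have "\<bar>Z \<omega> * V \<omega>\<bar> ^ k \<le> \<bar>Z \<omega>\<bar> ^ (2*k) + \<bar>V \<omega>\<bar> ^ (2*k)" for \<omega>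
      unfolding abs_mult power_mult_distrib mult.commute[of 2 k] power_mult by simp
    then show "AE \<omega> in M. norm (\<bar>Z \<omega> * V \<omega>\<bar> ^ k) \<le> norm (\<bar>Z \<omega>\<bar> ^ (2*k) + \<bar>V \<omega>\<bar> ^ (2*k))"
      by (intro AE_I2) simp
  qed measurable
qed (use assms in \<open>auto simp: all_moments_def\<close>)

lemma all_moments_abs:
  assumes "all_moments Z"
  shows "all_moments (\<lambda>\<omega>. \<bar>Z \<omega>\<bar>)"
  using assms by (auto simp: all_moments_def)

lemma all_moments_add:
  assumes "all_moments Z" "all_moments V"
  shows "all_moments (\<lambda>\<omega>. Z \<omega> + V \<omega>)"
  unfolding all_moments_def
proof safe
  note [measurable] = all_moments_measurable[OF assms(1)] all_moments_measurable[OF assms(2)]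
  fix k
  show "integrable M (\<lambda>\<omega>. \<bar>Z \<omega> + V \<omega>\<bar> ^ k)"
  proof (rule Bochner_Integration.integrable_bound)
    show "integrable M (\<lambda>\<omega>. 2 ^ k * (\<bar>Z \<omega>\<bar> ^ k + \<bar>V \<omega>\<bar> ^ k))"
      using assms by (auto simp: all_moments_def)
    have "\<bar>u + v\<bar> ^ k \<le> 2 ^ k * (\<bar>u\<bar> ^ k + \<bar>v\<bar> ^ k)" for u v :: real
    proof -
      have "\<bar>u + v\<bar> ^ k \<le> (2 * max \<bar>u\<bar> \<bar>v\<bar>) ^ k"
        by (intro power_mono) auto
      also have "\<dots> = 2 ^ k * (max \<bar>u\<bar> \<bar>v\<bar>) ^ k" by (simp add: power_mult_distrib)
      also have "\<dots> \<le> 2 ^ k * (\<bar>u\<bar> ^ k + \<bar>v\<bar> ^ k)"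
        by (intro mult_left_mono) (simp_all add: max_def)
      finally show ?thesis .
    qed
    then show "AE \<omega> in M. norm (\<bar>Z \<omega> + V \<omega>\<bar> ^ k) \<le> norm (2 ^ k * (\<bar>Z \<omega>\<bar> ^ k + \<bar>V \<omega>\<bar> ^ k))"
      by (intro AE_I2) simp
  qed measurable
qed (use assms in \<open>auto simp: all_moments_def\<close>)

lemma all_moments_minus:
  assumes "all_moments Z" "all_moments V"
  shows "all_moments (\<lambda>\<omega>. Z \<omega> - V \<omega>)"
  using all_moments_add[OF assms(1) all_moments_mult[OF all_moments_const[of "-1"] assms(2)]] by simp

lemma all_moments_sum:
  assumes "\<And>i. i \<in> A \<Longrightarrow> all_moments (Z i)"
  shows "all_moments (\<lambda>\<omega>. \<Sum>i\<in>A. Z i \<omega>)"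
  using assms by (induction A rule: infinite_finite_induct) (auto intro: all_moments_add)

lemma all_moments_prod:
  assumes "\<And>i. i \<in> A \<Longrightarrow> all_moments (Z i)"
  shows "all_moments (\<lambda>\<omega>. \<Prod>i\<in>A. Z i \<omega>)"
  using assms by (induction A rule: infinite_finite_induct) (auto intro: all_moments_mult)

lemma all_moments_power:
  assumes "all_moments Z"
  shows "all_moments (\<lambda>\<omega>. Z \<omega> ^ k)"
  using all_moments_prod[of "{..<k}" "\<lambda>_. Z"] assms by simp

lemmas all_moments_intros = all_moments_const all_moments_mult all_moments_add all_moments_minus
  all_moments_sum all_moments_prod all_moments_power all_moments_abs

lemma all_moments_normal:
  assumes "0 < \<sigma>" and "distributed M lborel Z (normal_density 0 \<sigma>)"
  shows "all_moments Z"
  unfolding all_moments_def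
proof safe
  show "Z \<in> borel_measurable M" using distributed_measurable[OF assms(2)] by simp
  fix k
  show "integrable M (\<lambda>\<omega>. \<bar>Z \<omega>\<bar> ^ k)"
    using integrable_normal_moment_abs[OF assms(1), of 0 k]
      distributed_integrable[OF assms(2), of "\<lambda>x. \<bar>x\<bar> ^ k"] by simp
qed

end

section \<open>Functions of polynomial growth and the normal density\<close>

definition poly_growth :: "(real \<Rightarrow> real) \<Rightarrow> bool" where
  "poly_growth g \<longleftrightarrow> (\<exists>A k. \<forall>x. \<bar>g x\<bar> \<le> A * (1 + \<bar>x\<bar>) ^ k)"

lemma poly_growthI: "(\<And>x. \<bar>g x\<bar> \<le> A * (1 + \<bar>x\<bar>) ^ k) \<Longrightarrow> poly_growth g"
  unfolding poly_growth_def by blast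

lemma poly_growthE:
  assumes "poly_growth g"
  obtains A k where "0 \<le> A" "\<And>x. \<bar>g x\<bar> \<le> A * (1 + \<bar>x\<bar>) ^ k"
proof -
  obtain A k where *: "\<And>x. \<bar>g x\<bar> \<le> A * (1 + \<bar>x\<bar>) ^ k" using assms unfolding poly_growth_def by blast
  from *[of 0] have "0 \<le> A" by simp
  with * show ?thesis using that by blast
qed

lemma poly_growth_bound:
  assumes "poly_growth h" "\<And>x. \<bar>g x\<bar> \<le> \<bar>h x\<bar>"
  shows "poly_growth g"
proof -
  obtain A k where A: "0 \<le> A" "\<And>x. \<bar>h x\<bar> \<le> A * (1 + \<bar>x\<bar>) ^ k"
    using assms(1) by (elim poly_growthE) (rule that)
  show ?thesis by (rule poly_growthI[OF order_trans[OF assms(2) A(2)]])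
qed

lemma poly_growth_const [simp]: "poly_growth (\<lambda>_. c)"
  by (rule poly_growthI[of _ "\<bar>c\<bar>" 0]) simp

lemma poly_growth_id [simp]: "poly_growth (\<lambda>x. x)"
  by (rule poly_growthI[of _ 1 1]) simp

lemma poly_growth_mult:
  assumes "poly_growth g" "poly_growth h"
  shows "poly_growth (\<lambda>x. g x * h x)"
proof -
  obtain A k where A: "0 \<le> A" "\<And>x. \<bar>g x\<bar> \<le> A * (1 + \<bar>x\<bar>) ^ k" using assms(1) by (elim poly_growthE) (rule that)
  obtain B l where B: "0 \<le> B" "\<And>x. \<bar>h x\<bar> \<le> B * (1 + \<bar>x\<bar>) ^ l" using assms(2) by (elim poly_growthE) (rule that)
  show ?thesis
  proof (rule poly_growthI)
    fix x
    have "\<bar>g x * h x\<bar> \<le> (A * (1 + \<bar>x\<bar>) ^ k) * (B * (1 + \<bar>x\<bar>) ^ l)"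
      unfolding abs_mult using A B by (intro mult_mono) auto
    then show "\<bar>g x * h x\<bar> \<le> (A * B) * (1 + \<bar>x\<bar>) ^ (k + l)" by (simp add: power_add algebra_simps)
  qed
qed

lemma poly_growth_add:
  assumes "poly_growth g" "poly_growth h"
  shows "poly_growth (\<lambda>x. g x + h x)"
proof -
  obtain A k where A: "0 \<le> A" "\<And>x. \<bar>g x\<bar> \<le> A * (1 + \<bar>x\<bar>) ^ k" using assms(1) by (elim poly_growthE) (rule that)
  obtain B l where B: "0 \<le> B" "\<And>x. \<bar>h x\<bar> \<le> B * (1 + \<bar>x\<bar>) ^ l" using assms(2) by (elim poly_growthE) (rule that)
  show ?thesis
  proof (rule poly_growthI)
    fix x :: real
    have "\<bar>g x\<bar> \<le> A * (1 + \<bar>x\<bar>) ^ (k + l)"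
      by (rule order_trans[OF A(2)]) (intro mult_left_mono power_increasing A, auto)
    moreover have "\<bar>h x\<bar> \<le> B * (1 + \<bar>x\<bar>) ^ (k + l)"
      by (rule order_trans[OF B(2)]) (intro mult_left_mono power_increasing B, auto)
    ultimately show "\<bar>g x + h x\<bar> \<le> (A + B) * (1 + \<bar>x\<bar>) ^ (k + l)" unfolding distrib_right by linarith
  qed
qed

lemma poly_growth_sum:
  assumes "\<And>i. i \<in> A \<Longrightarrow> poly_growth (g i)"
  shows "poly_growth (\<lambda>x. \<Sum>i\<in>A. g i x)"
  using assms by (induction A rule: infinite_finite_induct) (auto intro: poly_growth_add)

lemma poly_growth_prod:
  assumes "\<And>i. i \<in> A \<Longrightarrow> poly_growth (g i)"
  shows "poly_growth (\<lambda>x. \<Prod>i\<in>A. g i x)"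
  using assms by (induction A rule: infinite_finite_induct) (auto intro: poly_growth_mult)

lemmas poly_growth_intros = poly_growth_const poly_growth_id poly_growth_mult poly_growth_add
  poly_growth_sum poly_growth_prod

lemma power_le_fact_exp: "0 \<le> x \<Longrightarrow> x ^ k \<le> fact k * exp (x :: real)"
proof -
  assume x: "0 \<le> x"
  have "(\<lambda>n. x ^ n /\<^sub>R fact n) sums exp x" by (rule exp_converges)
  moreover have "(\<Sum>n\<in>{k}. x ^ n /\<^sub>R fact n) \<le> (\<Sum>n. x ^ n /\<^sub>R fact n)"
    by (rule sum_le_suminf) (use x summable_exp_generic[of x] in auto)
  ultimately have "x ^ k /\<^sub>R fact k \<le> exp x" by (simp add: sums_iff)
  then show ?thesis by (simp add: field_simps)
qed

lemma poly_growth_integrable_normal: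
  assumes s: "0 < \<sigma>" and g: "poly_growth g" and [measurable]: "g \<in> borel_measurable borel"
  shows "integrable lborel (\<lambda>x. g x * normal_density 0 \<sigma> x)"
proof -
  interpret N: prob_space "density lborel (normal_density 0 \<sigma>)" by (rule prob_space_normal_density[OF s])
  have "distributed (density lborel (normal_density 0 \<sigma>)) lborel (\<lambda>x. x) (normal_density 0 \<sigma>)"
    unfolding distributed_def by (simp add: distr_id2)
  then have "N.all_moments (\<lambda>x. x)" by (rule N.all_moments_normal[OF s])
  obtain A k where A: "0 \<le> A" "\<And>x. \<bar>g x\<bar> \<le> A * (1 + \<bar>x\<bar>) ^ k" using g by (elim poly_growthE) (rule that)
  have "N.all_moments (\<lambda>x. A * (1 + \<bar>x\<bar>) ^ k)"
    by (intro N.all_moments_intros) fact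
  then have "N.all_moments g" by (rule N.all_moments_bound) (use A in auto)
  then have "integrable (density lborel (normal_density 0 \<sigma>)) g" by (rule N.all_moments_integrable)
  then show ?thesis by (subst (asm) integrable_density) (auto simp: s mult.commute)
qed

text \<open>The k-th power of 1 + |x| is at most \<open>fact k\<close> times exp (1 + |x|), so that
  an explicit function with the decay of the normal density dominates, whatever g is.\<close>

lemma poly_growth_normal_tendsto:
  assumes s: "0 < \<sigma>" and g: "poly_growth g"
  shows "((\<lambda>x. g x * normal_density 0 \<sigma> x) \<longlongrightarrow> 0) at_top"
    and "((\<lambda>x. g x * normal_density 0 \<sigma> x) \<longlongrightarrow> 0) at_bot"
proof -
  obtain A k where A: "0 \<le> A" "\<And>x. \<bar>g x\<bar> \<le> A * (1 + \<bar>x\<bar>) ^ k" using g by (elim poly_growthE) (rule that)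
  define c where "c = 1 / sqrt (2 * pi * \<sigma>\<^sup>2)"
  have c: "0 \<le> c" by (simp add: c_def)
  define b where "b = (\<lambda>x. A * fact k * c * (exp (1 + \<bar>x\<bar>) * exp (- (x^2) / (2 * \<sigma>^2))))"
  have le: "norm (g x * normal_density 0 \<sigma> x) \<le> b x" for x
  proof -
    have "\<bar>g x\<bar> \<le> A * (fact k * exp (1 + \<bar>x\<bar>))"
      using A(1) power_le_fact_exp[of "1 + \<bar>x\<bar>" k] by (intro order_trans[OF A(2)] mult_left_mono) auto
    then have "\<bar>g x\<bar> * (c * exp (- (x^2) / (2 * \<sigma>^2))) \<le> A * (fact k * exp (1 + \<bar>x\<bar>)) * (c * exp (- (x^2) / (2 * \<sigma>^2)))"
      using c by (intro mult_right_mono) auto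
    then show ?thesis using c by (simp add: normal_density_def b_def c_def abs_mult algebra_simps)
  qed
  have "((\<lambda>x::real. exp (1 + \<bar>x\<bar>) * exp (- (x^2) / (2 * \<sigma>^2))) \<longlongrightarrow> 0) at_top"
    using s by real_asymp
  then have "(b \<longlongrightarrow> 0) at_top" unfolding b_def by (rule tendsto_mult_right_zero)
  then show "((\<lambda>x. g x * normal_density 0 \<sigma> x) \<longlongrightarrow> 0) at_top"
    by (rule Lim_null_comparison[rotated]) (use le in auto)
  have "((\<lambda>x::real. exp (1 + \<bar>x\<bar>) * exp (- (x^2) / (2 * \<sigma>^2))) \<longlongrightarrow> 0) at_bot"
    using s by real_asymp
  then have "(b \<longlongrightarrow> 0) at_bot" unfolding b_def by (rule tendsto_mult_right_zero)
  then show "((\<lambda>x. g x * normal_density 0 \<sigma> x) \<longlongrightarrow> 0) at_bot"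
    by (rule Lim_null_comparison[rotated]) (use le in auto)
qed

lemma normal_density_deriv:
  assumes "0 < \<sigma>"
  shows "(normal_density 0 \<sigma> has_real_derivative (- x / \<sigma>\<^sup>2 * normal_density 0 \<sigma> x)) (at x)"
proof -
  define c where "c = 1 / sqrt (2 * pi * \<sigma>\<^sup>2)"
  have "normal_density 0 \<sigma> = (\<lambda>x. c * exp (- x\<^sup>2 / (2 * \<sigma>\<^sup>2)))"
    by (simp add: normal_density_def c_def fun_eq_iff)
  then show ?thesis using assms
    by (auto intro!: derivative_eq_intros simp: power2_eq_square)
qed

text \<open>The integrand \<open>F'\<close> below is the derivative of g times the density. Its
  integral over the whole line is zero, since polynomial growth lets the boundary terms
  vanish.\<close>

lemma normal_integration_by_parts:
  fixes g g' :: "real \<Rightarrow> real"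
  assumes s: "0 < \<sigma>"
    and deriv: "\<And>x. (g has_real_derivative g' x) (at x)" and cont: "\<And>x. isCont g' x"
    and growth: "poly_growth g" "poly_growth g'"
  shows "(\<integral>x. x * g x * normal_density 0 \<sigma> x \<partial>lborel) = \<sigma>\<^sup>2 * (\<integral>x. g' x * normal_density 0 \<sigma> x \<partial>lborel)"
proof -
  have contg: "isCont g x" for x using deriv by (rule DERIV_isCont)
  have [measurable]: "g \<in> borel_measurable borel" "g' \<in> borel_measurable borel"
    by (auto intro!: borel_measurable_continuous_onI simp: continuous_on_eq_continuous_at contg cont)
  have contn: "isCont (normal_density 0 \<sigma>) x" for x
    using normal_density_deriv[OF s] by (rule DERIV_isCont)
  have i1: "integrable lborel (\<lambda>x. x * g x * normal_density 0 \<sigma> x)"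
    by (rule poly_growth_integrable_normal[OF s]) (intro poly_growth_intros growth, measurable)
  have i2: "integrable lborel (\<lambda>x. g' x * normal_density 0 \<sigma> x)"
    by (rule poly_growth_integrable_normal[OF s]) (intro growth, measurable)
  define F' where "F' = (\<lambda>x. g' x * normal_density 0 \<sigma> x - (1 / \<sigma>\<^sup>2) * (x * g x * normal_density 0 \<sigma> x))"
  have iF: "integrable lborel F'" unfolding F'_def by (intro Bochner_Integration.integrable_diff i2 integrable_mult_right i1)
  have "(LBINT x=-\<infinity>..\<infinity>. F' x) = 0 - 0"
  proof (rule interval_integral_FTC_integrable)
    fix x
    show "((\<lambda>x. g x * normal_density 0 \<sigma> x) has_vector_derivative F' x) (at x)"
      unfolding has_real_derivative_iff_has_vector_derivative[symmetric] F'_def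
      using DERIV_mult[OF deriv normal_density_deriv[OF s], of x] by (simp add: algebra_simps)
    show "isCont F' x" unfolding F'_def by (intro continuous_intros cont contg contn)
  next
    show "set_integrable lborel (einterval (-\<infinity>) \<infinity>) F'"
      using iF by (simp add: set_integrable_def)
    show "(((\<lambda>x. g x * normal_density 0 \<sigma> x) \<circ> real_of_ereal) \<longlongrightarrow> 0) (at_right (-\<infinity>))"
      unfolding tendsto_compose_filtermap at_right_MInf filtermap_filtermap
      using poly_growth_normal_tendsto(2)[OF s growth(1)] by (simp add: filterlim_def filtermap_filtermap)
    show "(((\<lambda>x. g x * normal_density 0 \<sigma> x) \<circ> real_of_ereal) \<longlongrightarrow> 0) (at_left \<infinity>)"
      unfolding tendsto_compose_filtermap at_left_PInf filtermap_filtermap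
      using poly_growth_normal_tendsto(1)[OF s growth(1)] by (simp add: filterlim_def filtermap_filtermap)
  qed auto
  then have "(\<integral>x. F' x \<partial>lborel) = 0"
    by (simp add: interval_lebesgue_integral_def set_lebesgue_integral_def)
  then have "(\<integral>x. g' x * normal_density 0 \<sigma> x \<partial>lborel) = (1 / \<sigma>\<^sup>2) * (\<integral>x. x * g x * normal_density 0 \<sigma> x \<partial>lborel)"
    unfolding F'_def Bochner_Integration.integral_diff[OF i2 integrable_mult_right[OF i1]] by simp
  moreover have "a = (1 / \<sigma>\<^sup>2) * b \<Longrightarrow> b = \<sigma>\<^sup>2 * a" for a b :: real
    using s by simp
  ultimately show ?thesis by blast
qed

section \<open>Gaussian families\<close>

text \<open>Joint normality enters as the characteristic function of linear combinations, a formula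
  that also holds for degenerate combinations. The single members have to be nondegenerate because
  projecting on \<open>G s\<close> divides by its variance.\<close>

locale gauss_family = prob_space M for M :: "'a measure" +
  fixes I :: "'i set" and G :: "'i \<Rightarrow> 'a \<Rightarrow> real"
  assumes finite_I: "finite I"
    and normal: "\<And>x. x \<in> I \<Longrightarrow> \<exists>\<sigma>>0. distributed M lborel (G x) (normal_density 0 \<sigma>)"
    and char_combination: "\<And>a. (\<integral>\<omega>. iexp (\<Sum>x\<in>I. a x * G x \<omega>) \<partial>M) =
      complex_of_real (exp (- (\<integral>\<omega>. (\<Sum>x\<in>I. a x * G x \<omega>)\<^sup>2 \<partial>M) / 2))"
begin

definition cov :: "'i \<Rightarrow> 'i \<Rightarrow> real" where
  "cov x y = (\<integral>\<omega>. G x \<omega> * G y \<omega> \<partial>M)"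

lemma moments: "x \<in> I \<Longrightarrow> all_moments (G x)"
  using normal all_moments_normal by blast

lemma G_measurable [measurable]: "x \<in> I \<Longrightarrow> G x \<in> borel_measurable M"
  by (rule all_moments_measurable[OF moments])

lemma normal_cov:
  assumes "x \<in> I"
  shows "0 < cov x x" "distributed M lborel (G x) (normal_density 0 (sqrt (cov x x)))"
proof -
  obtain \<sigma> where s: "0 < \<sigma>" and d: "distributed M lborel (G x) (normal_density 0 \<sigma>)"
    using normal[OF assms] by blast
  have "variance (G x) = \<sigma>\<^sup>2" "expectation (G x) = 0"
    using normal_distributed_variance[OF s d] normal_distributed_expectation[OF s d] by auto
  then have "cov x x = \<sigma>\<^sup>2" by (simp add: cov_def power2_eq_square)
  then show "0 < cov x x" "distributed M lborel (G x) (normal_density 0 (sqrt (cov x x)))"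
    using s d by auto
qed

text \<open>By joint normality the residuals of the projection on \<open>G s\<close> are independent of \<open>G s\<close>, so that
  integration by parts in \<open>G s\<close> reduces to the one-dimensional case.\<close>

definition residual :: "'i \<Rightarrow> 'i \<Rightarrow> 'a \<Rightarrow> real" where
  "residual s y \<omega> = G y \<omega> - cov s y / cov s s * G s \<omega>"

lemma residual_moments: "s \<in> I \<Longrightarrow> y \<in> I \<Longrightarrow> all_moments (residual s y)"
  unfolding residual_def by (intro all_moments_intros moments)

lemma residual_measurable [measurable]: "s \<in> I \<Longrightarrow> y \<in> I \<Longrightarrow> residual s y \<in> borel_measurable M"
  by (rule all_moments_measurable[OF residual_moments])

lemma residual_uncorrelated:
  assumes "s \<in> I" "y \<in> I"
  shows "(\<integral>\<omega>. G s \<omega> * residual s y \<omega> \<partial>M) = 0"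
proof -
  have i: "integrable M (\<lambda>\<omega>. G s \<omega> * G y \<omega>)" "integrable M (\<lambda>\<omega>. G s \<omega> * G s \<omega>)"
    by (intro all_moments_integrable all_moments_intros moments assms)+
  have "(\<integral>\<omega>. G s \<omega> * residual s y \<omega> \<partial>M) =
      (\<integral>\<omega>. G s \<omega> * G y \<omega> - cov s y / cov s s * (G s \<omega> * G s \<omega>) \<partial>M)"
    by (simp add: residual_def algebra_simps)
  also have "\<dots> = cov s y - cov s y / cov s s * cov s s"
    unfolding Bochner_Integration.integral_diff[OF i(1) integrable_mult_right[OF i(2)]]
    by (simp add: cov_def)
  finally show ?thesis using normal_cov(1)[OF assms(1)] by simp
qed

text \<open>Makes \<open>char_combination\<close> available for combinations of \<open>G s\<close>
  and its residuals.\<close>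

lemma residual_combination:
  assumes s: "s \<in> I"
  obtains a where "\<And>\<omega>. u * G s \<omega> + (\<Sum>y\<in>I. t y * residual s y \<omega>) = (\<Sum>x\<in>I. a x * G x \<omega>)"
proof -
  define a where "a = (\<lambda>x. t x + (if x = s then u - (\<Sum>y\<in>I. t y * cov s y / cov s s) else 0))"
  have "(\<Sum>x\<in>I. a x * G x \<omega>) = u * G s \<omega> + (\<Sum>y\<in>I. t y * residual s y \<omega>)" for \<omega>
  proof -
    have "(\<Sum>x\<in>I. a x * G x \<omega>) = (\<Sum>x\<in>I. t x * G x \<omega>) +
        (\<Sum>x\<in>I. (if x = s then (u - (\<Sum>y\<in>I. t y * cov s y / cov s s)) * G x \<omega> else 0))"
      unfolding a_def distrib_right sum.distrib by (intro arg_cong2[where f="(+)"] sum.cong) auto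
    also have "(\<Sum>x\<in>I. (if x = s then (u - (\<Sum>y\<in>I. t y * cov s y / cov s s)) * G x \<omega> else 0)) =
        (u - (\<Sum>y\<in>I. t y * cov s y / cov s s)) * G s \<omega>"
      using s finite_I by simp
    finally show ?thesis
      by (simp add: residual_def right_diff_distrib left_diff_distrib sum_subtractf sum_distrib_right mult.assoc)
  qed
  then show thesis using that[of a] by metis
qed

text \<open>The characteristic function of a combination depends on its second moment only. The
  cross term between \<open>G s\<close> and the residuals vanishes there, so the exponential
  factorizes. The residuals run over all of \<open>I\<close>; the one of \<open>G s\<close> itself
  is zero.\<close>

lemma residual_joint_distr:
  assumes s: "s \<in> I"
  shows "distr M borel (G s) \<Otimes>\<^sub>M distr M (Pi\<^sub>M I (\<lambda>_. borel)) (\<lambda>\<omega>. \<lambda>y\<in>I. residual s y \<omega>) =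
    distr M (borel \<Otimes>\<^sub>M Pi\<^sub>M I (\<lambda>_. borel)) (\<lambda>\<omega>. (G s \<omega>, \<lambda>y\<in>I. residual s y \<omega>))"
proof (rule kac_independence[OF finite_I])
  fix u t
  define Z where "Z = (\<lambda>\<omega>. \<Sum>y\<in>I. t y * residual s y \<omega>)"
  have Z: "all_moments Z" unfolding Z_def by (intro all_moments_intros residual_moments s)
  have char: "(\<integral>\<omega>. iexp (u * G s \<omega> + Z \<omega>) \<partial>M) = complex_of_real (exp (- (\<integral>\<omega>. (u * G s \<omega> + Z \<omega>)\<^sup>2 \<partial>M) / 2))"
    if "Z = (\<lambda>\<omega>. \<Sum>y\<in>I. t y * residual s y \<omega>)" for u t Z
  proof -
    obtain a where "\<And>\<omega>. u * G s \<omega> + (\<Sum>y\<in>I. t y * residual s y \<omega>) = (\<Sum>x\<in>I. a x * G x \<omega>)"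
      by (rule residual_combination[OF s, of u t]) (rule that)
    then show ?thesis using char_combination[of a] unfolding that by simp
  qed
  have i: "integrable M (\<lambda>\<omega>. (G s \<omega>)\<^sup>2)" "integrable M (\<lambda>\<omega>. G s \<omega> * Z \<omega>)" "integrable M (\<lambda>\<omega>. (Z \<omega>)\<^sup>2)"
    by (intro all_moments_integrable all_moments_intros moments s Z)+
  have "(\<integral>\<omega>. G s \<omega> * Z \<omega> \<partial>M) = (\<integral>\<omega>. (\<Sum>y\<in>I. t y * (G s \<omega> * residual s y \<omega>)) \<partial>M)"
    unfolding Z_def by (simp add: sum_distrib_left ac_simps)
  also have "\<dots> = (\<Sum>y\<in>I. \<integral>\<omega>. t y * (G s \<omega> * residual s y \<omega>) \<partial>M)"
    by (intro Bochner_Integration.integral_sum all_moments_integrable all_moments_intros moments s residual_moments)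
  also have "\<dots> = 0"
    using residual_uncorrelated[OF s] by simp
  finally have cross: "(\<integral>\<omega>. G s \<omega> * Z \<omega> \<partial>M) = 0" .
  have "(\<integral>\<omega>. (u * G s \<omega> + Z \<omega>)\<^sup>2 \<partial>M) = (\<integral>\<omega>. u\<^sup>2 * (G s \<omega>)\<^sup>2 + 2 * u * (G s \<omega> * Z \<omega>) + (Z \<omega>)\<^sup>2 \<partial>M)"
    by (simp add: power2_eq_square algebra_simps)
  also have "\<dots> = u\<^sup>2 * (\<integral>\<omega>. (G s \<omega>)\<^sup>2 \<partial>M) + 2 * u * (\<integral>\<omega>. G s \<omega> * Z \<omega> \<partial>M) + (\<integral>\<omega>. (Z \<omega>)\<^sup>2 \<partial>M)"
    using i by simp
  finally have sq: "(\<integral>\<omega>. (u * G s \<omega> + Z \<omega>)\<^sup>2 \<partial>M) = u\<^sup>2 * (\<integral>\<omega>. (G s \<omega>)\<^sup>2 \<partial>M) + (\<integral>\<omega>. (Z \<omega>)\<^sup>2 \<partial>M)"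
    by (simp add: cross)
  have 1: "(\<integral>\<omega>. iexp (u * G s \<omega>) \<partial>M) = complex_of_real (exp (- (u\<^sup>2 * (\<integral>\<omega>. (G s \<omega>)\<^sup>2 \<partial>M)) / 2))"
    using char[of "\<lambda>_. 0" "\<lambda>_. 0" u] by (simp add: power_mult_distrib)
  have 2: "(\<integral>\<omega>. iexp (Z \<omega>) \<partial>M) = complex_of_real (exp (- (\<integral>\<omega>. (Z \<omega>)\<^sup>2 \<partial>M) / 2))"
    using char[of Z t 0, OF Z_def] by simp
  show "(\<integral>\<omega>. iexp (u * G s \<omega> + (\<Sum>y\<in>I. t y * residual s y \<omega>)) \<partial>M) =
      (\<integral>\<omega>. iexp (u * G s \<omega>) \<partial>M) * (\<integral>\<omega>. iexp (\<Sum>y\<in>I. t y * residual s y \<omega>) \<partial>M)"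
    unfolding Z_def[symmetric, THEN fun_cong] char[OF Z_def] 1 2 sq of_real_mult[symmetric] exp_add[symmetric]
    by (simp add: field_simps)
qed (use s in auto)

text \<open>Under the product law the residuals can be frozen at a value r by Fubini's theorem. For
  each r the identity is the one-dimensional integration by parts in x.\<close>

lemma integration_by_parts_residual:
  fixes h h' :: "real \<Rightarrow> ('i \<Rightarrow> real) \<Rightarrow> real"
  assumes s: "s \<in> I"
    and deriv: "\<And>r x. ((\<lambda>x. h x r) has_real_derivative h' x r) (at x)"
    and cont: "\<And>r x. isCont (\<lambda>x. h' x r) x"
    and growth: "\<And>r. poly_growth (\<lambda>x. h x r)" "\<And>r. poly_growth (\<lambda>x. h' x r)"
    and meas: "(\<lambda>z. h (fst z) (snd z)) \<in> borel_measurable (borel \<Otimes>\<^sub>M Pi\<^sub>M I (\<lambda>_. borel))"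
      "(\<lambda>z. h' (fst z) (snd z)) \<in> borel_measurable (borel \<Otimes>\<^sub>M Pi\<^sub>M I (\<lambda>_. borel))"
    and int: "integrable M (\<lambda>\<omega>. G s \<omega> * h (G s \<omega>) (\<lambda>y\<in>I. residual s y \<omega>))"
      "integrable M (\<lambda>\<omega>. h' (G s \<omega>) (\<lambda>y\<in>I. residual s y \<omega>))"
  shows "(\<integral>\<omega>. G s \<omega> * h (G s \<omega>) (\<lambda>y\<in>I. residual s y \<omega>) \<partial>M) =
    cov s s * (\<integral>\<omega>. h' (G s \<omega>) (\<lambda>y\<in>I. residual s y \<omega>) \<partial>M)"
proof -
  let ?P = "Pi\<^sub>M I (\<lambda>_. borel :: real measure)"
  let ?R = "\<lambda>\<omega>. \<lambda>y\<in>I. residual s y \<omega>"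
  note [measurable] = meas
  have [measurable]: "G s \<in> borel_measurable M" using s by simp
  have [measurable]: "?R \<in> measurable M ?P" using s by measurable
  define N1 where "N1 = distr M borel (G s)"
  define N2 where "N2 = distr M ?P ?R"
  interpret N1: prob_space N1 unfolding N1_def by (rule prob_space_distr) simp
  interpret N2: prob_space N2 unfolding N2_def by (rule prob_space_distr) simp
  interpret N12: pair_sigma_finite N1 N2 ..
  have N: "N1 \<Otimes>\<^sub>M N2 = distr M (borel \<Otimes>\<^sub>M ?P) (\<lambda>\<omega>. (G s \<omega>, ?R \<omega>))"
    unfolding N1_def N2_def by (rule residual_joint_distr[OF s])
  have inner: "(\<integral>x. x * h x r \<partial>N1) = cov s s * (\<integral>x. h' x r \<partial>N1)" for r
  proof -
    have conth: "isCont (\<lambda>x. h x r) x" for x using deriv by (rule DERIV_isCont)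
    have [measurable]: "(\<lambda>x. h x r) \<in> borel_measurable borel" "(\<lambda>x. h' x r) \<in> borel_measurable borel"
      by (auto intro!: borel_measurable_continuous_onI simp: continuous_on_eq_continuous_at conth cont)
    have d: "distributed M lborel (G s) (normal_density 0 (sqrt (cov s s)))" by (rule normal_cov(2)[OF s])
    have p: "0 < cov s s" by (rule normal_cov(1)[OF s])
    have "(\<integral>x. x * h x r \<partial>N1) = (\<integral>\<omega>. G s \<omega> * h (G s \<omega>) r \<partial>M)"
      unfolding N1_def by (rule integral_distr) simp_all
    also have "\<dots> = (\<integral>x. normal_density 0 (sqrt (cov s s)) x * (x * h x r) \<partial>lborel)"
      by (rule distributed_integral[OF d, symmetric]) (use p in auto)
    also have "\<dots> = (sqrt (cov s s))\<^sup>2 * (\<integral>x. h' x r * normal_density 0 (sqrt (cov s s)) x \<partial>lborel)"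
      using normal_integration_by_parts[of "sqrt (cov s s)" "\<lambda>x. h x r" "\<lambda>x. h' x r", OF _ deriv cont growth] p
      by (simp add: mult.commute)
    also have "(\<integral>x. h' x r * normal_density 0 (sqrt (cov s s)) x \<partial>lborel) =
        (\<integral>x. normal_density 0 (sqrt (cov s s)) x * h' x r \<partial>lborel)"
      by (simp add: mult.commute)
    also have "\<dots> = (\<integral>\<omega>. h' (G s \<omega>) r \<partial>M)"
      by (rule distributed_integral[OF d]) (use p in auto)
    also have "\<dots> = (\<integral>x. h' x r \<partial>N1)"
      unfolding N1_def by (rule integral_distr[symmetric]) simp_all
    finally show ?thesis using p by simp
  qed
  have i1: "integrable (N1 \<Otimes>\<^sub>M N2) (\<lambda>z. fst z * h (fst z) (snd z))"
    unfolding N by (subst integrable_distr_eq) (use int(1) in auto)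
  have i2: "integrable (N1 \<Otimes>\<^sub>M N2) (\<lambda>z. h' (fst z) (snd z))"
    unfolding N by (subst integrable_distr_eq) (use int(2) in auto)
  have "(\<integral>\<omega>. G s \<omega> * h (G s \<omega>) (?R \<omega>) \<partial>M) = (\<integral>z. fst z * h (fst z) (snd z) \<partial>(N1 \<Otimes>\<^sub>M N2))"
    unfolding N by (subst integral_distr) auto
  also have "\<dots> = (\<integral>r. (\<integral>x. x * h x r \<partial>N1) \<partial>N2)"
    using N12.integral_snd[of "\<lambda>x r. x * h x r"] i1 by (simp add: case_prod_beta')
  also have "\<dots> = cov s s * (\<integral>r. (\<integral>x. h' x r \<partial>N1) \<partial>N2)"
    unfolding inner by simp
  also have "(\<integral>r. (\<integral>x. h' x r \<partial>N1) \<partial>N2) = (\<integral>z. h' (fst z) (snd z) \<partial>(N1 \<Otimes>\<^sub>M N2))"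
    using N12.integral_snd[of "\<lambda>x r. h' x r"] i2 by (simp add: case_prod_beta')
  also have "\<dots> = (\<integral>\<omega>. h' (G s \<omega>) (?R \<omega>) \<partial>M)"
    unfolding N by (subst integral_distr) auto
  finally show ?thesis .
qed

end

section \<open>Wick expansions\<close>

lemma length_remove1_le: "length (remove1 y xs) \<le> length xs"
  by (simp add: length_remove1)

text \<open>The term of \<open>stein_coef C xs R Q\<close> arises by contracting the monomial with factors \<open>xs\<close> from its
  head: either within \<open>xs\<close>, or once with a factor in \<open>R\<close>, which ends the contraction and leaves the
  factors in \<open>Q\<close>.\<close>

function stein_coef :: "('t \<Rightarrow> 't \<Rightarrow> real) \<Rightarrow> 't list \<Rightarrow> 't set \<Rightarrow> 't set \<Rightarrow> real" where
  "stein_coef C [] R Q = 0"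
| "stein_coef C (x # xs) R Q = (\<Sum>y\<in>R. if Q = set xs \<union> (R - {y}) then C x y else 0)
     + (\<Sum>y\<in>set xs. C x y * stein_coef C (remove1 y xs) R Q)"
  by pat_completeness auto
termination
  by (relation "Wellfounded.measure (\<lambda>(C, xs, R, Q). length xs)") (auto simp: length_remove1_le le_imp_less_Suc)

text \<open>Summation over Q resolves the condition on Q in the recursion and evaluates F at what is
  left over. This is the shape in which a single integration by parts appears; \<open>U\<close>
  provides a finite range for Q.\<close>

lemma stein_coef_sum_Cons:
  assumes U: "finite U" "set xs \<union> R \<subseteq> U"
  shows "(\<Sum>Q\<in>Pow U. stein_coef C (x # xs) R Q * F Q) =
    (\<Sum>y\<in>R. C x y * F (set xs \<union> (R - {y}))) +
    (\<Sum>y\<in>set xs. C x y * (\<Sum>Q\<in>Pow U. stein_coef C (remove1 y xs) R Q * F Q))"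
proof -
  have "(\<Sum>Q\<in>Pow U. (\<Sum>y\<in>R. if Q = set xs \<union> (R - {y}) then C x y else 0) * F Q) =
      (\<Sum>y\<in>R. \<Sum>Q\<in>Pow U. (if Q = set xs \<union> (R - {y}) then C x y * F Q else 0))"
    unfolding sum_distrib_right by (subst sum.swap) (intro sum.cong, auto)
  also have "\<dots> = (\<Sum>y\<in>R. C x y * F (set xs \<union> (R - {y})))"
    by (intro sum.cong refl, subst sum.delta) (use U in auto)
  finally have 1: "(\<Sum>Q\<in>Pow U. (\<Sum>y\<in>R. if Q = set xs \<union> (R - {y}) then C x y else 0) * F Q) = \<dots>" .
  have "(\<Sum>Q\<in>Pow U. (\<Sum>y\<in>set xs. C x y * stein_coef C (remove1 y xs) R Q) * F Q) =
      (\<Sum>y\<in>set xs. C x y * (\<Sum>Q\<in>Pow U. stein_coef C (remove1 y xs) R Q * F Q))"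
    unfolding sum_distrib_right sum_distrib_left by (subst sum.swap) (simp add: mult.assoc)
  with 1 show ?thesis by (simp add: distrib_right sum.distrib)
qed

lemma stein_coef_nonneg:
  assumes "\<And>x y. x \<in> set xs \<Longrightarrow> y \<in> set xs \<union> R \<Longrightarrow> 0 \<le> C x y"
  shows "0 \<le> stein_coef C xs R Q"
  using assms
proof (induction "length xs" arbitrary: xs rule: less_induct)
  case less
  show ?case
  proof (cases xs)
    case (Cons x ys)
    have "0 \<le> stein_coef C (remove1 y ys) R Q" if "y \<in> set ys" for y
    proof (rule less.hyps)
      show "length (remove1 y ys) < length xs" using Cons by (simp add: length_remove1_le le_imp_less_Suc)
    qed (use less.prems Cons set_remove1_subset[of y ys] in auto)
    then show ?thesis using less.prems Cons by (auto intro!: add_nonneg_nonneg sum_nonneg)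
  qed simp
qed

text \<open>Every contraction chooses among at most N partners, each at a cost of at most B, and at
  most \<open>length xs\<close> contractions occur. A contraction inside \<open>xs\<close> uses up
  two factors at once, so \<open>1 \<le> B\<close> serves to raise the exponent.\<close>

lemma stein_coef_bound:
  assumes "\<And>x y. x \<in> set xs \<Longrightarrow> y \<in> set xs \<union> R \<Longrightarrow> \<bar>C x y\<bar> \<le> B"
    and B: "1 \<le> B" and "length xs + card R \<le> N"
  shows "\<bar>stein_coef C xs R Q\<bar> \<le> (B * real N) ^ length xs"
  using assms(1,3)
proof (induction "length xs" arbitrary: xs rule: less_induct)
  case less
  show ?case
  proof (cases xs)
    case (Cons x ys)
    have N: "1 \<le> N" using less.prems(2) Cons by simp
    then have BN: "1 \<le> B * real N" using B mult_mono[of 1 B 1 "real N"] by simp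
    have IH: "\<bar>stein_coef C (remove1 y ys) R Q\<bar> \<le> (B * real N) ^ length ys" if y: "y \<in> set ys" for y
    proof -
      have "\<bar>stein_coef C (remove1 y ys) R Q\<bar> \<le> (B * real N) ^ length (remove1 y ys)"
      proof (rule less.hyps)
        show "length (remove1 y ys) < length xs" using Cons by (simp add: length_remove1_le le_imp_less_Suc)
        show "length (remove1 y ys) + card R \<le> N" using less.prems(2) Cons length_remove1_le[of y ys] by simp
      qed (use less.prems Cons set_remove1_subset[of y ys] in auto)
      also have "\<dots> \<le> (B * real N) ^ length ys"
        using BN by (intro power_increasing) (auto simp: length_remove1_le)
      finally show ?thesis .
    qed
    have "\<bar>\<Sum>y\<in>R. if Q = set ys \<union> (R - {y}) then C x y else 0\<bar> \<le> (\<Sum>y\<in>R. B)"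
      using less.prems(1) Cons B by (intro order_trans[OF sum_abs] sum_mono) auto
    also have "\<dots> \<le> real (card R) * (B * (B * real N) ^ length ys)"
      using BN B one_le_power[OF BN, of "length ys"] by (simp add: mult_left_mono mult_le_cancel_left1)
    finally have 1: "\<bar>\<Sum>y\<in>R. if Q = set ys \<union> (R - {y}) then C x y else 0\<bar> \<le> real (card R) * (B * (B * real N) ^ length ys)" .
    have "\<bar>\<Sum>y\<in>set ys. C x y * stein_coef C (remove1 y ys) R Q\<bar> \<le> (\<Sum>y\<in>set ys. B * (B * real N) ^ length ys)"
      using less.prems(1) Cons B IH BN
      by (intro order_trans[OF sum_abs] sum_mono) (auto simp: abs_mult intro!: mult_mono)
    also have "\<dots> \<le> real (length ys) * (B * (B * real N) ^ length ys)"
      using BN B by (simp add: card_length mult_right_mono)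
    finally have "\<bar>stein_coef C xs R Q\<bar> \<le> (real (card R) + real (length ys)) * (B * (B * real N) ^ length ys)"
      using 1 Cons by (simp add: distrib_right)
    also have "\<dots> \<le> real N * (B * (B * real N) ^ length ys)"
      using less.prems(2) Cons BN B by (intro mult_right_mono) auto
    finally show ?thesis using Cons by (simp add: mult_ac)
  qed simp
qed

section \<open>Matchings of positions with equal labels\<close>

definition matching :: "('t \<Rightarrow> 'l) \<Rightarrow> ('t \<Rightarrow> 't) \<Rightarrow> 't set \<Rightarrow> bool" where
  "matching lab \<sigma> S \<longleftrightarrow> (\<forall>x\<in>S. \<sigma> x \<in> S \<and> \<sigma> x \<noteq> x \<and> \<sigma> (\<sigma> x) = x \<and> lab (\<sigma> x) = lab x)"

lemma matching_empty [simp]: "matching lab \<sigma> {}"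
  by (simp add: matching_def)

lemma matching_cong:
  assumes "\<And>t. t \<in> S \<Longrightarrow> lab t = lab' t" "matching lab \<sigma> S"
  shows "matching lab' \<sigma> S"
  unfolding matching_def
proof
  fix t assume t: "t \<in> S"
  then have "\<sigma> t \<in> S" "\<sigma> t \<noteq> t" "\<sigma> (\<sigma> t) = t" "lab (\<sigma> t) = lab t"
    using assms(2) unfolding matching_def by blast+
  then show "\<sigma> t \<in> S \<and> \<sigma> t \<noteq> t \<and> \<sigma> (\<sigma> t) = t \<and> lab' (\<sigma> t) = lab' t"
    using assms(1)[OF t] assms(1)[of "\<sigma> t"] by simp
qed

text \<open>Outside S the values of a matching are arbitrary. Cutting them off leaves an extensional
  function, so that matchings can be counted.\<close>

lemma matching_restrict:
  assumes "matching lab \<sigma> S"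
  shows "matching lab (restrict \<sigma> S) S"
  using assms unfolding matching_def by auto

lemma matching_insert2:
  assumes "matching lab \<sigma> S" "x \<notin> S" "y \<notin> S" "x \<noteq> y" "lab x = lab y"
  shows "matching lab (\<sigma>(x := y, y := x)) (insert x (insert y S))"
  using assms unfolding matching_def by (auto split: if_splits)

lemma matching_Un:
  assumes "matching lab \<sigma> S" "matching lab \<tau> T" "S \<inter> T = {}"
  shows "matching lab (\<lambda>x. if x \<in> S then \<sigma> x else \<tau> x) (S \<union> T)"
proof -
  have "\<sigma> x \<in> S \<and> \<sigma> x \<noteq> x \<and> \<sigma> (\<sigma> x) = x \<and> lab (\<sigma> x) = lab x" if "x \<in> S" for x
    using assms(1) that unfolding matching_def by blast
  moreover have "\<tau> x \<in> T \<and> \<tau> x \<notin> S \<and> \<tau> x \<noteq> x \<and> \<tau> (\<tau> x) = x \<and> lab (\<tau> x) = lab x" if "x \<in> T" for x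
    using assms(2,3) that unfolding matching_def by blast
  ultimately show ?thesis unfolding matching_def by auto
qed

lemma matching_image:
  assumes "matching (lab \<circ> \<rho>) \<sigma> S" "\<And>x. x \<in> S \<Longrightarrow> \<pi> (\<rho> x) = x"
  shows "matching lab (\<rho> \<circ> \<sigma> \<circ> \<pi>) (\<rho> ` S)"
proof -
  have "\<sigma> x \<in> S \<and> \<rho> (\<sigma> x) \<noteq> \<rho> x \<and> \<sigma> (\<sigma> x) = x \<and> lab (\<rho> (\<sigma> x)) = lab (\<rho> x)" if "x \<in> S" for x
  proof -
    have "\<sigma> x \<in> S" "\<sigma> x \<noteq> x" "\<sigma> (\<sigma> x) = x" "lab (\<rho> (\<sigma> x)) = lab (\<rho> x)"
      using assms(1) that unfolding matching_def comp_def by auto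
    moreover have "\<rho> (\<sigma> x) \<noteq> \<rho> x"
      using assms(2)[OF that] assms(2)[OF \<open>\<sigma> x \<in> S\<close>] \<open>\<sigma> x \<noteq> x\<close> by auto
    ultimately show ?thesis by simp
  qed
  then show ?thesis using assms(2) unfolding matching_def by auto
qed

text \<open>A nonzero coefficient comes from a chain of contractions with nonzero covariances. The
  contracted pairs form the matching, the factors never contracted are Q, and the contraction that
  ends the chain is the pair joining \<open>xs\<close> to \<open>R\<close>.\<close>

lemma stein_coef_matching:
  assumes "stein_coef C xs R Q \<noteq> 0" "distinct xs" "set xs \<inter> R = {}"
    and "\<And>x y. x \<in> set xs \<Longrightarrow> y \<in> set xs \<union> R \<Longrightarrow> C x y \<noteq> 0 \<Longrightarrow> lab x = lab y"
  shows "Q \<subseteq> set xs \<union> R \<and> (\<exists>\<sigma>. matching lab \<sigma> (set xs \<union> R - Q) \<and> (\<exists>x\<in>set xs - Q. \<sigma> x \<in> R - Q))"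
  using assms
proof (induction "length xs" arbitrary: xs rule: less_induct)
  case less
  show ?case
  proof (cases xs)
    case Nil
    then show ?thesis using less.prems by simp
  next
    case (Cons x ys)
    consider (1) y where "y \<in> R" "Q = set ys \<union> (R - {y})" "C x y \<noteq> 0"
      | (2) y where "y \<in> set ys" "C x y \<noteq> 0" "stein_coef C (remove1 y ys) R Q \<noteq> 0"
    proof -
      have "(\<Sum>y\<in>R. if Q = set ys \<union> (R - {y}) then C x y else 0) \<noteq> 0 \<or>
        (\<Sum>y\<in>set ys. C x y * stein_coef C (remove1 y ys) R Q) \<noteq> 0"
        using less.prems(1) Cons by auto
      then show thesis
      proof
        assume "(\<Sum>y\<in>R. if Q = set ys \<union> (R - {y}) then C x y else 0) \<noteq> 0"
        then obtain y where "y \<in> R" "(if Q = set ys \<union> (R - {y}) then C x y else 0) \<noteq> 0"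
          by (rule sum.not_neutral_contains_not_neutral)
        then show thesis using that(1)[of y] by (simp split: if_splits)
      next
        assume "(\<Sum>y\<in>set ys. C x y * stein_coef C (remove1 y ys) R Q) \<noteq> 0"
        then obtain y where "y \<in> set ys" "C x y * stein_coef C (remove1 y ys) R Q \<noteq> 0"
          by (rule sum.not_neutral_contains_not_neutral)
        then show thesis using that(2)[of y] by simp
      qed
    qed
    then show ?thesis
    proof cases
      case 1
      have d: "x \<notin> set ys" "x \<notin> R" "y \<notin> set ys" using 1(1) less.prems(2,3) Cons by auto
      then have xy: "x \<noteq> y" "x \<notin> Q" "y \<notin> Q" unfolding 1(2) using 1(1) by auto
      have "lab x = lab y" using less.prems(4)[of x y] 1 Cons by auto
      from matching_insert2[of lab id "{}" x y, OF _ _ _ xy(1) this]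
      have "matching lab (id(x := y, y := x)) {x, y}" by simp
      moreover have "set xs \<union> R - Q = {x, y}" unfolding 1(2) using 1(1) d Cons by auto
      moreover have "x \<in> set xs - Q" "(id(x := y, y := x)) x \<in> R - Q" "Q \<subseteq> set xs \<union> R"
        using 1(1) xy Cons unfolding 1(2) by auto
      ultimately show ?thesis by (intro conjI exI[of _ "id(x := y, y := x)"] bexI[of _ x]) simp_all
    next
      case 2
      have d: "distinct ys" "x \<notin> set ys" using less.prems(2) Cons by auto
      have s: "set (remove1 y ys) = set ys - {y}" using d by (simp add: set_remove1_eq)
      have xy: "x \<noteq> y" "x \<notin> R" "y \<notin> R" using 2 d less.prems(3) Cons by auto
      have "Q \<subseteq> set (remove1 y ys) \<union> R \<and> (\<exists>\<sigma>. matching lab \<sigma> (set (remove1 y ys) \<union> R - Q) \<and>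
          (\<exists>x\<in>set (remove1 y ys) - Q. \<sigma> x \<in> R - Q))"
      proof (rule less.hyps)
        show "length (remove1 y ys) < length xs" using Cons by (simp add: length_remove1_le le_imp_less_Suc)
        show "\<And>u v. u \<in> set (remove1 y ys) \<Longrightarrow> v \<in> set (remove1 y ys) \<union> R \<Longrightarrow> C u v \<noteq> 0 \<Longrightarrow> lab u = lab v"
          using less.prems(4) Cons s by auto
      qed (use 2 d less.prems Cons s in auto)
      then obtain \<sigma> z where *: "Q \<subseteq> set ys - {y} \<union> R" "matching lab \<sigma> (set ys - {y} \<union> R - Q)"
        "z \<in> set ys - {y} - Q" "\<sigma> z \<in> R - Q" unfolding s by blast
      have "lab x = lab y" using less.prems(4)[of x y] 2 Cons by auto
      from matching_insert2[OF *(2) _ _ xy(1) this]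
      have "matching lab (\<sigma>(x := y, y := x)) (insert x (insert y (set ys - {y} \<union> R - Q)))"
        using d xy by auto
      moreover have "insert x (insert y (set ys - {y} \<union> R - Q)) = set xs \<union> R - Q"
        using Cons 2 xy *(1) d by auto
      moreover have "z \<in> set xs - Q" "(\<sigma>(x := y, y := x)) z \<in> R - Q" using * Cons d by auto
      moreover have "Q \<subseteq> set xs \<union> R" using *(1) Cons by auto
      ultimately show ?thesis by (intro conjI exI[of _ "\<sigma>(x := y, y := x)"] bexI[of _ z]) simp_all
    qed
  qed
qed

section \<open>Integration by parts for polynomials in Gaussian variables\<close>

lemma lipschitz_bound_from_derivative:
  fixes f f' :: "real \<Rightarrow> real"
  assumes f: "\<And>x. (f has_real_derivative f' x) (at x)" and bound: "\<And>x. \<bar>f' x\<bar> \<le> B"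
  shows "\<bar>f x\<bar> \<le> \<bar>f y\<bar> + B * \<bar>x - y\<bar>"
proof -
  have "\<bar>f x - f y\<bar> \<le> B * \<bar>x - y\<bar>"
    using field_differentiable_bound[of UNIV f f' B x y] f bound by (simp add: has_field_derivative_at_within)
  then show ?thesis by linarith
qed

context gauss_family begin

text \<open>The product runs over positions and not over variables. Several positions may carry the
  same variable, so powers are covered although S is a plain set, and contractions can name the
  factors they remove.\<close>

definition gmono :: "('t \<Rightarrow> 'i) \<Rightarrow> 't set \<Rightarrow> 'a \<Rightarrow> real" where
  "gmono e S \<omega> = (\<Prod>t\<in>S. G (e t) \<omega>)"

lemma gmono_empty [simp]: "gmono e {} \<omega> = 1"
  by (simp add: gmono_def)

lemma gmono_insert: "finite S \<Longrightarrow> x \<notin> S \<Longrightarrow> gmono e (insert x S) \<omega> = G (e x) \<omega> * gmono e S \<omega>"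
  by (simp add: gmono_def)

lemma gmono_Un: "finite S \<Longrightarrow> finite T \<Longrightarrow> S \<inter> T = {} \<Longrightarrow> gmono e (S \<union> T) \<omega> = gmono e S \<omega> * gmono e T \<omega>"
  by (simp add: gmono_def prod.union_disjoint)

lemma gmono_cong: "(\<And>t. t \<in> S \<Longrightarrow> e t = e' t) \<Longrightarrow> gmono e S \<omega> = gmono e' S \<omega>"
  by (simp add: gmono_def)

lemma gmono_moments: "(\<And>t. t \<in> S \<Longrightarrow> e t \<in> I) \<Longrightarrow> all_moments (gmono e S)"
  unfolding gmono_def by (intro all_moments_intros moments)

lemma lipschitz_moments:
  fixes f f' :: "real \<Rightarrow> real"
  assumes f: "\<And>x. (f has_real_derivative f' x) (at x)" and bound: "\<And>x. \<bar>f' x\<bar> \<le> B"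
    and W: "all_moments W"
  shows "all_moments (\<lambda>\<omega>. f (W \<omega>))"
proof (rule all_moments_bound)
  have "isCont f x" for x using f by (rule DERIV_isCont)
  then have "f \<in> borel_measurable borel"
    by (auto intro!: borel_measurable_continuous_onI simp: continuous_on_eq_continuous_at)
  then show "(\<lambda>\<omega>. f (W \<omega>)) \<in> borel_measurable M" using all_moments_measurable[OF W] by simp
  show "all_moments (\<lambda>\<omega>. \<bar>f 0\<bar> + B * \<bar>W \<omega>\<bar>)" by (intro all_moments_intros W)
  show "\<bar>f (W \<omega>)\<bar> \<le> \<bar>f 0\<bar> + B * \<bar>W \<omega>\<bar>" for \<omega>
    using lipschitz_bound_from_derivative[OF f bound, of "W \<omega>" 0] by simp
qed

text \<open>Each \<open>G y\<close> is its residual plus \<open>cov s y / cov s s\<close> times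
  \<open>G s\<close>. Differentiating in \<open>G s\<close> with the residuals held fixed yields
  this quotient for every factor, and the variance \<open>cov s s\<close> of the one-dimensional
  formula turns it into \<open>cov s y\<close>. The first sum differentiates the monomial, the
  second the polynomial inside f.\<close>

theorem integration_by_parts:
  fixes f f' :: "real \<Rightarrow> real" and e :: "'j \<Rightarrow> 't \<Rightarrow> 'i" and b :: "'u \<Rightarrow> 'i"
  assumes f: "\<And>x. (f has_real_derivative f' x) (at x)" and contf': "\<And>x. isCont f' x"
    and bound: "\<And>x. \<bar>f' x\<bar> \<le> B"
    and s: "s \<in> I" and bS: "\<And>t. t \<in> S \<Longrightarrow> b t \<in> I"
    and eP: "\<And>j t. j \<in> Y \<Longrightarrow> t \<in> P \<Longrightarrow> e j t \<in> I"
    and W: "\<And>\<omega>. W \<omega> = \<kappa> * (\<Sum>j\<in>Y. gmono (e j) P \<omega>)"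
  shows "(\<integral>\<omega>. G s \<omega> * (gmono b S \<omega> * f (W \<omega>)) \<partial>M) =
    (\<Sum>t\<in>S. cov s (b t) * (\<integral>\<omega>. gmono b (S - {t}) \<omega> * f (W \<omega>) \<partial>M)) +
    \<kappa> * (\<Sum>j\<in>Y. \<Sum>t\<in>P. cov s (e j t) * (\<integral>\<omega>. gmono b S \<omega> * gmono (e j) (P - {t}) \<omega> * f' (W \<omega>) \<partial>M))"
proof -
  define c where "c = (\<lambda>y. cov s y / cov s s)"
  \<comment> \<open>Recovers the value of \<open>G y\<close> from the value x of \<open>G s\<close>
    and the residuals r.\<close>
  define ev where "ev = (\<lambda>x (r :: 'i \<Rightarrow> real) y. r y + c y * x)"
  define mo where "mo = (\<lambda>x r (b :: 'u \<Rightarrow> 'i) S. \<Prod>t\<in>S. ev x r (b t))"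
  define mo' where "mo' = (\<lambda>x r (b :: 't \<Rightarrow> 'i) S. \<Prod>t\<in>S. ev x r (b t))"
  define w where "w = (\<lambda>x r. \<kappa> * (\<Sum>j\<in>Y. mo' x r (e j) P))"
  define w' where "w' = (\<lambda>x r. \<kappa> * (\<Sum>j\<in>Y. \<Sum>t\<in>P. c (e j t) * mo' x r (e j) (P - {t})))"
  define h where "h = (\<lambda>x r. mo x r b S * f (w x r))"
  define h' where "h' = (\<lambda>x r. (\<Sum>t\<in>S. c (b t) * mo x r b (S - {t})) * f (w x r) + mo x r b S * (f' (w x r) * w' x r))"
  let ?R = "\<lambda>\<omega>. \<lambda>y\<in>I. residual s y \<omega>"
  have ev_R: "ev (G s \<omega>) (?R \<omega>) y = G y \<omega>" if "y \<in> I" for y \<omega>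
    using that by (simp add: ev_def c_def residual_def)
  have mo_R: "mo (G s \<omega>) (?R \<omega>) b A = gmono b A \<omega>" if "A \<subseteq> S" for A \<omega>
    unfolding mo_def gmono_def using that bS by (intro prod.cong ev_R) auto
  have mo'_R: "mo' (G s \<omega>) (?R \<omega>) (e j) A = gmono (e j) A \<omega>" if "j \<in> Y" "A \<subseteq> P" for A j \<omega>
    unfolding mo'_def gmono_def using that eP by (intro prod.cong ev_R) auto
  have w_R: "w (G s \<omega>) (?R \<omega>) = W \<omega>" for \<omega>
    unfolding w_def W by (simp add: mo'_R)
  have w'_R: "w' (G s \<omega>) (?R \<omega>) = \<kappa> * (\<Sum>j\<in>Y. \<Sum>t\<in>P. c (e j t) * gmono (e j) (P - {t}) \<omega>)" for \<omega>
    unfolding w'_def by (simp add: mo'_R)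
  have h_R: "h (G s \<omega>) (?R \<omega>) = gmono b S \<omega> * f (W \<omega>)" for \<omega>
    unfolding h_def by (simp add: mo_R w_R)
  have h'_R: "h' (G s \<omega>) (?R \<omega>) = (\<Sum>t\<in>S. c (b t) * (gmono b (S - {t}) \<omega> * f (W \<omega>))) +
      \<kappa> * (\<Sum>j\<in>Y. \<Sum>t\<in>P. c (e j t) * (gmono b S \<omega> * gmono (e j) (P - {t}) \<omega> * f' (W \<omega>)))" for \<omega>
    unfolding h'_def w_R w'_R by (simp add: mo_R sum_distrib_left sum_distrib_right mult_ac)
  have dev: "((\<lambda>x. ev x r y) has_real_derivative c y) (at x)" for r y x
    unfolding ev_def by (auto intro!: derivative_eq_intros)
  have dmo: "((\<lambda>x. mo x r b A) has_real_derivative (\<Sum>t\<in>A. c (b t) * mo x r b (A - {t}))) (at x)" for r b A x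
    unfolding mo_def by (rule has_field_derivative_prod) (rule dev)
  have dmo': "((\<lambda>x. mo' x r b A) has_real_derivative (\<Sum>t\<in>A. c (b t) * mo' x r b (A - {t}))) (at x)" for r b A x
    unfolding mo'_def by (rule has_field_derivative_prod) (rule dev)
  have dw: "((\<lambda>x. w x r) has_real_derivative w' x r) (at x)" for r x
    unfolding w_def w'_def by (intro DERIV_cmult DERIV_sum dmo')
  have dfw: "((\<lambda>x. f (w x r)) has_real_derivative f' (w x r) * w' x r) (at x)" for r x
    by (rule DERIV_chain2[OF f dw])
  have cmo: "isCont (\<lambda>x. mo x r b A) x" for r b A x using dmo by (rule DERIV_isCont)
  have cmo': "isCont (\<lambda>x. mo' x r b A) x" for r b A x using dmo' by (rule DERIV_isCont)
  have cw: "isCont (\<lambda>x. w x r) x" for r x using dw by (rule DERIV_isCont)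
  have cfw: "isCont (\<lambda>x. f (w x r)) x" for r x using dfw by (rule DERIV_isCont)
  have cf'w: "isCont (\<lambda>x. f' (w x r)) x" for r x by (rule isCont_o2[OF cw contf'])
  have gev: "poly_growth (\<lambda>x. ev x r y)" for r y unfolding ev_def by (intro poly_growth_intros)
  have gmo: "poly_growth (\<lambda>x. mo x r b A)" for r b A unfolding mo_def by (intro poly_growth_intros gev)
  have gmo': "poly_growth (\<lambda>x. mo' x r b A)" for r b A unfolding mo'_def by (intro poly_growth_intros gev)
  have gw: "poly_growth (\<lambda>x. w x r)" for r unfolding w_def by (intro poly_growth_intros gmo')
  have gfw: "poly_growth (\<lambda>x. f (w x r))" for r
  proof (rule poly_growth_bound)
    have "poly_growth (\<lambda>x. \<bar>w x r\<bar>)" by (rule poly_growth_bound[OF gw[of r]]) simp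
    then show "poly_growth (\<lambda>x. \<bar>f 0\<bar> + B * \<bar>w x r\<bar>)" by (intro poly_growth_intros)
    show "\<bar>f (w x r)\<bar> \<le> \<bar>\<bar>f 0\<bar> + B * \<bar>w x r\<bar>\<bar>" for x
      using lipschitz_bound_from_derivative[OF f bound, of "w x r" 0] by simp
  qed
  have gf'w: "poly_growth (\<lambda>x. f' (w x r))" for r
    by (rule poly_growthI[of _ B 0]) (simp add: bound)
  have contf: "isCont f x" for x using f by (rule DERIV_isCont)
  have [measurable]: "f \<in> borel_measurable borel" "f' \<in> borel_measurable borel"
    by (auto intro!: borel_measurable_continuous_onI simp: continuous_on_eq_continuous_at contf contf')
  have mev: "(\<lambda>z. ev (fst z) (snd z) y) \<in> borel_measurable (borel \<Otimes>\<^sub>M Pi\<^sub>M I (\<lambda>_. borel))" if "y \<in> I" for y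
    unfolding ev_def using that by measurable
  have mmo [measurable]: "(\<lambda>z. mo (fst z) (snd z) b A) \<in> borel_measurable (borel \<Otimes>\<^sub>M Pi\<^sub>M I (\<lambda>_. borel))" if "A \<subseteq> S" for A
    unfolding mo_def using that bS by (intro borel_measurable_prod mev) auto
  have mmo' [measurable]: "(\<lambda>z. mo' (fst z) (snd z) (e j) A) \<in> borel_measurable (borel \<Otimes>\<^sub>M Pi\<^sub>M I (\<lambda>_. borel))" if "j \<in> Y" "A \<subseteq> P" for j A
    unfolding mo'_def using that eP by (intro borel_measurable_prod mev) auto
  have mw [measurable]: "(\<lambda>z. w (fst z) (snd z)) \<in> borel_measurable (borel \<Otimes>\<^sub>M Pi\<^sub>M I (\<lambda>_. borel))"
    unfolding w_def by (intro borel_measurable_times borel_measurable_const borel_measurable_sum mmo') auto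
  have mw' [measurable]: "(\<lambda>z. w' (fst z) (snd z)) \<in> borel_measurable (borel \<Otimes>\<^sub>M Pi\<^sub>M I (\<lambda>_. borel))"
    unfolding w'_def by (intro borel_measurable_times borel_measurable_const borel_measurable_sum mmo') auto
  have aW: "all_moments W" unfolding W by (intro all_moments_intros gmono_moments eP)
  have afW: "all_moments (\<lambda>\<omega>. f (W \<omega>))" by (rule lipschitz_moments[OF f bound aW])
  have af'W: "all_moments (\<lambda>\<omega>. f' (W \<omega>))"
    by (rule all_moments_bound[OF all_moments_const[of B]]) (use bound all_moments_measurable[OF aW] in auto)
  have ab: "all_moments (gmono b A)" if "A \<subseteq> S" for A using that bS by (intro gmono_moments) auto
  have ae: "all_moments (gmono (e j) A)" if "j \<in> Y" "A \<subseteq> P" for j A using that eP by (intro gmono_moments) auto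
  have i1: "integrable M (\<lambda>\<omega>. gmono b (S - {t}) \<omega> * f (W \<omega>))" for t
    by (intro all_moments_integrable all_moments_intros ab afW) auto
  have i2: "integrable M (\<lambda>\<omega>. gmono b S \<omega> * gmono (e j) (P - {t}) \<omega> * f' (W \<omega>))" if "j \<in> Y" for j t
    using that by (intro all_moments_integrable all_moments_intros ab ae af'W) auto
  have "(\<integral>\<omega>. G s \<omega> * (gmono b S \<omega> * f (W \<omega>)) \<partial>M) = (\<integral>\<omega>. G s \<omega> * h (G s \<omega>) (?R \<omega>) \<partial>M)"
    unfolding h_R ..
  also have "\<dots> = cov s s * (\<integral>\<omega>. h' (G s \<omega>) (?R \<omega>) \<partial>M)"
  proof (rule integration_by_parts_residual[OF s])
    show "((\<lambda>x. h x r) has_real_derivative h' x r) (at x)" for r x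
      unfolding h_def h'_def using DERIV_mult[OF dmo[of r b S x] dfw[of r x]] by (simp add: mult_ac add.commute)
    show "isCont (\<lambda>x. h' x r) x" for r x
      unfolding h'_def w'_def by (intro continuous_intros cmo cmo' cfw cf'w)
    show "poly_growth (\<lambda>x. h x r)" for r unfolding h_def by (intro poly_growth_intros gmo gfw)
    show "poly_growth (\<lambda>x. h' x r)" for r
      unfolding h'_def w'_def by (intro poly_growth_intros gmo gmo' gfw gf'w)
    show "(\<lambda>z. h (fst z) (snd z)) \<in> borel_measurable (borel \<Otimes>\<^sub>M Pi\<^sub>M I (\<lambda>_. borel))"
      unfolding h_def using mmo[OF order_refl] by measurable
    show "(\<lambda>z. h' (fst z) (snd z)) \<in> borel_measurable (borel \<Otimes>\<^sub>M Pi\<^sub>M I (\<lambda>_. borel))"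
      unfolding h'_def
      by (intro borel_measurable_times borel_measurable_add borel_measurable_const borel_measurable_sum mmo mw'
           measurable_compose[OF mw \<open>f \<in> borel_measurable borel\<close>] measurable_compose[OF mw \<open>f' \<in> borel_measurable borel\<close>]) auto
    show "integrable M (\<lambda>\<omega>. G s \<omega> * h (G s \<omega>) (?R \<omega>))"
      unfolding h_R by (intro all_moments_integrable all_moments_intros ab afW moments s) auto
    show "integrable M (\<lambda>\<omega>. h' (G s \<omega>) (?R \<omega>))"
      unfolding h'_R by (intro Bochner_Integration.integrable_add Bochner_Integration.integrable_sum integrable_mult_right i1 i2)
  qed
  also have "(\<integral>\<omega>. h' (G s \<omega>) (?R \<omega>) \<partial>M) =
      (\<Sum>t\<in>S. c (b t) * (\<integral>\<omega>. gmono b (S - {t}) \<omega> * f (W \<omega>) \<partial>M)) +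
      \<kappa> * (\<Sum>j\<in>Y. \<Sum>t\<in>P. c (e j t) * (\<integral>\<omega>. gmono b S \<omega> * gmono (e j) (P - {t}) \<omega> * f' (W \<omega>) \<partial>M))"
    unfolding h'_R
    by (subst Bochner_Integration.integral_add)
       (simp_all add: Bochner_Integration.integral_sum i1 i2 integrable_mult_right Bochner_Integration.integrable_sum)
  also have "cov s s * \<dots> = (\<Sum>t\<in>S. cov s s * c (b t) * (\<integral>\<omega>. gmono b (S - {t}) \<omega> * f (W \<omega>) \<partial>M)) +
      \<kappa> * (\<Sum>j\<in>Y. \<Sum>t\<in>P. cov s s * c (e j t) * (\<integral>\<omega>. gmono b S \<omega> * gmono (e j) (P - {t}) \<omega> * f' (W \<omega>) \<partial>M))"
    by (simp add: distrib_left sum_distrib_left mult_ac)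
  also have "\<dots> = (\<Sum>t\<in>S. cov s (b t) * (\<integral>\<omega>. gmono b (S - {t}) \<omega> * f (W \<omega>) \<partial>M)) +
      \<kappa> * (\<Sum>j\<in>Y. \<Sum>t\<in>P. cov s (e j t) * (\<integral>\<omega>. gmono b S \<omega> * gmono (e j) (P - {t}) \<omega> * f' (W \<omega>) \<partial>M))"
    using normal_cov(1)[OF s] by (simp add: c_def)
  finally show ?thesis .
qed

end

text \<open>Induction adapted to Wick's recursion, where pairing x with t leaves
  \<open>S - {t}\<close> instead of \<open>S\<close>.\<close>

lemma finite_minus_induct [consumes 1, case_names empty insert]:
  assumes "finite S" "P {}" "\<And>x S. finite S \<Longrightarrow> x \<notin> S \<Longrightarrow> (\<And>t. t \<in> S \<Longrightarrow> P (S - {t})) \<Longrightarrow> P (insert x S)"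
  shows "P S"
  using assms(1)
proof (induction "card S" arbitrary: S rule: less_induct)
  case less
  show ?case
  proof (cases "S = {}")
    case False
    then obtain x T where S: "S = insert x T" "x \<notin> T" by (metis Set.set_insert ex_in_conv)
    then have "P (T - {t})" if "t \<in> T" for t
      using less.prems by (intro less.hyps) (auto simp: card_insert_if le_imp_less_Suc card_mono)
    then show ?thesis unfolding S(1) using less.prems S by (intro assms(3)) auto
  qed (simp add: assms(2))
qed

context gauss_family begin

lemma gmono_empty_fun [simp]: "gmono e {} = (\<lambda>_. 1)"
  by (simp add: fun_eq_iff)

text \<open>Wick's recursion, obtained from integration by parts with the constant function f =
  1.\<close>

lemma expectation_gmono_insert:
  assumes "finite S" "x \<notin> S" "\<And>t. t \<in> insert x S \<Longrightarrow> e t \<in> I"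
  shows "expectation (gmono e (insert x S)) = (\<Sum>t\<in>S. cov (e x) (e t) * expectation (gmono e (S - {t})))"
proof -
  have "(\<integral>\<omega>. G (e x) \<omega> * (gmono e S \<omega> * 1) \<partial>M) =
    (\<Sum>t\<in>S. cov (e x) (e t) * (\<integral>\<omega>. gmono e (S - {t}) \<omega> * 1 \<partial>M)) +
    0 * (\<Sum>j\<in>({} :: unit set). \<Sum>t\<in>{}. cov (e x) (e t) * (\<integral>\<omega>. gmono e S \<omega> * gmono e ({} - {t}) \<omega> * 0 \<partial>M))"
    by (rule integration_by_parts[where f="\<lambda>_. 1" and f'="\<lambda>_. 0" and B=0 and W="\<lambda>_. 0"])
       (use assms in auto)
  moreover have "gmono e (insert x S) = (\<lambda>\<omega>. G (e x) \<omega> * gmono e S \<omega>)"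
    using assms by (simp add: gmono_insert fun_eq_iff)
  ultimately show ?thesis by simp
qed

text \<open>Integration by parts in the head of \<open>xs\<close> gives two kinds of terms. A
  partner inside \<open>xs\<close> leaves a shorter monomial times f, to which the induction
  applies; a partner in W turns f into f' and ends the chain. By Wick's formula the expectation
  obeys the first half of this recursion, so centring removes exactly what would remain once
  \<open>xs\<close> is used up. The maps \<open>e j\<close> agree with \<open>b\<close> on
  \<open>xs\<close> in order that both monomials can be read off one position map.\<close>

lemma stein_coefficient_identity:
  fixes f f' :: "real \<Rightarrow> real" and e :: "'j \<Rightarrow> 't \<Rightarrow> 'i" and b :: "'t \<Rightarrow> 'i"
  assumes f: "\<And>x. (f has_real_derivative f' x) (at x)" and contf': "\<And>x. isCont f' x"
    and bound: "\<And>x. \<bar>f' x\<bar> \<le> B"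
    and eP: "\<And>j t. j \<in> Y \<Longrightarrow> t \<in> P \<Longrightarrow> e j t \<in> I"
    and W: "\<And>\<omega>. W \<omega> = \<kappa> * (\<Sum>j\<in>Y. gmono (e j) P \<omega>)"
    and U: "finite U" "P \<subseteq> U"
    and xs: "distinct xs" "set xs \<subseteq> U" "set xs \<inter> P = {}"
    and b: "\<And>t. t \<in> set xs \<Longrightarrow> b t \<in> I" "\<And>j t. j \<in> Y \<Longrightarrow> t \<in> set xs \<Longrightarrow> e j t = b t"
  shows "(\<integral>\<omega>. (gmono b (set xs) \<omega> - expectation (gmono b (set xs))) * f (W \<omega>) \<partial>M) =
    \<kappa> * (\<Sum>j\<in>Y. \<Sum>Q\<in>Pow U. stein_coef (\<lambda>t u. cov (e j t) (e j u)) xs P Q * (\<integral>\<omega>. gmono (e j) Q \<omega> * f' (W \<omega>) \<partial>M))"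
  using xs b
proof (induction "length xs" arbitrary: xs rule: less_induct)
  case less
  have aW: "all_moments W" unfolding W by (intro all_moments_intros gmono_moments eP)
  have afW: "all_moments (\<lambda>\<omega>. f (W \<omega>))" by (rule lipschitz_moments[OF f bound aW])
  show ?case
  proof (cases xs)
    case Nil
    then show ?thesis by (simp add: prob_space)
  next
    case (Cons x ys)
    have d: "distinct ys" "x \<notin> set ys" "x \<notin> P" "set ys \<inter> P = {}" "set ys \<subseteq> U" using less.prems Cons by auto
    have bI: "b x \<in> I" "\<And>t. t \<in> set ys \<Longrightarrow> b t \<in> I" using less.prems Cons by auto
    have eb: "e j x = b x" "\<And>t. t \<in> set ys \<Longrightarrow> e j t = b t" if "j \<in> Y" for j using less.prems Cons that by auto
    define Ef where "Ef = (\<lambda>S. \<integral>\<omega>. gmono b S \<omega> * f (W \<omega>) \<partial>M)"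
    define m where "m = (\<lambda>S. expectation (gmono b S))"
    define Ej where "Ej = (\<lambda>j Q. \<integral>\<omega>. gmono (e j) Q \<omega> * f' (W \<omega>) \<partial>M)"
    define C where "C = (\<lambda>j t u. cov (e j t) (e j u))"
    have ab: "all_moments (gmono b S)" if "S \<subseteq> set xs" for S
      using that less.prems(4) by (intro gmono_moments) auto
    have centered: "(\<integral>\<omega>. (gmono b S \<omega> - m S) * f (W \<omega>) \<partial>M) = Ef S - m S * Ef {}" if "S \<subseteq> set xs" for S
    proof -
      have "integrable M (\<lambda>\<omega>. gmono b S \<omega> * f (W \<omega>))" "integrable M (\<lambda>\<omega>. f (W \<omega>))"
        using that by (auto intro!: all_moments_integrable all_moments_intros ab afW)
      then show ?thesis by (simp add: Ef_def left_diff_distrib)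
    qed
    have IH: "Ef (set ys - {y}) - m (set ys - {y}) * Ef {} =
        \<kappa> * (\<Sum>j\<in>Y. \<Sum>Q\<in>Pow U. stein_coef (C j) (remove1 y ys) P Q * Ej j Q)" if "y \<in> set ys" for y
    proof -
      have s: "set (remove1 y ys) = set ys - {y}" using d by (simp add: set_remove1_eq)
      have "(\<integral>\<omega>. (gmono b (set (remove1 y ys)) \<omega> - expectation (gmono b (set (remove1 y ys)))) * f (W \<omega>) \<partial>M) =
        \<kappa> * (\<Sum>j\<in>Y. \<Sum>Q\<in>Pow U. stein_coef (\<lambda>t u. cov (e j t) (e j u)) (remove1 y ys) P Q * (\<integral>\<omega>. gmono (e j) Q \<omega> * f' (W \<omega>) \<partial>M))"
      proof (rule less.hyps)
        show "length (remove1 y ys) < length xs" using Cons by (simp add: length_remove1_le le_imp_less_Suc)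
      qed (use d bI eb s in auto)
      moreover have "set ys - {y} \<subseteq> set xs" using Cons by auto
      ultimately show ?thesis
        using centered[of "set ys - {y}"] unfolding s m_def Ej_def C_def by simp
    qed
    have "(\<integral>\<omega>. G (b x) \<omega> * (gmono b (set ys) \<omega> * f (W \<omega>)) \<partial>M) =
      (\<Sum>t\<in>set ys. cov (b x) (b t) * (\<integral>\<omega>. gmono b (set ys - {t}) \<omega> * f (W \<omega>) \<partial>M)) +
      \<kappa> * (\<Sum>j\<in>Y. \<Sum>t\<in>P. cov (b x) (e j t) * (\<integral>\<omega>. gmono b (set ys) \<omega> * gmono (e j) (P - {t}) \<omega> * f' (W \<omega>) \<partial>M))"
      by (rule integration_by_parts[OF f contf' bound bI(1) bI(2) eP W])
    also have "(\<integral>\<omega>. G (b x) \<omega> * (gmono b (set ys) \<omega> * f (W \<omega>)) \<partial>M) = Ef (set xs)"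
      unfolding Ef_def Cons using d by (simp add: gmono_insert mult.assoc)
    also have "(\<Sum>j\<in>Y. \<Sum>t\<in>P. cov (b x) (e j t) * (\<integral>\<omega>. gmono b (set ys) \<omega> * gmono (e j) (P - {t}) \<omega> * f' (W \<omega>) \<partial>M)) =
      (\<Sum>j\<in>Y. \<Sum>t\<in>P. C j x t * Ej j (set ys \<union> (P - {t})))"
    proof (intro sum.cong refl)
      fix j t assume j: "j \<in> Y" and t: "t \<in> P"
      have "gmono b (set ys) \<omega> * gmono (e j) (P - {t}) \<omega> = gmono (e j) (set ys \<union> (P - {t})) \<omega>" for \<omega>
      proof -
        have "gmono b (set ys) \<omega> = gmono (e j) (set ys) \<omega>" using eb j by (intro gmono_cong) auto
        then show ?thesis using d U finite_subset by (subst gmono_Un) auto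
      qed
      then show "cov (b x) (e j t) * (\<integral>\<omega>. gmono b (set ys) \<omega> * gmono (e j) (P - {t}) \<omega> * f' (W \<omega>) \<partial>M) =
          C j x t * Ej j (set ys \<union> (P - {t}))"
        using eb j by (simp add: C_def Ej_def)
    qed
    finally have 1: "Ef (set xs) = (\<Sum>t\<in>set ys. cov (b x) (b t) * Ef (set ys - {t})) +
      \<kappa> * (\<Sum>j\<in>Y. \<Sum>t\<in>P. C j x t * Ej j (set ys \<union> (P - {t})))"
      unfolding Ef_def .
    have 2: "m (set xs) = (\<Sum>t\<in>set ys. cov (b x) (b t) * m (set ys - {t}))"
      unfolding m_def Cons using d bI by (subst list.set, subst expectation_gmono_insert) auto
    have "Ef (set xs) - m (set xs) * Ef {} =
      (\<Sum>y\<in>set ys. cov (b x) (b y) * (Ef (set ys - {y}) - m (set ys - {y}) * Ef {})) +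
      \<kappa> * (\<Sum>j\<in>Y. \<Sum>t\<in>P. C j x t * Ej j (set ys \<union> (P - {t})))"
      unfolding 1 2 by (simp add: right_diff_distrib sum_subtractf sum_distrib_right mult.assoc)
    also have "(\<Sum>y\<in>set ys. cov (b x) (b y) * (Ef (set ys - {y}) - m (set ys - {y}) * Ef {})) =
      (\<Sum>y\<in>set ys. \<Sum>j\<in>Y. \<kappa> * (C j x y * (\<Sum>Q\<in>Pow U. stein_coef (C j) (remove1 y ys) P Q * Ej j Q)))"
    proof (rule sum.cong[OF refl])
      fix y assume y: "y \<in> set ys"
      have "cov (b x) (b y) * (\<kappa> * (\<Sum>j\<in>Y. \<Sum>Q\<in>Pow U. stein_coef (C j) (remove1 y ys) P Q * Ej j Q)) =
        (\<Sum>j\<in>Y. \<kappa> * (cov (b x) (b y) * (\<Sum>Q\<in>Pow U. stein_coef (C j) (remove1 y ys) P Q * Ej j Q)))"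
        by (simp add: sum_distrib_left mult_ac)
      also have "\<dots> = (\<Sum>j\<in>Y. \<kappa> * (C j x y * (\<Sum>Q\<in>Pow U. stein_coef (C j) (remove1 y ys) P Q * Ej j Q)))"
        by (rule sum.cong[OF refl]) (use eb y in \<open>simp add: C_def\<close>)
      finally show "cov (b x) (b y) * (Ef (set ys - {y}) - m (set ys - {y}) * Ef {}) = \<dots>"
        unfolding IH[OF y] .
    qed
    also have "\<dots> = \<kappa> * (\<Sum>j\<in>Y. \<Sum>y\<in>set ys. C j x y * (\<Sum>Q\<in>Pow U. stein_coef (C j) (remove1 y ys) P Q * Ej j Q))"
      by (subst sum.swap) (simp add: sum_distrib_left)
    also have "\<dots> + \<kappa> * (\<Sum>j\<in>Y. \<Sum>t\<in>P. C j x t * Ej j (set ys \<union> (P - {t}))) =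
      \<kappa> * (\<Sum>j\<in>Y. (\<Sum>t\<in>P. C j x t * Ej j (set ys \<union> (P - {t}))) +
        (\<Sum>y\<in>set ys. C j x y * (\<Sum>Q\<in>Pow U. stein_coef (C j) (remove1 y ys) P Q * Ej j Q)))"
      by (simp add: sum.distrib distrib_left)
    also have "\<dots> = \<kappa> * (\<Sum>j\<in>Y. \<Sum>Q\<in>Pow U. stein_coef (C j) xs P Q * Ej j Q)"
      unfolding Cons using U d by (subst stein_coef_sum_Cons) auto
    finally show ?thesis using centered[of "set xs"] unfolding m_def C_def Ej_def by simp
  qed
qed

text \<open>The case where f is the identity and W a single monomial: a covariance of monomials
  becomes a sum of expectations, each reached through a contraction that joins the two.\<close>

lemma expectation_gmono_Un:
  assumes U: "finite U" "P \<subseteq> U" and xs: "distinct xs" "set xs \<subseteq> U" "set xs \<inter> P = {}"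
    and e: "\<And>t. t \<in> U \<Longrightarrow> e t \<in> I"
  shows "expectation (gmono e (set xs \<union> P)) - expectation (gmono e (set xs)) * expectation (gmono e P) =
    (\<Sum>Q\<in>Pow U. stein_coef (\<lambda>t u. cov (e t) (e u)) xs P Q * expectation (gmono e Q))"
proof -
  have "(\<integral>\<omega>. (gmono e (set xs) \<omega> - expectation (gmono e (set xs))) * gmono e P \<omega> \<partial>M) =
    1 * (\<Sum>j\<in>{()}. \<Sum>Q\<in>Pow U. stein_coef (\<lambda>t u. cov (e t) (e u)) xs P Q * (\<integral>\<omega>. gmono e Q \<omega> * 1 \<partial>M))"
    by (rule stein_coefficient_identity[where f="\<lambda>x. x" and f'="\<lambda>_. 1" and B=1])
       (use assms in auto)
  moreover have "gmono e (set xs \<union> P) = (\<lambda>\<omega>. gmono e (set xs) \<omega> * gmono e P \<omega>)"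
    using U xs finite_subset[of P U] by (simp add: gmono_Un fun_eq_iff)
  moreover have "(\<integral>\<omega>. (gmono e (set xs) \<omega> - expectation (gmono e (set xs))) * gmono e P \<omega> \<partial>M) =
    (\<integral>\<omega>. gmono e (set xs) \<omega> * gmono e P \<omega> \<partial>M) - expectation (gmono e (set xs)) * expectation (gmono e P)"
  proof -
    have "all_moments (gmono e (set xs))" "all_moments (gmono e P)" using assms by (auto intro!: gmono_moments)
    then have "integrable M (\<lambda>\<omega>. gmono e (set xs) \<omega> * gmono e P \<omega>)" "integrable M (gmono e P)"
      by (auto intro!: all_moments_integrable all_moments_intros)
    then show ?thesis by (simp add: left_diff_distrib)
  qed
  ultimately show ?thesis by simp
qed

lemma expectation_gmono_nonneg:
  assumes "finite S" "\<And>t. t \<in> S \<Longrightarrow> e t \<in> I" "\<And>t u. t \<in> S \<Longrightarrow> u \<in> S \<Longrightarrow> 0 \<le> cov (e t) (e u)"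
  shows "0 \<le> expectation (gmono e S)"
  using assms
proof (induction S rule: finite_minus_induct)
  case (insert x S)
  note 3 = insert
  have "0 \<le> (\<Sum>t\<in>S. cov (e x) (e t) * expectation (gmono e (S - {t})))"
    using 3 by (intro sum_nonneg mult_nonneg_nonneg) auto
  then show ?case using 3 by (subst expectation_gmono_insert) auto
qed simp

lemma expectation_gmono_bound:
  assumes "finite S" "\<And>t. t \<in> S \<Longrightarrow> e t \<in> I" "\<And>t u. t \<in> S \<Longrightarrow> u \<in> S \<Longrightarrow> \<bar>cov (e t) (e u)\<bar> \<le> B"
    and "1 \<le> B" "card S \<le> N"
  shows "\<bar>expectation (gmono e S)\<bar> \<le> (B * real N) ^ card S"
  using assms
proof (induction S rule: finite_minus_induct)
  case empty
  show ?case by (simp add: prob_space)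
next
  case (insert x S)
  note 3 = insert
  have N: "1 \<le> N" using 3 by simp
  then have BN: "1 \<le> B * real N" using 3(6) mult_mono[of 1 B 1 "real N"] by simp
  have IH: "\<bar>expectation (gmono e (S - {t}))\<bar> \<le> (B * real N) ^ card S" if t: "t \<in> S" for t
  proof -
    have "\<bar>expectation (gmono e (S - {t}))\<bar> \<le> (B * real N) ^ card (S - {t})"
      using 3 t by (intro 3(3)) auto
    also have "\<dots> \<le> (B * real N) ^ card S"
      using BN 3(1) by (intro power_increasing) (auto simp: card_mono)
    finally show ?thesis .
  qed
  have "\<bar>expectation (gmono e (insert x S))\<bar> = \<bar>\<Sum>t\<in>S. cov (e x) (e t) * expectation (gmono e (S - {t}))\<bar>"
    using 3 by (subst expectation_gmono_insert) auto
  also have "\<dots> \<le> (\<Sum>t\<in>S. B * (B * real N) ^ card S)"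
    using 3 IH BN by (intro order_trans[OF sum_abs] sum_mono) (auto simp: abs_mult intro!: mult_mono)
  also have "\<dots> \<le> real N * (B * (B * real N) ^ card S)"
    using 3 BN by (auto intro!: mult_right_mono)
  finally show ?case using 3 by (simp add: mult_ac)
qed

lemma expectation_gmono_matching:
  assumes "finite S" "\<And>t. t \<in> S \<Longrightarrow> e t \<in> I"
    and "\<And>t u. t \<in> S \<Longrightarrow> u \<in> S \<Longrightarrow> cov (e t) (e u) \<noteq> 0 \<Longrightarrow> lab t = lab u"
    and "expectation (gmono e S) \<noteq> 0"
  shows "\<exists>\<sigma>. matching lab \<sigma> S"
  using assms
proof (induction S rule: finite_minus_induct)
  case (insert x S)
  note 3 = insert
  have "(\<Sum>t\<in>S. cov (e x) (e t) * expectation (gmono e (S - {t}))) \<noteq> 0"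
    using 3(6) 3(1,2,4) by (subst (asm) expectation_gmono_insert) auto
  then obtain t where t: "t \<in> S" "cov (e x) (e t) * expectation (gmono e (S - {t})) \<noteq> 0"
    by (rule sum.not_neutral_contains_not_neutral)
  then obtain \<sigma> where s: "matching lab \<sigma> (S - {t})" using 3(3)[of t] 3(4,5) by auto
  have "lab x = lab t" using 3(5)[of x t] t by auto
  from matching_insert2[OF s _ _ _ this] 3(2) t(1)
  have "matching lab (\<sigma>(x := t, t := x)) (insert x (insert t (S - {t})))" by auto
  moreover have "insert t (S - {t}) = S" using t(1) by auto
  ultimately show ?case by auto
qed auto

text \<open>Pairing each t with \<open>\<pi> t\<close> is one summand of Wick's formula, and
  nonnegative covariances allow all other summands to be dropped.\<close>

lemma expectation_gmono_paired:
  assumes "finite A" "inj_on \<pi> A" "A \<inter> \<pi> ` A = {}"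
    and "\<And>t. t \<in> A \<union> \<pi> ` A \<Longrightarrow> e t \<in> I"
    and "\<And>t u. t \<in> A \<union> \<pi> ` A \<Longrightarrow> u \<in> A \<union> \<pi> ` A \<Longrightarrow> 0 \<le> cov (e t) (e u)"
    and "\<And>t. t \<in> A \<Longrightarrow> \<gamma> \<le> cov (e t) (e (\<pi> t))" "0 \<le> \<gamma>"
  shows "\<gamma> ^ card A \<le> expectation (gmono e (A \<union> \<pi> ` A))"
  using assms
proof (induction A rule: finite_induct)
  case empty
  show ?case by (simp add: prob_space)
next
  case (insert x A)
  let ?S = "A \<union> insert (\<pi> x) (\<pi> ` A)"
  have S: "finite ?S" "x \<notin> ?S" using insert by auto
  have eq: "insert x A \<union> \<pi> ` insert x A = insert x ?S" by auto
  have pA: "\<pi> x \<notin> A \<union> \<pi> ` A" using insert by auto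
  have nn: "0 \<le> cov (e x) (e t) * expectation (gmono e (?S - {t}))" if "t \<in> ?S" for t
    using insert that S by (intro mult_nonneg_nonneg expectation_gmono_nonneg) auto
  have IH: "\<gamma> ^ card A \<le> expectation (gmono e (A \<union> \<pi> ` A))"
    using insert by (intro insert.IH) auto
  have "\<gamma> ^ card (insert x A) = \<gamma> * \<gamma> ^ card A" using insert by simp
  also have "\<dots> \<le> cov (e x) (e (\<pi> x)) * expectation (gmono e (A \<union> \<pi> ` A))"
    using insert IH by (intro mult_mono) auto
  also have "A \<union> \<pi> ` A = ?S - {\<pi> x}" using pA by auto
  also have "cov (e x) (e (\<pi> x)) * expectation (gmono e (?S - {\<pi> x})) \<le>
      (\<Sum>t\<in>?S. cov (e x) (e t) * expectation (gmono e (?S - {t})))"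
    by (rule member_le_sum) (use nn S in auto)
  also have "\<dots> = expectation (gmono e (insert x ?S))"
    by (rule expectation_gmono_insert[symmetric]) (use S insert in auto)
  finally show ?case unfolding eq .
qed

end

section \<open>Stein's method for total variation\<close>

definition normal_tail :: "real \<Rightarrow> real" where
  "normal_tail x = (\<integral>t. std_normal_density t * indicator {x..} t \<partial>lborel)"

lemma integrable_std_normal_density_indicator:
  "A \<in> sets borel \<Longrightarrow> integrable lborel (\<lambda>t. std_normal_density t * indicator A t)"
  using integrable_real_mult_indicator[of A lborel std_normal_density] by (simp add: integrable_normal_density)

text \<open>On the half line from x on, the factor x is at most t, and t times the density is the
  derivative of minus the density.\<close>

lemma mills_ratio_bound:
  assumes "0 \<le> x"
  shows "x * normal_tail x \<le> std_normal_density x"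
proof -
  have deriv: "((\<lambda>t. - std_normal_density t) has_real_derivative (t * std_normal_density t)) (at t)" for t
    using DERIV_minus[OF normal_density_deriv[of 1 t]] by simp
  have lim: "((\<lambda>t. - std_normal_density t) \<longlongrightarrow> 0) at_top"
    using tendsto_minus[OF poly_growth_normal_tendsto(1)[of 1 "\<lambda>_. 1"]] by simp
  have "(\<integral>\<^sup>+t. ennreal (t * std_normal_density t) * indicator {x..} t \<partial>lborel) = ennreal (0 - (- std_normal_density x))"
    by (rule nn_integral_FTC_atLeast) (use assms deriv lim in auto)
  moreover have "(\<integral>\<^sup>+t. ennreal (t * std_normal_density t * indicator {x..} t) \<partial>lborel) =
      (\<integral>\<^sup>+t. ennreal (t * std_normal_density t) * indicator {x..} t \<partial>lborel)"
    by (intro nn_integral_cong) (auto simp: indicator_def)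
  ultimately have 1: "(\<integral>\<^sup>+t. ennreal (t * std_normal_density t * indicator {x..} t) \<partial>lborel) = ennreal (std_normal_density x)"
    by simp
  have "ennreal (x * normal_tail x) = ennreal (\<integral>t. x * (std_normal_density t * indicator {x..} t) \<partial>lborel)"
    by (simp add: normal_tail_def)
  also have "\<dots> = (\<integral>\<^sup>+t. ennreal (x * (std_normal_density t * indicator {x..} t)) \<partial>lborel)"
    by (rule nn_integral_eq_integral[symmetric])
       (use assms in \<open>auto intro!: integrable_mult_right integrable_std_normal_density_indicator\<close>)
  also have "\<dots> \<le> (\<integral>\<^sup>+t. ennreal (t * std_normal_density t * indicator {x..} t) \<partial>lborel)"
    by (intro nn_integral_mono ennreal_leI) (auto simp: indicator_def mult_right_mono)
  finally show ?thesis unfolding 1 by (simp add: ennreal_le_iff)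
qed

text \<open>Stein's solution: f is \<open>F\<close> divided by the density, where \<open>F\<close>
  integrates h - E h against the normal law up to x. The full integral is zero, so \<open>F\<close>
  is also minus the integral from x on. Estimating by the tail on the side of x, the Mills ratio
  bounds |x f| by 1. As |h - E h| is at most 1, f' = (h - E h) + x f is bounded by 2.\<close>

lemma stein_solution:
  fixes h :: "real \<Rightarrow> real"
  assumes h: "\<And>x. isCont h x" "\<And>x. 0 \<le> h x" "\<And>x. h x \<le> 1"
  obtains f f' where "\<And>x. (f has_real_derivative f' x) (at x)" "\<And>x. isCont f' x" "\<And>x. \<bar>f' x\<bar> \<le> 2"
    "\<And>x. f' x - x * f x = h x - (\<integral>t. h t \<partial>std_normal_distribution)"
proof -
  interpret N: prob_space std_normal_distribution by (rule prob_space_normal_density) simp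
  have [measurable]: "h \<in> borel_measurable borel"
    using h(1) by (auto intro!: borel_measurable_continuous_onI simp: continuous_on_eq_continuous_at)
  define c where "c = (\<integral>t. h t \<partial>std_normal_distribution)"
  define g where "g = (\<lambda>x. h x - c)"
  have inth: "integrable std_normal_distribution h"
    by (rule N.integrable_const_bound[where B=1]) (use h in auto)
  have c: "0 \<le> c" "c \<le> 1"
    unfolding c_def using h(2,3) inth N.integral_le_const[OF inth, of 1] by (auto intro!: Bochner_Integration.integral_nonneg)
  have g: "isCont g x" "\<bar>g x\<bar> \<le> 1" for x
    unfolding g_def using h(2)[of x] h(3)[of x] c by (auto intro!: continuous_intros h(1))
  have [measurable]: "g \<in> borel_measurable borel" unfolding g_def by measurable
  define \<psi> where "\<psi> = (\<lambda>t. g t * std_normal_density t)"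
  have contn: "isCont std_normal_density x" for x
    using normal_density_deriv[of 1 x] by (auto intro: DERIV_isCont)
  have cont\<psi>: "isCont \<psi> x" for x unfolding \<psi>_def by (intro continuous_intros g contn)
  have [measurable]: "\<psi> \<in> borel_measurable borel" unfolding \<psi>_def by measurable
  have \<psi>_le: "\<bar>\<psi> t\<bar> \<le> std_normal_density t" for t
    unfolding \<psi>_def abs_mult using g(2)[of t] by (simp add: mult_left_le_one_le)
  have int\<psi>: "integrable lborel (\<lambda>t. \<psi> t * indicator A t)" if [measurable]: "A \<in> sets borel" for A
    by (rule Bochner_Integration.integrable_bound[OF integrable_std_normal_density_indicator[OF that]])
       (use \<psi>_le in \<open>simp_all add: indicator_def\<close>)
  have int\<psi>0: "integrable lborel \<psi>" using int\<psi>[of UNIV] by simp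
  have "(\<integral>t. g t \<partial>std_normal_distribution) = 0"
    unfolding g_def using inth N.prob_space by (simp add: c_def)
  then have \<psi>0: "(\<integral>t. \<psi> t \<partial>lborel) = 0"
    by (subst (asm) integral_density) (auto simp: \<psi>_def mult.commute)
  define F where "F = (\<lambda>x. \<integral>t. \<psi> t * indicator {..x} t \<partial>lborel)"
  \<comment> \<open>\<open>F0\<close> is any antiderivative of \<open>\<psi>\<close>.
    \<open>F\<close>, the one that vanishes at minus infinity, differs from it by a constant and is
    therefore differentiable as well.\<close>
  obtain F0 where F0: "\<And>x. (F0 has_real_derivative \<psi> x) (at x)"
    using einterval_antiderivative[of "-\<infinity>" \<infinity> \<psi>] cont\<psi>
    by (auto simp: has_real_derivative_iff_has_vector_derivative)
  have diff: "F y - F x = F0 y - F0 x" if "x \<le> y" for x y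
  proof -
    have "F y - F x = (\<integral>t. \<psi> t * indicator {..y} t - \<psi> t * indicator {..x} t \<partial>lborel)"
      unfolding F_def by (rule Bochner_Integration.integral_diff[symmetric]) (auto intro!: int\<psi>)
    also have "\<dots> = (\<integral>t. \<psi> t * indicator {x<..y} t \<partial>lborel)"
      using that by (intro Bochner_Integration.integral_cong) (auto simp: indicator_def)
    also have "\<dots> = (\<integral>t. \<psi> t * indicator {x..y} t \<partial>lborel)"
    proof (rule integral_cong_AE)
      show "AE t in lborel. \<psi> t * indicator {x<..y} t = \<psi> t * indicator {x..y} t"
        using AE_lborel_singleton[of x] by eventually_elim (auto simp: indicator_def)
    qed auto
    also have "\<dots> = F0 y - F0 x"
      by (rule integral_FTC_Icc_real[OF that]) (use F0 cont\<psi> in auto)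
    finally show ?thesis .
  qed
  have F: "(F has_real_derivative \<psi> x) (at x)" for x
  proof -
    have "F y = F0 y + (F 0 - F0 0)" for y
      using diff[of 0 y] diff[of y 0] by (cases "0 \<le> y") auto
    then have eq: "F = (\<lambda>y. F0 y + (F 0 - F0 0))" by (rule ext)
    have "((\<lambda>y. F0 y + (F 0 - F0 0)) has_real_derivative \<psi> x + 0) (at x)"
      by (rule DERIV_add[OF F0 DERIV_const])
    then show ?thesis unfolding eq[symmetric] by simp
  qed
  have F_tail: "\<bar>F x\<bar> \<le> normal_tail x" for x
  proof -
    have "F x = - (\<integral>t. \<psi> t * indicator {x<..} t \<partial>lborel)"
    proof -
      have "(\<integral>t. \<psi> t * indicator {..x} t + \<psi> t * indicator {x<..} t \<partial>lborel) = (\<integral>t. \<psi> t \<partial>lborel)"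
        by (intro Bochner_Integration.integral_cong) (auto simp: indicator_def)
      then show ?thesis
        unfolding F_def \<psi>0 by (subst (asm) Bochner_Integration.integral_add) (auto intro!: int\<psi>)
    qed
    then have "\<bar>F x\<bar> \<le> (\<integral>t. \<bar>\<psi> t * indicator {x<..} t\<bar> \<partial>lborel)"
      using integral_abs_bound[of lborel "\<lambda>t. \<psi> t * indicator {x<..} t"] by simp
    also have "\<dots> \<le> normal_tail x"
      unfolding normal_tail_def
      by (intro integral_mono integrable_abs int\<psi> integrable_std_normal_density_indicator)
         (auto simp: indicator_def \<psi>_le)
    finally show ?thesis .
  qed
  have F_tail': "\<bar>F x\<bar> \<le> normal_tail (- x)" for x
  proof -
    have "\<bar>F x\<bar> \<le> (\<integral>t. \<bar>\<psi> t * indicator {..x} t\<bar> \<partial>lborel)"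
      unfolding F_def by (rule integral_abs_bound)
    also have "\<dots> \<le> (\<integral>t. std_normal_density t * indicator {..x} t \<partial>lborel)"
      by (intro integral_mono integrable_abs int\<psi> integrable_std_normal_density_indicator)
         (auto simp: indicator_def \<psi>_le)
    also have "\<dots> = (\<integral>t. std_normal_density (- t) * indicator {..x} (- t) \<partial>lborel)"
      using lborel_integral_real_affine[of "-1" "\<lambda>t. std_normal_density t * indicator {..x} t" 0] by simp
    also have "\<dots> = normal_tail (- x)"
      unfolding normal_tail_def by (intro Bochner_Integration.integral_cong) (auto simp: indicator_def normal_density_def)
    finally show ?thesis .
  qed
  have pos: "0 < std_normal_density x" for x by (simp add: normal_density_pos)
  have xF: "\<bar>x * F x\<bar> \<le> std_normal_density x" for x
  proof (cases "0 \<le> x")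
    case True
    then have "\<bar>x * F x\<bar> \<le> x * normal_tail x" using F_tail[of x] by (simp add: abs_mult mult_left_mono)
    then show ?thesis using mills_ratio_bound[OF True] by linarith
  next
    case False
    then have "\<bar>x * F x\<bar> \<le> (- x) * normal_tail (- x)"
      using F_tail'[of x] mult_left_mono[OF F_tail'[of x], of "- x"] by (simp add: abs_mult)
    moreover have "std_normal_density (- x) = std_normal_density x" by (simp add: normal_density_def)
    ultimately show ?thesis using mills_ratio_bound[of "- x"] False by linarith
  qed
  define f where "f = (\<lambda>x. F x / std_normal_density x)"
  define f' where "f' = (\<lambda>x. g x + x * f x)"
  have df: "(f has_real_derivative f' x) (at x)" for x
  proof -
    have "(f has_real_derivative (\<psi> x * std_normal_density x - F x * (- x / 1\<^sup>2 * std_normal_density x)) /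
        (std_normal_density x * std_normal_density x)) (at x)"
      unfolding f_def by (rule DERIV_divide[OF F normal_density_deriv]) (use pos[of x] in auto)
    moreover have "(\<psi> x * std_normal_density x - F x * (- x / 1\<^sup>2 * std_normal_density x)) /
        (std_normal_density x * std_normal_density x) = f' x"
      unfolding f'_def f_def \<psi>_def using pos[of x] by (simp add: field_simps)
    ultimately show ?thesis by simp
  qed
  show thesis
  proof (rule that[of f f'])
    show "(f has_real_derivative f' x) (at x)" for x by (rule df)
    show "isCont f' x" for x
      unfolding f'_def by (intro continuous_intros g DERIV_isCont[OF df])
    show "\<bar>f' x\<bar> \<le> 2" for x
    proof -
      have "\<bar>x * f x\<bar> \<le> 1" using xF[of x] pos[of x] unfolding f_def by (simp add: abs_mult abs_divide field_simps)
      then show ?thesis unfolding f'_def using g(2)[of x] by linarith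
    qed
    show "f' x - x * f x = h x - (\<integral>t. h t \<partial>std_normal_distribution)" for x
      by (simp add: f'_def g_def c_def)
  qed
qed

text \<open>Stein's equation has a continuously differentiable solution only for continuous test functions;
  inner regularity extends the bound to Borel sets.\<close>

lemma measure_diff_bound_from_continuous:
  fixes M N :: "real measure"
  assumes M: "prob_space M" "sets M = sets borel" and N: "prob_space N" "sets N = sets borel"
    and bound: "\<And>h. (\<And>x. isCont h x) \<Longrightarrow> (\<And>x. 0 \<le> h x) \<Longrightarrow> (\<And>x. h x \<le> 1) \<Longrightarrow>
      (\<integral>x. h x \<partial>M) - (\<integral>x. h x \<partial>N) \<le> \<epsilon>"
    and A: "A \<in> sets borel"
  shows "measure M A - measure N A \<le> \<epsilon>"
proof -
  interpret M: prob_space M by (rule M)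
  interpret N: prob_space N by (rule N)
  note [measurable_cong] = M(2) N(2)
  have K: "measure M K - measure N K \<le> \<epsilon>" if "compact K" for K
  proof (cases "K = {}")
    case True
    then show ?thesis using bound[of "\<lambda>_. 0"] by simp
  next
    case False
    have closed: "closed K" using that by (rule compact_imp_closed)
    then have [measurable]: "K \<in> sets borel" by simp
    \<comment> \<open>Continuous cut-offs: 1 on \<open>K\<close> and, for positive n, 0 at distance
      at least 1/n from it. Closedness of \<open>K\<close> makes them converge pointwise to its
      indicator.\<close>
    define h where "h = (\<lambda>n x. max 0 (1 - real n * infdist x K))"
    have cont: "isCont (h n) x" for n x unfolding h_def by (intro continuous_intros)
    have [measurable]: "h n \<in> borel_measurable borel" for n
      by (auto intro!: borel_measurable_continuous_onI simp: continuous_on_eq_continuous_at cont)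
    have h01: "0 \<le> h n x" "h n x \<le> 1" for n x by (auto simp: h_def infdist_nonneg)
    have lim: "(\<lambda>n. h n x) \<longlonglongrightarrow> indicator K x" for x
    proof (cases "x \<in> K")
      case True
      then show ?thesis by (simp add: h_def)
    next
      case F: False
      then have d: "0 < infdist x K"
        using in_closed_iff_infdist_zero[OF closed False, of x] infdist_nonneg[of x K] by linarith
      obtain n0 :: nat where n0: "1 / infdist x K < real n0" using reals_Archimedean2 by blast
      have "h n x = 0" if "n \<ge> n0" for n
      proof -
        have "1 < real n0 * infdist x K" using n0 d by (simp add: field_simps)
        also have "\<dots> \<le> real n * infdist x K" using that d by (intro mult_right_mono) auto
        finally show ?thesis by (simp add: h_def)
      qed
      then have "eventually (\<lambda>n. h n x = 0) sequentially" by (auto simp: eventually_sequentially)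
      then show ?thesis using F by (simp add: tendsto_eventually)
    qed
    have "(\<lambda>n. \<integral>x. h n x \<partial>M) \<longlonglongrightarrow> (\<integral>x. indicator K x \<partial>M)"
      by (rule integral_dominated_convergence[where w="\<lambda>_. 1"]) (use h01 lim in auto)
    moreover have "(\<lambda>n. \<integral>x. h n x \<partial>N) \<longlonglongrightarrow> (\<integral>x. indicator K x \<partial>N)"
      by (rule integral_dominated_convergence[where w="\<lambda>_. 1"]) (use h01 lim in auto)
    ultimately have "(\<lambda>n. (\<integral>x. h n x \<partial>M) - (\<integral>x. h n x \<partial>N)) \<longlonglongrightarrow> measure M K - measure N K"
      using M(2) N(2) by (auto intro!: tendsto_diff)
    then show ?thesis
      by (rule LIMSEQ_le_const2) (use bound[OF cont h01] in auto)
  qed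
  show ?thesis
  proof (rule field_le_epsilon)
    fix \<delta> :: real assume d: "0 < \<delta>"
    have "emeasure M A = (SUP K \<in> {K. K \<subseteq> A \<and> compact K}. emeasure M K)"
      by (rule inner_regular) (use M A M.emeasure_space_1 in auto)
    moreover have "emeasure M A < \<infinity>" by (simp add: M.emeasure_eq_measure)
    ultimately obtain K where K': "K \<subseteq> A" "compact K" "emeasure M A < emeasure M K + ennreal \<delta>"
    proof -
      assume *: "emeasure M A = (SUP K \<in> {K. K \<subseteq> A \<and> compact K}. emeasure M K)"
      have "\<exists>K. K \<subseteq> A \<and> compact K \<and> measure M A - \<delta> < measure M K"
      proof (rule ccontr)
        assume "\<not> ?thesis"
        then have le: "measure M K \<le> measure M A - \<delta>" if "K \<subseteq> A" "compact K" for K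
          using that by (meson not_less)
        from le[of "{}"] have nn: "0 \<le> measure M A - \<delta>" by simp
        have "emeasure M A \<le> ennreal (measure M A - \<delta>)"
          unfolding * by (rule SUP_least) (auto simp: M.emeasure_eq_measure intro!: ennreal_leI le)
        then show False using nn d by (simp add: M.emeasure_eq_measure)
      qed
      then obtain K where K: "K \<subseteq> A" "compact K" "measure M A - \<delta> < measure M K" by blast
      then have "emeasure M A < emeasure M K + ennreal \<delta>"
        using d by (simp add: M.emeasure_eq_measure ennreal_less_iff flip: ennreal_plus)
      with K show thesis using that by blast
    qed
    have "measure M A < measure M K + \<delta>"
      using K'(3) d by (simp add: M.emeasure_eq_measure ennreal_less_iff flip: ennreal_plus)
    moreover have "measure N K \<le> measure N A"
      using K'(1) A N(2) by (intro N.finite_measure_mono) auto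
    ultimately show "measure M A - measure N A \<le> \<epsilon> + \<delta>" using K[OF K'(2)] by linarith
  qed
qed

text \<open>A supremum of reals can be compared with its members once the set is bounded, here by 1;
  the empty set then gives the value 0. This is the lower half of the final sandwich.\<close>

lemma tv_dist_nonneg:
  assumes "prob_space M" "prob_space N"
  shows "0 \<le> tv_dist M X N Y"
proof -
  interpret M: prob_space M by (rule assms)
  interpret N: prob_space N by (rule assms)
  have "\<bar>measure M U - measure N V\<bar> \<le> 1" for U V
    using M.prob_le_1[of U] N.prob_le_1[of V] measure_nonneg[of M U] measure_nonneg[of N V] by linarith
  then have "bdd_above ((\<lambda>A. \<bar>measure M (X -` A \<inter> space M) - measure N (Y -` A \<inter> space N)\<bar>) ` sets borel)"
    by (intro bdd_aboveI[of _ 1]) auto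
  then have "\<bar>measure M (X -` {} \<inter> space M) - measure N (Y -` {} \<inter> space N)\<bar> \<le> tv_dist M X N Y"
    unfolding tv_dist_def by (rule cSUP_upper2[OF _ sets.empty_sets]) simp
  then show ?thesis by simp
qed

text \<open>With f the solution of Stein's equation for h, the two expectations of h differ by E
  (f'(Z) - Z f(Z)) = E ((1 - T) f'(Z)), and |f'| is at most 2.\<close>

theorem (in prob_space) stein_tv_bound:
  fixes Z T :: "'a \<Rightarrow> real"
  assumes [measurable]: "Z \<in> borel_measurable M" and T: "integrable M T"
    and stein: "\<And>f f' B. (\<And>x. (f has_real_derivative f' x) (at x)) \<Longrightarrow> (\<And>x. isCont f' x) \<Longrightarrow>
      (\<And>x. \<bar>f' x\<bar> \<le> B) \<Longrightarrow> (\<integral>\<omega>. Z \<omega> * f (Z \<omega>) \<partial>M) = (\<integral>\<omega>. T \<omega> * f' (Z \<omega>) \<partial>M)"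
  shows "tv_dist M Z std_normal_distribution (\<lambda>x. x) \<le> 2 * (\<integral>\<omega>. \<bar>1 - T \<omega>\<bar> \<partial>M)"
proof -
  interpret N: prob_space std_normal_distribution by (rule prob_space_normal_density) simp
  have D: "prob_space (distr M borel Z)" by (rule prob_space_distr) simp
  have main: "\<bar>(\<integral>x. h x \<partial>distr M borel Z) - (\<integral>x. h x \<partial>std_normal_distribution)\<bar> \<le> 2 * (\<integral>\<omega>. \<bar>1 - T \<omega>\<bar> \<partial>M)"
    if h: "\<And>x. isCont h x" "\<And>x. 0 \<le> h x" "\<And>x. h x \<le> 1" for h
  proof -
    have [measurable]: "h \<in> borel_measurable borel"
      by (auto intro!: borel_measurable_continuous_onI simp: continuous_on_eq_continuous_at h)
    obtain f f' where f: "\<And>x. (f has_real_derivative f' x) (at x)" "\<And>x. isCont f' x" "\<And>x. \<bar>f' x\<bar> \<le> 2"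
      "\<And>x. f' x - x * f x = h x - (\<integral>t. h t \<partial>std_normal_distribution)"
      by (rule stein_solution[of h]) (use h that in auto)
    define c where "c = (\<integral>t. h t \<partial>std_normal_distribution)"
    have contf: "isCont f x" for x using f(1) by (rule DERIV_isCont)
    have [measurable]: "f \<in> borel_measurable borel" "f' \<in> borel_measurable borel"
      by (auto intro!: borel_measurable_continuous_onI simp: continuous_on_eq_continuous_at contf f(2))
    have ih: "integrable M (\<lambda>\<omega>. h (Z \<omega>))" by (rule integrable_const_bound[where B=1]) (use h in auto)
    have if': "integrable M (\<lambda>\<omega>. f' (Z \<omega>))" by (rule integrable_const_bound[where B=2]) (use f(3) in auto)
    have Zf: "Z \<omega> * f (Z \<omega>) = f' (Z \<omega>) - h (Z \<omega>) + c" for \<omega>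
      using f(4)[of "Z \<omega>"] unfolding c_def by linarith
    have [measurable]: "T \<in> borel_measurable M" using T by auto
    have iTf: "integrable M (\<lambda>\<omega>. T \<omega> * f' (Z \<omega>))"
    proof (rule Bochner_Integration.integrable_bound)
      show "integrable M (\<lambda>\<omega>. 2 * T \<omega>)" using T by simp
      have "\<bar>T \<omega>\<bar> * \<bar>f' (Z \<omega>)\<bar> \<le> \<bar>T \<omega>\<bar> * 2" for \<omega> by (intro mult_left_mono f(3)) auto
      then show "AE \<omega> in M. norm (T \<omega> * f' (Z \<omega>)) \<le> norm (2 * T \<omega>)"
        by (intro AE_I2) (simp add: abs_mult mult.commute)
    qed measurable
    have "(\<integral>\<omega>. T \<omega> * f' (Z \<omega>) \<partial>M) = (\<integral>\<omega>. f' (Z \<omega>) - h (Z \<omega>) + c \<partial>M)"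
      using stein[OF f(1-3)] unfolding Zf by simp
    also have "\<dots> = (\<integral>\<omega>. f' (Z \<omega>) \<partial>M) - (\<integral>\<omega>. h (Z \<omega>) \<partial>M) + c"
      using ih if' by (simp add: prob_space)
    finally have "(\<integral>\<omega>. h (Z \<omega>) \<partial>M) - c = (\<integral>\<omega>. f' (Z \<omega>) \<partial>M) - (\<integral>\<omega>. T \<omega> * f' (Z \<omega>) \<partial>M)" by linarith
    also have "\<dots> = (\<integral>\<omega>. f' (Z \<omega>) - T \<omega> * f' (Z \<omega>) \<partial>M)" using iTf if' by simp
    finally have eq: "(\<integral>\<omega>. h (Z \<omega>) \<partial>M) - c = (\<integral>\<omega>. f' (Z \<omega>) - T \<omega> * f' (Z \<omega>) \<partial>M)" .
    have "\<bar>(\<integral>\<omega>. h (Z \<omega>) \<partial>M) - c\<bar> \<le> (\<integral>\<omega>. \<bar>f' (Z \<omega>) - T \<omega> * f' (Z \<omega>)\<bar> \<partial>M)"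
      unfolding eq by (rule integral_abs_bound)
    also have "\<dots> \<le> (\<integral>\<omega>. 2 * \<bar>1 - T \<omega>\<bar> \<partial>M)"
    proof (rule integral_mono)
      show "integrable M (\<lambda>\<omega>. \<bar>f' (Z \<omega>) - T \<omega> * f' (Z \<omega>)\<bar>)" using iTf if' by simp
      show "integrable M (\<lambda>\<omega>. 2 * \<bar>1 - T \<omega>\<bar>)" using T by simp
      fix \<omega>
      have "f' (Z \<omega>) - T \<omega> * f' (Z \<omega>) = (1 - T \<omega>) * f' (Z \<omega>)" by (simp add: algebra_simps)
      then have "\<bar>f' (Z \<omega>) - T \<omega> * f' (Z \<omega>)\<bar> = \<bar>1 - T \<omega>\<bar> * \<bar>f' (Z \<omega>)\<bar>" by (simp add: abs_mult)
      also have "\<dots> \<le> \<bar>1 - T \<omega>\<bar> * 2" by (intro mult_left_mono f(3)) auto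
      finally show "\<bar>f' (Z \<omega>) - T \<omega> * f' (Z \<omega>)\<bar> \<le> 2 * \<bar>1 - T \<omega>\<bar>" by simp
    qed
    finally show ?thesis unfolding c_def by (simp add: integral_distr)
  qed
  show ?thesis
    unfolding tv_dist_def
  proof (rule cSUP_least)
    fix A :: "real set" assume A: "A \<in> sets borel"
    have "measure (distr M borel Z) A - measure std_normal_distribution A \<le> 2 * (\<integral>\<omega>. \<bar>1 - T \<omega>\<bar> \<partial>M)"
      by (rule measure_diff_bound_from_continuous[OF D _ N.prob_space_axioms _ _ A])
         (use main in \<open>auto simp: abs_le_iff\<close>)
    moreover have "measure std_normal_distribution A - measure (distr M borel Z) A \<le> 2 * (\<integral>\<omega>. \<bar>1 - T \<omega>\<bar> \<partial>M)"
      by (rule measure_diff_bound_from_continuous[OF N.prob_space_axioms _ D _ _ A])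
         (use main in \<open>auto simp: abs_le_iff\<close>)
    ultimately show "\<bar>measure M (Z -` A \<inter> space M) - measure std_normal_distribution ((\<lambda>x. x) -` A \<inter> space std_normal_distribution)\<bar>
        \<le> 2 * (\<integral>\<omega>. \<bar>1 - T \<omega>\<bar> \<partial>M)"
      using A by (simp add: measure_distr abs_le_iff)
  qed auto
qed

section \<open>Counting matched walks\<close>

lemma card_le_sum_fibres:
  assumes "finite S" "\<And>y. y \<in> f ` S \<Longrightarrow> card {z \<in> S. f z = y} \<le> k"
  shows "card S \<le> card (f ` S) * k"
proof -
  have "card (\<Union>y\<in>f ` S. {z \<in> S. f z = y}) \<le> (\<Sum>y\<in>f ` S. card {z \<in> S. f z = y})"
    by (rule card_UN_le) (use assms in simp)
  also have "\<dots> \<le> (\<Sum>y\<in>f ` S. k)" by (rule sum_mono) (use assms in auto)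
  also have "(\<Union>y\<in>f ` S. {z \<in> S. f z = y}) = S" by auto
  finally show ?thesis by simp
qed

text \<open>Building a function in the order given by \<open>rk\<close>, there are only two choices at each point of \<open>F\<close>.\<close>

lemma card_forced_functions:
  fixes rk :: "'v \<Rightarrow> nat"
  assumes "finite V" "finite A" "inj_on rk V" "S \<subseteq> (\<Pi>\<^sub>E v\<in>V. A)" "F \<subseteq> V"
    and "\<And>v y. v \<in> F \<Longrightarrow> y \<in> S \<Longrightarrow> card {z v | z. z \<in> S \<and> (\<forall>u\<in>V. rk u < rk v \<longrightarrow> z u = y u)} \<le> 2"
  shows "card S \<le> card A ^ (card V - card F) * 2 ^ card F"
  using assms
proof (induction "card V" arbitrary: V S F rule: less_induct)
  case less
  note fin = less.prems(1,2)
  have finS: "finite S" using less.prems by (meson finite_PiE finite_subset)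
  show ?case
  proof (cases "V = {}")
    case True
    then have "S \<subseteq> {\<lambda>_. undefined}" using less.prems by auto
    from card_mono[OF _ this] have "card S \<le> 1" by simp
    then show ?thesis using True less.prems by simp
  next
    case False
    \<comment> \<open>The point of highest rank is the one chosen last. Restricting to the other
      points keeps the hypothesis, as it looks at points of lower rank only.\<close>
    obtain m where m: "m \<in> V" "\<And>v. v \<in> V \<Longrightarrow> rk v \<le> rk m"
    proof -
      have "Max (rk ` V) \<in> rk ` V" using fin False by (intro Max_in) auto
      then obtain m where "m \<in> V" "rk m = Max (rk ` V)" by auto
      then show thesis using that[of m] fin by simp
    qed
    let ?V = "V - {m}" and ?F = "F - {m}"
    define S' where "S' = (\<lambda>z. restrict z ?V) ` S"
    have lt: "rk u < rk m" if "u \<in> ?V" for u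
    proof -
      have "rk u \<noteq> rk m" using that m(1) inj_on_eq_iff[OF less.prems(3), of u m] by auto
      then show ?thesis using m(2)[of u] that by auto
    qed
    have IH: "card S' \<le> card A ^ (card ?V - card ?F) * 2 ^ card ?F"
    proof (rule less.hyps)
      show "card ?V < card V" using m(1) fin(1) by (rule card_Diff1_less[rotated])
      show "S' \<subseteq> (\<Pi>\<^sub>E v\<in>?V. A)" 
      proof
        fix z' assume "z' \<in> S'"
        then obtain z where "z \<in> S" "z' = restrict z ?V" by (auto simp: S'_def)
        then show "z' \<in> (\<Pi>\<^sub>E v\<in>?V. A)" using less.prems(4) by (auto intro!: restrict_PiE_iff[THEN iffD2])
      qed
      show "inj_on rk ?V" using less.prems(3) by (rule inj_on_subset) auto
      fix v y' assume v: "v \<in> ?F" and "y' \<in> S'"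
      then obtain y where y: "y \<in> S" "y' = restrict y ?V" by (auto simp: S'_def)
      have vV: "v \<in> ?V" using v less.prems(5) by auto
      have "{z v | z. z \<in> S' \<and> (\<forall>u\<in>?V. rk u < rk v \<longrightarrow> z u = y' u)} \<subseteq>
        {z v | z. z \<in> S \<and> (\<forall>u\<in>V. rk u < rk v \<longrightarrow> z u = y u)}"
      proof safe
        fix z' assume "z' \<in> S'" and agree: "\<forall>u\<in>?V. rk u < rk v \<longrightarrow> z' u = y' u"
        then obtain z where z: "z \<in> S" "z' = restrict z ?V" by (auto simp: S'_def)
        have "z u = y u" if "u \<in> V" "rk u < rk v" for u
        proof -
          have "u \<in> ?V" using that lt[OF vV] by auto
          then show ?thesis using agree that(2) z y by auto
        qed
        moreover have "z' v = z v" using z vV by simp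
        ultimately show "\<exists>z. z' v = z v \<and> z \<in> S \<and> (\<forall>u\<in>V. rk u < rk v \<longrightarrow> z u = y u)" using z by auto
      qed
      moreover have "finite {z v | z. z \<in> S \<and> (\<forall>u\<in>V. rk u < rk v \<longrightarrow> z u = y u)}"
        using finS by simp
      ultimately have "card {z v | z. z \<in> S' \<and> (\<forall>u\<in>?V. rk u < rk v \<longrightarrow> z u = y' u)} \<le>
          card {z v | z. z \<in> S \<and> (\<forall>u\<in>V. rk u < rk v \<longrightarrow> z u = y u)}"
        by (rule card_mono[rotated])
      also have "\<dots> \<le> 2" by (rule less.prems(6)) (use v y in auto)
      finally show "card {z v | z. z \<in> S' \<and> (\<forall>u\<in>?V. rk u < rk v \<longrightarrow> z u = y' u)} \<le> 2" .
    qed (use less.prems in auto)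
    define k where "k = (if m \<in> F then 2 else card A)"
    have "card S \<le> card S' * k"
      unfolding S'_def
    proof (rule card_le_sum_fibres[OF finS])
      fix y' assume "y' \<in> (\<lambda>z. restrict z ?V) ` S"
      then obtain y where y: "y \<in> S" "y' = restrict y ?V" by auto
      let ?T = "{z \<in> S. restrict z ?V = y'}"
      have inj: "inj_on (\<lambda>z. z m) ?T"
      proof (rule inj_onI)
        fix z w assume zw: "z \<in> ?T" "w \<in> ?T" "z m = w m"
        show "z = w"
        proof
          fix u
          show "z u = w u"
          proof (cases "u \<in> ?V")
            case True
            moreover have "restrict z ?V u = restrict w ?V u" using zw by simp
            ultimately show ?thesis by simp
          next
            case F: False
            show ?thesis
            proof (cases "u = m")
              case False
              then have "u \<notin> V" using F by auto
              moreover have "z \<in> (\<Pi>\<^sub>E v\<in>V. A)" "w \<in> (\<Pi>\<^sub>E v\<in>V. A)" using zw less.prems(4) by auto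
              ultimately show ?thesis by (metis PiE_arb)
            qed (use zw in simp)
          qed
        qed
      qed
      have sub: "(\<lambda>z. z m) ` ?T \<subseteq> {z m | z. z \<in> S \<and> (\<forall>u\<in>V. rk u < rk m \<longrightarrow> z u = y u)}"
      proof
        fix c assume "c \<in> (\<lambda>z. z m) ` ?T"
        then obtain z where z: "z \<in> S" "restrict z ?V = y'" "c = z m" by auto
        have "z u = y u" if "u \<in> V" "rk u < rk m" for u
        proof -
          have "restrict z ?V u = restrict y ?V u" using z(2) y(2) by simp
          moreover have "u \<in> ?V" using that by auto
          ultimately show ?thesis by simp
        qed
        then show "c \<in> {z m | z. z \<in> S \<and> (\<forall>u\<in>V. rk u < rk m \<longrightarrow> z u = y u)}" using z by blast
      qed
      have "card ?T = card ((\<lambda>z. z m) ` ?T)" using card_image[OF inj] by simp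
      also have "\<dots> \<le> k"
      proof (cases "m \<in> F")
        case True
        have "card ((\<lambda>z. z m) ` ?T) \<le> card {z m | z. z \<in> S \<and> (\<forall>u\<in>V. rk u < rk m \<longrightarrow> z u = y u)}"
          by (rule card_mono[OF _ sub]) (use finS in simp)
        then show ?thesis using less.prems(6)[OF True y(1)] True by (simp add: k_def)
      next
        case False
        have "(\<lambda>z. z m) ` ?T \<subseteq> A" using less.prems(4) m by auto
        then show ?thesis using False fin card_mono by (auto simp: k_def)
      qed
      finally show "card ?T \<le> k" .
    qed
    also have "\<dots> \<le> (card A ^ (card ?V - card ?F) * 2 ^ card ?F) * k"
      using IH by (rule mult_right_mono) simp
    also have "\<dots> = card A ^ (card V - card F) * 2 ^ card F"
    proof -
      have cV: "card V = Suc (card ?V)" by (rule card.remove[OF fin(1) m(1)])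
      have finF: "finite F" using less.prems finite_subset by blast
      show ?thesis
      proof (cases "m \<in> F")
        case True
        then have "card F = Suc (card ?F)" by (rule card.remove[OF finF])
        then obtain q where q: "card F = Suc q" "card ?F = q" by blast
        show ?thesis using True unfolding cV q by (simp add: k_def)
      next
        case F: False
        then have FV: "?F = F" "F \<subseteq> ?V" using less.prems(5) by auto
        then have "card ?F = card F" "card F \<le> card ?V"
          using card_mono[OF finite_Diff[OF fin(1)] FV(2)] by auto
        then show ?thesis using F cV by (simp add: k_def Suc_diff_le)
      qed
    qed
    finally show ?thesis .
  qed
qed

section \<open>Four closed walks whose steps are matched\<close>

definition step_next :: "nat \<Rightarrow> nat \<times> nat \<Rightarrow> nat \<times> nat" where
  "step_next p t = (fst t, Suc (snd t) mod p)"

text \<open>Walks 0, 1 and walks 2, 3 belong to the two copies of T in its variance. The first two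
  clauses record a contraction between the walks of one copy, the third a contraction between the
  copies.\<close>

definition linked :: "nat \<Rightarrow> (nat \<times> nat \<Rightarrow> nat \<times> nat) \<Rightarrow> bool" where
  "linked p \<sigma> \<longleftrightarrow> (\<exists>j<p. fst (\<sigma> (0, j)) = 1) \<and> (\<exists>j<p. fst (\<sigma> (2, j)) = 3) \<and>
     (\<exists>i\<in>{0, 1}. \<exists>j<p. fst (\<sigma> (i, j)) \<in> {2, 3})"

text \<open>A pair (i, j) names the j-th vertex of walk i and also the step that leaves it;
  \<open>z\<close> assigns values to the vertices.\<close>

definition step_label :: "nat \<Rightarrow> (nat \<Rightarrow> nat \<Rightarrow> 'l) \<Rightarrow> (nat \<times> nat \<Rightarrow> nat) \<Rightarrow> nat \<times> nat \<Rightarrow> 'l" where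
  "step_label p L z t = L (z t) (z (step_next p t))"

text \<open>The order puts the walks so that each of the first three has a step \<open>r i\<close> matched with a later walk.\<close>

lemma linked_order:
  assumes lk: "linked p \<sigma>"
    and \<sigma>: "\<And>t. t \<in> {..<4} \<times> {..<p} \<Longrightarrow> \<sigma> t \<in> {..<4} \<times> {..<p} \<and> \<sigma> (\<sigma> t) = t"
  obtains ord r where "inj_on ord {..<4 :: nat}" "\<And>i. i < 4 \<Longrightarrow> ord i < (4 :: nat)"
    "\<And>i. i < 4 \<Longrightarrow> r i < p" "\<And>i. i < 4 \<Longrightarrow> ord i < 3 \<Longrightarrow> ord i < ord (fst (\<sigma> (i, r i)))"
proof -
  have sym: "\<exists>j<p. fst (\<sigma> (i', j)) = i" if "j < p" "fst (\<sigma> (i, j)) = i'" "i < 4" for i i' j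
  proof -
    define j' where "j' = snd (\<sigma> (i, j))"
    have eq: "\<sigma> (i, j) = (i', j')" using that by (simp add: j'_def prod_eq_iff)
    have "(i', j') \<in> {..<4} \<times> {..<p} \<and> \<sigma> (i', j') = (i, j)"
      using \<sigma>[of "(i, j)"] that(1,3) unfolding eq by blast
    then show ?thesis by (intro exI[of _ j']) simp
  qed
  obtain a ja where a: "a \<in> {0, 1}" "ja < p" "fst (\<sigma> (a, ja)) \<in> {2, 3}"
    using lk unfolding linked_def by blast
  define b where "b = fst (\<sigma> (a, ja))"
  \<comment> \<open>The order will be \<open>a'\<close>, \<open>a\<close>, \<open>b'\<close>,
    \<open>b\<close>: here \<open>a'\<close> is joined to \<open>a\<close>, \<open>a\<close> to
    \<open>b\<close>, and \<open>b'\<close> to \<open>b\<close>. The two differences swap 0 with 1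
    and 2 with 3.\<close>
  define a' where "a' = 1 - a"
  define b' where "b' = 5 - b"
  have ab: "(a = 0 \<and> a' = 1 \<or> a = 1 \<and> a' = 0)" "(b = 2 \<and> b' = 3 \<or> b = 3 \<and> b' = 2)"
    using a by (auto simp: a'_def b'_def b_def)
  have "\<exists>j<p. fst (\<sigma> (a', j)) = a"
    using ab(1) lk sym[of _ 0 1] unfolding linked_def by auto
  then obtain j1 where j1: "j1 < p" "fst (\<sigma> (a', j1)) = a" by blast
  have "\<exists>j<p. fst (\<sigma> (b', j)) = b"
    using ab(2) lk sym[of _ 2 3] unfolding linked_def by auto
  then obtain j2 where j2: "j2 < p" "fst (\<sigma> (b', j2)) = b" by blast
  define ord where "ord = (\<lambda>i. if i = a' then 0 else if i = a then 1 else if i = b' then 2 else (3 :: nat))"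
  define r where "r = (\<lambda>i. if i = a' then j1 else if i = a then ja else if i = b' then j2 else 0)"
  have four: "i = a' \<or> i = a \<or> i = b' \<or> i = b" if "i < 4" for i
    using that ab by auto
  have ne: "a \<noteq> a'" "b' \<noteq> a" "b' \<noteq> a'" "b \<noteq> a" "b \<noteq> a'" "b \<noteq> b'" using ab by auto
  show thesis
  proof (rule that[of ord r])
    show "inj_on ord {..<4}" using four by (auto simp: inj_on_def ord_def split: if_splits)
    show "ord i < 4" if "i < 4" for i by (simp add: ord_def)
    show "r i < p" if "i < 4" for i using j1 j2 a by (simp add: r_def)
    show "ord i < ord (fst (\<sigma> (i, r i)))" if "i < 4" "ord i < 3" for i
      using four[OF that(1)] that(2) ne j1 j2 unfolding ord_def r_def b_def[symmetric]
      by (auto simp: b_def[symmetric] split: if_splits)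
  qed
qed

text \<open>The involution exchanges descents and ascents, and injectivity of \<open>rk\<close>
  excludes ties.\<close>

lemma card_involution_descents:
  fixes rk :: "'v \<Rightarrow> nat"
  assumes "finite V" "inj_on rk V" "\<And>t. t \<in> V \<Longrightarrow> \<sigma> t \<in> V \<and> \<sigma> t \<noteq> t \<and> \<sigma> (\<sigma> t) = t"
  shows "2 * card {t \<in> V. rk (\<sigma> t) < rk t} = card V"
proof -
  let ?D = "{t \<in> V. rk (\<sigma> t) < rk t}" and ?U = "{t \<in> V. rk t < rk (\<sigma> t)}"
  have VU: "V = ?D \<union> ?U"
  proof -
    have "rk (\<sigma> t) \<noteq> rk t" if "t \<in> V" for t
      using inj_on_eq_iff[OF assms(2), of "\<sigma> t" t] assms(3)[OF that] that by auto
    then show ?thesis by (auto simp: neq_iff)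
  qed
  have "card V = card (?D \<union> ?U)" by (rule arg_cong[OF VU])
  also have "\<dots> = card ?D + card ?U"
    by (rule card_Un_disjoint) (use assms(1) in auto)
  finally have "card V = card ?D + card ?U" .
  moreover have "bij_betw \<sigma> ?D ?U"
    by (rule bij_betwI[where g=\<sigma>]) (use assms(3) in auto)
  then have "card ?D = card ?U" by (rule bij_betw_same_card)
  ultimately show ?thesis by simp
qed

text \<open>Vertices are chosen in the order \<open>rk\<close>. If the partner of step t comes
  earlier, the label of t is already known, so with its start given the end of t has at most two
  values. Half of the 4p steps are of this kind. All of them determine a new vertex, except possibly
  the closing step of the last walk, which returns to a vertex chosen before. Hence at least 2p - 1
  of the 4p vertices are forced.\<close>

lemma card_matched_walks:
  fixes L :: "nat \<Rightarrow> nat \<Rightarrow> 'l" and p n :: nat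
  defines "V \<equiv> {..<4 :: nat} \<times> {..<p}"
  assumes p: "0 < p"
    and L: "\<And>a l. a \<in> {1..n} \<Longrightarrow> card {b \<in> {1..n}. L a b = l} \<le> 2"
    and \<sigma>: "\<And>t. t \<in> V \<Longrightarrow> \<sigma> t \<in> V \<and> \<sigma> t \<noteq> t \<and> \<sigma> (\<sigma> t) = t"
    and lk: "linked p \<sigma>"
  shows "card {z \<in> (\<Pi>\<^sub>E v\<in>V. {1..n}). \<forall>t\<in>V. step_label p L z (\<sigma> t) = step_label p L z t} \<le> n ^ (2 * p + 1) * 2 ^ (2 * p - 1)"
proof -
  obtain ord r where ord: "inj_on ord {..<4 :: nat}" "\<And>i. i < 4 \<Longrightarrow> ord i < (4 :: nat)"
    and r: "\<And>i. i < 4 \<Longrightarrow> r i < p" "\<And>i. i < 4 \<Longrightarrow> ord i < 3 \<Longrightarrow> ord i < ord (fst (\<sigma> (i, r i)))"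
    by (rule linked_order[OF lk]) (use \<sigma> in \<open>auto simp: V_def\<close>)
  \<comment> \<open>The walks are visited in the order \<open>ord\<close>. Walk i is entered at the
    vertex after \<open>r i\<close> and left at \<open>r i\<close>, which makes \<open>r i\<close>
    its closing step.\<close>
  define rk where "rk = (\<lambda>t :: nat \<times> nat. ord (fst t) * p + (snd t + p - Suc (r (fst t))) mod p)"
  let ?nx = "step_next p"
  have finV: "finite V" by (simp add: V_def)
  have cardV: "card V = 4 * p" by (simp add: V_def card_cartesian_product)
  have nxV: "?nx t \<in> V" if "t \<in> V" for t using that p by (auto simp: V_def step_next_def)
  have rot: "(j + p - Suc q) mod p = (if j \<le> q then j + p - Suc q else j - Suc q)" if "j < p" "q < p" for j q
  proof (cases "j \<le> q")
    case False
    then have "(j + p - Suc q) mod p = ((j - Suc q) + p) mod p"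
      using that by (intro arg_cong[where f="\<lambda>x. x mod p"]) simp
    also have "\<dots> = j - Suc q" using that unfolding mod_add_self2 by (intro mod_less) simp
    finally show ?thesis using False by simp
  qed (use that in simp)
  have rk_div: "rk t div p = ord (fst t)" for t using p by (simp add: rk_def)
  have rk_mod: "rk t mod p = (snd t + p - Suc (r (fst t))) mod p" for t by (simp add: rk_def)
  have inj: "inj_on rk V"
  proof (rule inj_onI)
    fix t u assume tu: "t \<in> V" "u \<in> V" "rk t = rk u"
    have "ord (fst t) = ord (fst u)" using rk_div tu(3) by metis
    then have f: "fst t = fst u" using ord(1) tu by (auto simp: V_def inj_on_eq_iff)
    have "(snd t + p - Suc (r (fst t))) mod p = (snd u + p - Suc (r (fst t))) mod p"
      using rk_mod tu(3) f by metis
    then have "snd t = snd u"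
      using tu r(1)[of "fst t"] by (auto simp: V_def rot split: if_splits)
    with f show "t = u" by (simp add: prod_eq_iff)
  qed
  have rk_next: "rk (?nx t) = rk t + 1" if "t \<in> V" "snd t \<noteq> r (fst t)" for t
  proof -
    have q: "r (fst t) < p" "snd t < p" using that r by (auto simp: V_def)
    show ?thesis
    proof (cases "Suc (snd t) = p")
      case True
      then show ?thesis using q that(2) by (auto simp: rk_def step_next_def rot)
    next
      case False
      then have "Suc (snd t) < p" using q by simp
      then show ?thesis
        using that(2) q rot[of "Suc (snd t)" "r (fst t)"] rot[of "snd t" "r (fst t)"]
        by (simp add: rk_def step_next_def split: if_splits)
    qed
  qed
  have rk_next_le: "rk (?nx t) \<le> rk t + 1" if "t \<in> V" for t
  proof (cases "snd t = r (fst t)")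
    case True
    have q: "r (fst t) < p" "snd t < p" using that r by (auto simp: V_def)
    have "rk t mod p = p - 1" using rot[OF q(2,1)] True q by (simp add: rk_mod)
    then have "rk t = ord (fst t) * p + (p - 1)" by (metis rk_div div_mult_mod_eq)
    moreover have "rk (?nx t) < ord (fst t) * p + p" using p by (simp add: rk_def step_next_def)
    ultimately show ?thesis using p by simp
  qed (use rk_next that in simp)
  define D where "D = {t \<in> V. rk (\<sigma> t) < rk t}"
  define B where "B = {t \<in> D. snd t \<noteq> r (fst t)}"
  have cardD: "card D = 2 * p"
    using card_involution_descents[OF finV inj \<sigma>] cardV by (simp add: D_def)
  \<comment> \<open>The closing steps of the first three walks are matched with later walks and are
    no descents, so only the closing step of the last walk can be lost.\<close>
  have sub: "D - B \<subseteq> {t \<in> V. ord (fst t) = 3 \<and> snd t = r (fst t)}"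
  proof safe
    fix i j :: nat assume t: "(i, j) \<in> D" "(i, j) \<notin> B"
    then show V: "(i, j) \<in> V" and j: "snd (i, j) = r (fst (i, j))" by (auto simp: D_def B_def)
    have i: "i < 4" using V by (simp add: V_def)
    show "ord (fst (i, j)) = 3"
    proof (rule ccontr)
      assume "ord (fst (i, j)) \<noteq> 3"
      then have "ord i < ord (fst (\<sigma> (i, j)))" using r(2)[OF i] ord(2)[OF i] j by simp
      then have "rk (i, j) < rk (\<sigma> (i, j))"
        using rk_div[of "(i, j)"] rk_div[of "\<sigma> (i, j)"] div_le_mono[of "rk (\<sigma> (i, j))" "rk (i, j)" p] by force
      then show False using t by (simp add: D_def)
    qed
  qed
  have X1: "card {t \<in> V. ord (fst t) = 3 \<and> snd t = r (fst t)} \<le> 1"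
  proof -
    have "t = u" if "t \<in> {t \<in> V. ord (fst t) = 3 \<and> snd t = r (fst t)}" "u \<in> {t \<in> V. ord (fst t) = 3 \<and> snd t = r (fst t)}" for t u
    proof -
      have "fst t = fst u" by (rule inj_onD[OF ord(1)]) (use that in \<open>auto simp: V_def\<close>)
      then show ?thesis using that by (simp add: prod_eq_iff)
    qed
    then show ?thesis using finV by (auto simp: card_le_Suc0_iff_eq)
  qed
  have "card (D - B) \<le> card {t \<in> V. ord (fst t) = 3 \<and> snd t = r (fst t)}"
    by (rule card_mono[OF _ sub]) (use finV in simp)
  then have "card (D - B) \<le> 1" using X1 by (rule order_trans)
  moreover have "card D = card B + card (D - B)"
  proof -
    have "B \<subseteq> D" "finite D" using finV by (auto simp: B_def D_def)
    then show ?thesis using card_Diff_subset[of B D] card_mono[of D B] finite_subset[of B D] by simp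
  qed
  ultimately have cardB: "2 * p - 1 \<le> card B" using cardD by simp
  \<comment> \<open>Trimmed to the exact size, so that the exponent of n becomes exactly 2p +
    1.\<close>
  obtain B' where B': "B' \<subseteq> B" "card B' = 2 * p - 1"
    using obtain_subset_with_card_n[OF cardB] by metis
  have injn: "inj_on ?nx V"
  proof (rule inj_onI)
    fix t u assume tu: "t \<in> V" "u \<in> V" "?nx t = ?nx u"
    then have f: "fst t = fst u" and s: "Suc (snd t) mod p = Suc (snd u) mod p" by (auto simp: step_next_def)
    have "snd t < p" "snd u < p" using tu by (auto simp: V_def)
    then have "snd t = snd u" using s by (cases "Suc (snd t) = p"; cases "Suc (snd u) = p") auto
    with f show "t = u" by (simp add: prod_eq_iff)
  qed
  have BV: "B' \<subseteq> V" using B' by (auto simp: B_def D_def)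
  define S where "S = {z \<in> (\<Pi>\<^sub>E v\<in>V. {1..n}). \<forall>t\<in>V. step_label p L z (\<sigma> t) = step_label p L z t}"
  have "card S \<le> card {1..n} ^ (card V - card (?nx ` B')) * 2 ^ card (?nx ` B')"
  proof (rule card_forced_functions[OF finV _ inj])
    show "?nx ` B' \<subseteq> V" using BV nxV by auto
    fix v y assume "v \<in> ?nx ` B'" and y: "y \<in> S"
    then obtain t where t: "t \<in> B'" "v = ?nx t" by auto
    have tV: "t \<in> V" using t BV by auto
    have tD: "rk (\<sigma> t) < rk t" "snd t \<noteq> r (fst t)" using t B' by (auto simp: B_def D_def)
    have rv: "rk v = rk t + 1" using rk_next[OF tV tD(2)] t by simp
    have sV: "\<sigma> t \<in> V" using \<sigma> tV by auto
    have "{z v | z. z \<in> S \<and> (\<forall>u\<in>V. rk u < rk v \<longrightarrow> z u = y u)} \<subseteq>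
      {b \<in> {1..n}. L (y t) b = step_label p L y (\<sigma> t)}"
    proof safe
      fix z assume z: "z \<in> S" "\<forall>u\<in>V. rk u < rk v \<longrightarrow> z u = y u"
      have "z t = y t" using z(2) tV rv by simp
      \<comment> \<open>Both ends of the partner step precede \<open>v\<close>: its start has rank
        below that of t, and its end has rank at most one more, while \<open>v\<close> has rank
        \<open>rk t + 1\<close>.\<close>
      moreover have "step_label p L z (\<sigma> t) = step_label p L y (\<sigma> t)"
        unfolding step_label_def using z(2) sV nxV[OF sV] rk_next_le[OF sV] tD(1) rv by simp
      moreover have "step_label p L z (\<sigma> t) = L (z t) (z v)"
        using z(1) tV by (simp add: S_def step_label_def t)
      ultimately show "L (y t) (z v) = step_label p L y (\<sigma> t)" by simp
      show "z v \<in> {1..n}" using z(1) nxV[OF tV] t by (auto simp: S_def)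
    qed
    then have "card {z v | z. z \<in> S \<and> (\<forall>u\<in>V. rk u < rk v \<longrightarrow> z u = y u)} \<le>
      card {b \<in> {1..n}. L (y t) b = step_label p L y (\<sigma> t)}"
      by (intro card_mono) auto
    also have "\<dots> \<le> 2" using y tV by (intro L) (auto simp: S_def)
    finally show "card {z v | z. z \<in> S \<and> (\<forall>u\<in>V. rk u < rk v \<longrightarrow> z u = y u)} \<le> 2" .
  qed (auto simp: S_def)
  also have "card (?nx ` B') = 2 * p - 1"
    using card_image[OF inj_on_subset[OF injn BV]] B' by simp
  also have "card V - (2 * p - 1) = 2 * p + 1" using cardV p by simp
  finally show ?thesis by (simp add: S_def)
qed

section \<open>Walk sums\<close>

context prob_space begin

lemma variance_sum_moments:
  assumes "\<And>a. a \<in> A \<Longrightarrow> all_moments (m a)"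
  shows "variance (\<lambda>\<omega>. \<Sum>a\<in>A. c a * m a \<omega>) =
    (\<Sum>a\<in>A. \<Sum>b\<in>A. c a * c b * (expectation (\<lambda>\<omega>. m a \<omega> * m b \<omega>) - expectation (m a) * expectation (m b)))"
proof -
  have i1: "integrable M (m a)" if "a \<in> A" for a using assms[OF that] by (rule all_moments_integrable)
  have i2: "integrable M (\<lambda>\<omega>. m a \<omega> * m b \<omega>)" if "a \<in> A" "b \<in> A" for a b
    using that by (intro all_moments_integrable all_moments_intros assms)
  have E: "expectation (\<lambda>\<omega>. \<Sum>a\<in>A. c a * m a \<omega>) = (\<Sum>a\<in>A. c a * expectation (m a))"
    using i1 by (simp add: Bochner_Integration.integral_sum)
  have "variance (\<lambda>\<omega>. \<Sum>a\<in>A. c a * m a \<omega>) =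
    expectation (\<lambda>\<omega>. \<Sum>a\<in>A. \<Sum>b\<in>A. (c a * c b) * ((m a \<omega> - expectation (m a)) * (m b \<omega> - expectation (m b))))"
    unfolding E sum_subtractf[symmetric] power2_eq_square sum_product
    by (intro Bochner_Integration.integral_cong sum.cong) (auto simp: algebra_simps)
  also have "\<dots> = (\<Sum>a\<in>A. \<Sum>b\<in>A. (c a * c b) * expectation (\<lambda>\<omega>. (m a \<omega> - expectation (m a)) * (m b \<omega> - expectation (m b))))"
  proof -
    have "integrable M (\<lambda>\<omega>. (m a \<omega> - expectation (m a)) * (m b \<omega> - expectation (m b)))" if "a \<in> A" "b \<in> A" for a b
      using that by (intro all_moments_integrable all_moments_intros assms)
    then show ?thesis by (simp add: Bochner_Integration.integral_sum Bochner_Integration.integrable_sum)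
  qed
  also have "\<dots> = (\<Sum>a\<in>A. \<Sum>b\<in>A. c a * c b * (expectation (\<lambda>\<omega>. m a \<omega> * m b \<omega>) - expectation (m a) * expectation (m b)))"
  proof (intro sum.cong refl arg_cong2[where f="(*)"])
    fix a b assume ab: "a \<in> A" "b \<in> A"
    have "expectation (\<lambda>\<omega>. (m a \<omega> - expectation (m a)) * (m b \<omega> - expectation (m b))) =
      expectation (\<lambda>\<omega>. m a \<omega> * m b \<omega> - expectation (m b) * m a \<omega> - expectation (m a) * m b \<omega> + expectation (m a) * expectation (m b))"
      by (intro Bochner_Integration.integral_cong) (auto simp: algebra_simps)
    also have "\<dots> = expectation (\<lambda>\<omega>. m a \<omega> * m b \<omega>) - expectation (m a) * expectation (m b)"
      using i1[OF ab(1)] i1[OF ab(2)] i2[OF ab] by (simp add: prob_space)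
    finally show "expectation (\<lambda>\<omega>. (m a \<omega> - expectation (m a)) * (m b \<omega> - expectation (m b))) = \<dots>" .
  qed
  finally show ?thesis .
qed

lemma expectation_abs_le_sqrt:
  assumes "all_moments V"
  shows "expectation (\<lambda>\<omega>. \<bar>V \<omega>\<bar>) \<le> sqrt (expectation (\<lambda>\<omega>. (V \<omega>)\<^sup>2))"
proof -
  have "integrable M (\<lambda>\<omega>. \<bar>V \<omega>\<bar>)" "integrable M (\<lambda>\<omega>. \<bar>V \<omega>\<bar>\<^sup>2)"
    by (intro all_moments_integrable all_moments_intros assms)+
  then have "variance (\<lambda>\<omega>. \<bar>V \<omega>\<bar>) = expectation (\<lambda>\<omega>. \<bar>V \<omega>\<bar>\<^sup>2) - (expectation (\<lambda>\<omega>. \<bar>V \<omega>\<bar>))\<^sup>2"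
    by (rule variance_eq)
  then have "(expectation (\<lambda>\<omega>. \<bar>V \<omega>\<bar>))\<^sup>2 \<le> expectation (\<lambda>\<omega>. (V \<omega>)\<^sup>2)"
    using variance_positive[of "\<lambda>\<omega>. \<bar>V \<omega>\<bar>"] by simp
  then show ?thesis by (rule real_le_rsqrt)
qed

end

text \<open>What the estimates use of a matrix model. \<open>lab\<close> tells from which of the
  independent vectors an entry comes: covariances vanish across labels and are at least \<gamma>
  within one. \<open>label_fibre\<close> says that a matrix row contains each label at most twice,
  and \<kappa> stands for the normalization of the trace.\<close>

locale walk_model = gauss_family M I G for M :: "'a measure" and I :: "'i set" and G +
  fixes ent :: "nat \<Rightarrow> nat \<Rightarrow> 'i" and lab :: "'i \<Rightarrow> 'l" and n p :: nat and B \<gamma> \<kappa> :: real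
  assumes p_pos: "0 < p"
    and ent: "\<And>a b. a \<in> {1..n} \<Longrightarrow> b \<in> {1..n} \<Longrightarrow> ent a b \<in> I"
    and cov_diff: "\<And>x y. x \<in> I \<Longrightarrow> y \<in> I \<Longrightarrow> lab x \<noteq> lab y \<Longrightarrow> cov x y = 0"
    and cov_same: "\<And>x y. x \<in> I \<Longrightarrow> y \<in> I \<Longrightarrow> lab x = lab y \<Longrightarrow> \<gamma> \<le> cov x y"
    and cov_bound: "\<And>x y. x \<in> I \<Longrightarrow> y \<in> I \<Longrightarrow> \<bar>cov x y\<bar> \<le> B"
    and gamma_pos: "0 < \<gamma>" and B_ge: "1 \<le> B" and kappa_pos: "0 < \<kappa>"
    and label_fibre: "\<And>a l. a \<in> {1..n} \<Longrightarrow> card {b \<in> {1..n}. lab (ent a b) = l} \<le> 2"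
begin

lemma cov_nonneg: "x \<in> I \<Longrightarrow> y \<in> I \<Longrightarrow> 0 \<le> cov x y"
  using cov_diff[of x y] cov_same[of x y] gamma_pos by (cases "lab x = lab y") auto

definition walks :: "(nat \<Rightarrow> nat) set" where
  "walks = (\<Pi>\<^sub>E j\<in>{..<p}. {1..n})"

lemma finite_walks: "finite walks"
  by (auto simp: walks_def intro!: finite_PiE)

text \<open>Position \<open>(i, j)\<close> stands for the \<open>j\<close>-th step of the \<open>i\<close>-th walk.\<close>

definition pos :: "(nat \<Rightarrow> nat \<Rightarrow> nat) \<Rightarrow> nat \<times> nat \<Rightarrow> 'i" where
  "pos z t = ent (z (fst t) (snd t)) (z (fst t) (Suc (snd t) mod p))"

lemma pos_in: "z i \<in> walks \<Longrightarrow> j < p \<Longrightarrow> pos z (i, j) \<in> I"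
  unfolding pos_def using p_pos by (intro ent) (auto simp: walks_def PiE_iff)

definition two :: "(nat \<Rightarrow> nat) \<Rightarrow> (nat \<Rightarrow> nat) \<Rightarrow> nat \<Rightarrow> nat \<Rightarrow> nat" where
  "two x y i = (if i = 0 then x else y)"

definition row :: "nat \<Rightarrow> (nat \<times> nat) set" where
  "row i = {i} \<times> {..<p}"

lemma finite_row [simp]: "finite (row i)" by (simp add: row_def)

lemma card_row: "card (row i) = p" by (simp add: row_def)

definition row0 :: "(nat \<times> nat) list" where
  "row0 = map (Pair 0) [0..<p]"

lemma row0: "set row0 = row 0" "distinct row0" "length row0 = p"
  by (auto simp: row0_def row_def distinct_map inj_on_def)

abbreviation rows :: "(nat \<times> nat) set" where "rows \<equiv> row 0 \<union> row 1"

lemma rows_disjoint: "row 0 \<inter> row 1 = {}" by (auto simp: row_def)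

lemma card_rows: "card rows = 2 * p"
  using card_Un_disjoint[OF finite_row finite_row rows_disjoint] by (simp add: card_row)

lemma two_in: "x \<in> walks \<Longrightarrow> y \<in> walks \<Longrightarrow> t \<in> rows \<Longrightarrow> pos (two x y) t \<in> I"
  by (auto simp: row_def two_def intro!: pos_in)

definition W :: "'a \<Rightarrow> real" where
  "W \<omega> = \<kappa> * (\<Sum>x\<in>walks. gmono (pos (two x x)) (row 0) \<omega>)"

definition pairC :: "(nat \<Rightarrow> nat) \<Rightarrow> (nat \<Rightarrow> nat) \<Rightarrow> nat \<times> nat \<Rightarrow> nat \<times> nat \<Rightarrow> real" where
  "pairC x y t u = cov (pos (two x y) t) (pos (two x y) u)"

text \<open>One factor \<kappa> comes from the W that is expanded, the other from the W inside the
  test function. \<open>Q\<close> is the set of positions that stay uncontracted; all ways of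
  arriving at the same \<open>Q\<close> are collected in one coefficient.\<close>

definition T :: "'a \<Rightarrow> real" where
  "T \<omega> = \<kappa>\<^sup>2 * (\<Sum>x\<in>walks. \<Sum>y\<in>walks. \<Sum>Q\<in>Pow rows.
     stein_coef (pairC x y) row0 (row 1) Q * gmono (pos (two x y)) Q \<omega>)"

lemma pair_moments: "x \<in> walks \<Longrightarrow> y \<in> walks \<Longrightarrow> Q \<subseteq> rows \<Longrightarrow> all_moments (gmono (pos (two x y)) Q)"
  by (intro gmono_moments two_in) auto

lemma W_moments: "all_moments W"
  unfolding W_def by (intro all_moments_intros pair_moments) auto

lemma T_moments: "all_moments T"
  unfolding T_def by (intro all_moments_intros pair_moments) auto

lemma gmono_row1: "gmono (pos (two x y)) (row 1) \<omega> = gmono (pos (two y y)) (row 0) \<omega>"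
  unfolding gmono_def
  by (rule prod.reindex_bij_witness[where i="\<lambda>t. (1, snd t)" and j="\<lambda>t. (0, snd t)"])
     (auto simp: row_def pos_def two_def)

lemma W_row1: "W \<omega> = \<kappa> * (\<Sum>y\<in>walks. gmono (pos (two x y)) (row 1) \<omega>)"
  unfolding W_def gmono_row1 ..

text \<open>The coefficient identity for each walk x in row 0, summed over x. The W inside f is
  written in row 1 by \<open>W_row1\<close>, so that positions stay disjoint even when both walks
  coincide.\<close>

lemma W_stein:
  fixes f f' :: "real \<Rightarrow> real"
  assumes f: "\<And>x. (f has_real_derivative f' x) (at x)" and contf': "\<And>x. isCont f' x"
    and bound: "\<And>x. \<bar>f' x\<bar> \<le> b"
  shows "expectation (\<lambda>\<omega>. (W \<omega> - expectation W) * f (W \<omega>)) = expectation (\<lambda>\<omega>. T \<omega> * f' (W \<omega>))"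
proof -
  have af: "all_moments (\<lambda>\<omega>. f (W \<omega>))" by (rule lipschitz_moments[OF f bound W_moments])
  have [measurable]: "f' \<in> borel_measurable borel"
    by (auto intro!: borel_measurable_continuous_onI simp: continuous_on_eq_continuous_at contf')
  have af': "all_moments (\<lambda>\<omega>. f' (W \<omega>))"
    by (rule all_moments_bound[OF all_moments_const[of b]]) (use bound all_moments_measurable[OF W_moments] in auto)
  have am: "all_moments (gmono (pos (two x x)) (row 0))" if "x \<in> walks" for x
    using that by (intro pair_moments) auto
  let ?m = "\<lambda>x. gmono (pos (two x x)) (row 0)"
  have EW: "expectation W = \<kappa> * (\<Sum>x\<in>walks. expectation (?m x))"
    unfolding W_def using all_moments_integrable[OF am] by (simp add: Bochner_Integration.integral_sum)
  have ic: "integrable M (\<lambda>\<omega>. (?m x \<omega> - expectation (?m x)) * f (W \<omega>))" if "x \<in> walks" for x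
    using that by (intro all_moments_integrable all_moments_intros am af)
  have "expectation (\<lambda>\<omega>. (W \<omega> - expectation W) * f (W \<omega>)) =
      expectation (\<lambda>\<omega>. \<kappa> * (\<Sum>x\<in>walks. (?m x \<omega> - expectation (?m x)) * f (W \<omega>)))"
    unfolding EW
    by (intro Bochner_Integration.integral_cong)
       (auto simp: W_def sum_subtractf right_diff_distrib left_diff_distrib sum_distrib_right sum_distrib_left mult_ac)
  also have "\<dots> = \<kappa> * (\<Sum>x\<in>walks. expectation (\<lambda>\<omega>. (?m x \<omega> - expectation (?m x)) * f (W \<omega>)))"
    using ic by (simp add: Bochner_Integration.integral_sum)
  also have "\<dots> = \<kappa> * (\<Sum>x\<in>walks. \<kappa> * (\<Sum>y\<in>walks. \<Sum>Q\<in>Pow rows. stein_coef (pairC x y) row0 (row 1) Q *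
      expectation (\<lambda>\<omega>. gmono (pos (two x y)) Q \<omega> * f' (W \<omega>))))"
  proof (intro arg_cong2[where f="(*)"] refl sum.cong)
    fix x assume x: "x \<in> walks"
    show "expectation (\<lambda>\<omega>. (?m x \<omega> - expectation (?m x)) * f (W \<omega>)) =
      \<kappa> * (\<Sum>y\<in>walks. \<Sum>Q\<in>Pow rows. stein_coef (pairC x y) row0 (row 1) Q *
      expectation (\<lambda>\<omega>. gmono (pos (two x y)) Q \<omega> * f' (W \<omega>)))"
      unfolding pairC_def row0(1)[symmetric]
    proof (rule stein_coefficient_identity[OF f contf' bound _ W_row1[of _ x]])
      show "pos (two x y) t \<in> I" if "y \<in> walks" "t \<in> row 1" for y t
        using that x by (intro two_in) auto
      show "pos (two x x) t \<in> I" if "t \<in> set row0" for t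
        using that x by (intro two_in) (auto simp: row0)
      show "pos (two x y) t = pos (two x x) t" if "t \<in> set row0" for y t
        using that by (auto simp: row0 row_def pos_def two_def)
    qed (use row0 rows_disjoint in auto)
  qed
  also have "\<dots> = expectation (\<lambda>\<omega>. \<kappa> * (\<Sum>x\<in>walks. \<kappa> * (\<Sum>y\<in>walks. \<Sum>Q\<in>Pow rows. stein_coef (pairC x y) row0 (row 1) Q *
      (gmono (pos (two x y)) Q \<omega> * f' (W \<omega>)))))"
  proof -
    define h where "h = (\<lambda>x y Q \<omega>. stein_coef (pairC x y) row0 (row 1) Q * (gmono (pos (two x y)) Q \<omega> * f' (W \<omega>)))"
    have ih: "integrable M (h x y Q)" if "x \<in> walks" "y \<in> walks" "Q \<in> Pow rows" for x y Q
      unfolding h_def using that by (intro all_moments_integrable all_moments_intros pair_moments af') auto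
    have 1: "expectation (\<lambda>\<omega>. \<Sum>y\<in>walks. \<Sum>Q\<in>Pow rows. h x y Q \<omega>) = (\<Sum>y\<in>walks. \<Sum>Q\<in>Pow rows. expectation (h x y Q))"
      if "x \<in> walks" for x
      using that ih
      by (subst Bochner_Integration.integral_sum)
         (auto intro!: sum.cong Bochner_Integration.integral_sum Bochner_Integration.integrable_sum simp del: One_nat_def)
    have i: "integrable M (\<lambda>\<omega>. \<kappa> * (\<Sum>y\<in>walks. \<Sum>Q\<in>Pow rows. h x y Q \<omega>))" if "x \<in> walks" for x
      using that ih by (intro integrable_mult_right Bochner_Integration.integrable_sum) auto
    have "expectation (\<lambda>\<omega>. \<kappa> * (\<Sum>x\<in>walks. \<kappa> * (\<Sum>y\<in>walks. \<Sum>Q\<in>Pow rows. h x y Q \<omega>))) =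
      \<kappa> * (\<Sum>x\<in>walks. \<kappa> * (\<Sum>y\<in>walks. \<Sum>Q\<in>Pow rows. expectation (h x y Q)))"
      unfolding integral_mult_right_zero by (subst Bochner_Integration.integral_sum, erule i) (simp add: 1 del: One_nat_def)
    then show ?thesis unfolding h_def integral_mult_right_zero by (rule sym)
  qed
  also have "\<dots> = expectation (\<lambda>\<omega>. T \<omega> * f' (W \<omega>))"
    by (intro Bochner_Integration.integral_cong)
       (auto simp: T_def sum_distrib_left sum_distrib_right power2_eq_square mult_ac)
  finally show ?thesis .
qed

text \<open>The identity \<open>W_stein\<close> for the identity function. It says that T divided by
  the variance of W has mean 1, so that its deviation from 1 is measured by the variance of
  T.\<close>

lemma variance_W: "variance W = expectation T"
proof -
  have "expectation (\<lambda>\<omega>. (W \<omega> - expectation W) * W \<omega>) = expectation (\<lambda>\<omega>. T \<omega> * 1)"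
    by (rule W_stein[where f="\<lambda>x. x" and b=1]) auto
  moreover have i: "integrable M W" "integrable M (\<lambda>\<omega>. (W \<omega>)\<^sup>2)" "integrable M (\<lambda>\<omega>. W \<omega> * W \<omega>)"
    by (intro all_moments_integrable all_moments_intros W_moments)+
  moreover have "expectation (\<lambda>\<omega>. (W \<omega> - expectation W) * W \<omega>) = expectation (\<lambda>\<omega>. (W \<omega>)\<^sup>2) - (expectation W)\<^sup>2"
    unfolding left_diff_distrib using i by (simp add: power2_eq_square)
  ultimately show ?thesis using variance_eq[OF i(1,2)] by simp
qed

text \<open>A test function of the standardized variable is a rescaled test function of W, which
  gives the Stein identity with \<open>T / v\<close> in place of T. The mean of \<open>T / v\<close>
  is 1, and the Cauchy-Schwarz inequality bounds its mean distance from 1 by its standard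
  deviation.\<close>

theorem tv_dist_W:
  assumes "0 < variance W"
  shows "tv_dist M (standardized M W) std_normal_distribution (\<lambda>x. x) \<le> 2 * (sqrt (variance T) / variance W)"
proof -
  define \<mu> where "\<mu> = expectation W"
  define v where "v = variance W"
  define s where "s = sqrt v"
  have v: "0 < v" using assms by (simp add: v_def)
  then have s: "0 < s" "s\<^sup>2 = v" by (auto simp: s_def)
  define Z where "Z = standardized M W"
  have Z: "Z \<omega> = (W \<omega> - \<mu>) / s" for \<omega> by (simp add: Z_def standardized_def \<mu>_def s_def v_def)
  have [measurable]: "W \<in> borel_measurable M" by (rule all_moments_measurable[OF W_moments])
  have "tv_dist M Z std_normal_distribution (\<lambda>x. x) \<le> 2 * expectation (\<lambda>\<omega>. \<bar>1 - T \<omega> / v\<bar>)"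
  proof (rule stein_tv_bound)
    show "Z \<in> borel_measurable M" unfolding Z[abs_def] by measurable
    show "integrable M (\<lambda>\<omega>. T \<omega> / v)" using all_moments_integrable[OF T_moments] by simp
    fix f f' :: "real \<Rightarrow> real" and b
    assume f: "\<And>x. (f has_real_derivative f' x) (at x)" "\<And>x. isCont f' x" "\<And>x. \<bar>f' x\<bar> \<le> b"
    have d: "((\<lambda>w. f ((w - \<mu>) / s)) has_real_derivative f' ((w - \<mu>) / s) * (1 / s)) (at w)" for w
    proof (rule DERIV_chain2[OF f(1)])
      show "((\<lambda>w. (w - \<mu>) / s) has_real_derivative 1 / s) (at w)"
        using s by (auto intro!: derivative_eq_intros)
    qed
    have c: "isCont (\<lambda>w. f' ((w - \<mu>) / s) * (1 / s)) w" for w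
      by (intro continuous_intros isCont_o2[OF _ f(2)]) (use s in auto)
    have bd: "\<bar>f' ((w - \<mu>) / s) * (1 / s)\<bar> \<le> b / s" for w
      using f(3)[of "(w - \<mu>) / s"] s by (simp add: abs_mult divide_right_mono)
    from W_stein[OF d c bd]
    have "expectation (\<lambda>\<omega>. (W \<omega> - \<mu>) * f (Z \<omega>)) = expectation (\<lambda>\<omega>. T \<omega> * (f' (Z \<omega>) * (1 / s)))"
      unfolding \<mu>_def Z .
    then have "expectation (\<lambda>\<omega>. (W \<omega> - \<mu>) * f (Z \<omega>)) / s = expectation (\<lambda>\<omega>. T \<omega> * (f' (Z \<omega>) * (1 / s))) / s"
      by simp
    then show "expectation (\<lambda>\<omega>. Z \<omega> * f (Z \<omega>)) = expectation (\<lambda>\<omega>. T \<omega> / v * f' (Z \<omega>))"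
      unfolding integral_divide_zero[symmetric] using s
      by (simp add: Z power2_eq_square[symmetric] mult_ac divide_divide_eq_left)
  qed
  also have "expectation (\<lambda>\<omega>. \<bar>1 - T \<omega> / v\<bar>) \<le> sqrt (expectation (\<lambda>\<omega>. (1 - T \<omega> / v)\<^sup>2))"
  proof (rule expectation_abs_le_sqrt)
    show "all_moments (\<lambda>\<omega>. 1 - T \<omega> / v)"
      using all_moments_minus[OF all_moments_const[of 1] all_moments_mult[OF all_moments_const[of "1 / v"] T_moments]] by simp
  qed
  also have "expectation (\<lambda>\<omega>. (1 - T \<omega> / v)\<^sup>2) = expectation (\<lambda>\<omega>. (T \<omega> - v)\<^sup>2 / v\<^sup>2)"
  proof (rule Bochner_Integration.integral_cong[OF refl])
    fix \<omega>
    have "1 - T \<omega> / v = (v - T \<omega>) / v" using v by (simp add: diff_divide_distrib)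
    then show "(1 - T \<omega> / v)\<^sup>2 = (T \<omega> - v)\<^sup>2 / v\<^sup>2"
      by (simp add: power_divide power2_commute)
  qed
  also have "\<dots> = variance T / v\<^sup>2"
    using variance_W by (simp add: v_def)
  also have "sqrt (variance T / v\<^sup>2) = sqrt (variance T) / v"
    using v by (simp add: real_sqrt_divide)
  finally show ?thesis unfolding v_def Z_def by simp
qed

end

section \<open>Upper bound for the variance of the Stein factor\<close>

lemma partition_by_subsets:
  assumes "r \<inter> s = {}" "Q \<subseteq> r" "Q' \<subseteq> s" "R \<subseteq> Q \<union> Q'"
  shows "(r - Q) \<inter> ((s - Q') \<union> ((Q \<union> Q' - R) \<union> R)) = {}"
    and "(s - Q') \<inter> ((Q \<union> Q' - R) \<union> R) = {}"
    and "(Q \<union> Q' - R) \<inter> R = {}"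
    and "(r - Q) \<union> ((s - Q') \<union> ((Q \<union> Q' - R) \<union> R)) = r \<union> s"
  using assms by auto

context walk_model begin

lemma pairC_bound:
  assumes "x \<in> walks" "y \<in> walks" "t \<in> rows" "u \<in> rows"
  shows "\<bar>pairC x y t u\<bar> \<le> B" "0 \<le> pairC x y t u"
  unfolding pairC_def using assms by (auto intro!: cov_bound cov_nonneg two_in simp del: Un_iff)

lemma pair_stein_coef_bound:
  assumes "x \<in> walks" "y \<in> walks"
  shows "\<bar>stein_coef (pairC x y) row0 (row 1) Q\<bar> \<le> (B * real (4 * p)) ^ p"
  using stein_coef_bound[of row0 "row 1" "pairC x y" B "4 * p" Q] assms B_ge pairC_bound(1)[OF assms]
  by (simp add: row0 card_row)

definition four :: "(nat \<Rightarrow> nat) \<Rightarrow> (nat \<Rightarrow> nat) \<Rightarrow> (nat \<Rightarrow> nat) \<Rightarrow> (nat \<Rightarrow> nat) \<Rightarrow> nat \<Rightarrow> nat \<Rightarrow> nat" where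
  "four x y x' y' i = (if i = 0 then x else if i = 1 then y else if i = 2 then x' else y')"

text \<open>Moves rows 0 and 1 to rows 2 and 3, so that the two terms of T in a covariance occupy
  disjoint positions of one monomial.\<close>

definition shift2 :: "nat \<times> nat \<Rightarrow> nat \<times> nat" where
  "shift2 t = (fst t + 2, snd t)"

definition Cv :: "('a \<Rightarrow> real) \<Rightarrow> ('a \<Rightarrow> real) \<Rightarrow> real" where
  "Cv U V = expectation (\<lambda>\<omega>. U \<omega> * V \<omega>) - expectation U * expectation V"

abbreviation all_rows :: "(nat \<times> nat) set" where "all_rows \<equiv> {..<4} \<times> {..<p}"

lemma inj_shift2: "inj_on shift2 A"
  by (auto simp: inj_on_def shift2_def prod_eq_iff)

lemma four_in:
  assumes "x \<in> walks" "y \<in> walks" "x' \<in> walks" "y' \<in> walks" "t \<in> all_rows"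
  shows "pos (four x y x' y') t \<in> I"
  using assms by (cases t) (auto simp: four_def intro!: pos_in)

lemma gmono_four:
  assumes "Q \<subseteq> rows"
  shows "gmono (pos (two x y)) Q = gmono (pos (four x y x' y')) Q"
    and "gmono (pos (two x' y')) Q = gmono (pos (four x y x' y')) (shift2 ` Q)"
proof -
  show "gmono (pos (two x y)) Q = gmono (pos (four x y x' y')) Q"
    using assms by (intro ext gmono_cong) (auto simp: row_def pos_def two_def four_def)
  show "gmono (pos (two x' y')) Q = gmono (pos (four x y x' y')) (shift2 ` Q)"
  proof
    fix \<omega>
    have "pos (two x' y') t = pos (four x y x' y') (shift2 t)" if "t \<in> Q" for t
      using that assms by (auto simp: row_def pos_def two_def four_def shift2_def)
    then show "gmono (pos (two x' y')) Q \<omega> = gmono (pos (four x y x' y')) (shift2 ` Q) \<omega>"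
      unfolding gmono_def by (simp add: prod.reindex[OF inj_shift2])
  qed
qed

lemma shift2_rows: "shift2 ` rows = {2, 3} \<times> {..<p}"
proof -
  have "t \<in> shift2 ` rows" if "t \<in> {2, 3} \<times> {..<p}" for t
    using that by (intro image_eqI[of _ _ "(fst t - 2, snd t)"]) (auto simp: shift2_def row_def)
  then show ?thesis by (auto simp: shift2_def row_def)
qed

lemma rows_shift2_disjoint: "rows \<inter> shift2 ` rows = {}"
  unfolding shift2_rows by (auto simp: row_def)

lemma rows_shift2_Un: "rows \<union> shift2 ` rows = all_rows"
  unfolding shift2_rows by (auto simp: row_def)

lemma subset_all_rows:
  assumes "Q \<subseteq> rows"
  shows "Q \<subseteq> all_rows" "shift2 ` Q \<subseteq> all_rows"
  using assms image_mono[OF assms, of shift2] unfolding rows_shift2_Un[symmetric] by blast+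

lemma disjoint_shift2: "Q \<subseteq> rows \<Longrightarrow> Q' \<subseteq> rows \<Longrightarrow> Q \<inter> shift2 ` Q' = {}"
  using rows_shift2_disjoint image_mono[of Q' rows shift2] by blast

lemma finite_subset_rows: "Q \<subseteq> rows \<Longrightarrow> finite Q"
  by (rule finite_subset[of _ rows]) auto

text \<open>The contraction that produced T is applied once more, now to the factors that the two
  terms have left over. At least one contraction joins the terms, and \<open>R\<close> is what
  remains after it.\<close>

lemma Cv_eq:
  assumes W: "x \<in> walks" "y \<in> walks" "x' \<in> walks" "y' \<in> walks" and Q: "Q \<subseteq> rows" "Q' \<subseteq> rows"
    and xs: "set xs = Q" "distinct xs"
  shows "Cv (gmono (pos (two x y)) Q) (gmono (pos (two x' y')) Q') =
    (\<Sum>R\<in>Pow all_rows. stein_coef (\<lambda>t u. cov (pos (four x y x' y') t) (pos (four x y x' y') u)) xs (shift2 ` Q') R *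
       expectation (gmono (pos (four x y x' y')) R))"
proof -
  let ?e = "pos (four x y x' y')"
  have disj: "Q \<inter> shift2 ` Q' = {}" by (intro disjoint_shift2 Q)
  have fin: "finite Q" "finite (shift2 ` Q')" by (intro finite_imageI finite_subset_rows Q)+
  have sub: "Q \<subseteq> all_rows" "shift2 ` Q' \<subseteq> all_rows" by (intro subset_all_rows Q)+
  have "Cv (gmono (pos (two x y)) Q) (gmono (pos (two x' y')) Q') =
    expectation (gmono ?e (Q \<union> shift2 ` Q')) - expectation (gmono ?e Q) * expectation (gmono ?e (shift2 ` Q'))"
    unfolding Cv_def gmono_four(1)[OF Q(1), of x y x' y'] gmono_four(2)[OF Q(2), of x' y' x y]
    by (simp only: gmono_Un[OF fin disj, of ?e, abs_def])
  also have "\<dots> = (\<Sum>R\<in>Pow all_rows. stein_coef (\<lambda>t u. cov (?e t) (?e u)) xs (shift2 ` Q') R * expectation (gmono ?e R))"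
    unfolding xs(1)[symmetric]
    by (rule expectation_gmono_Un) (use sub disj xs W four_in in auto)
  finally show ?thesis .
qed

lemma cov_label: "x \<in> I \<Longrightarrow> y \<in> I \<Longrightarrow> cov x y \<noteq> 0 \<Longrightarrow> lab x = lab y"
  using cov_diff by blast

text \<open>Every ingredient of the expansion in \<open>Cv_eq\<close> is nonnegative. This lets the
  lower bound for the variance of W discard all pairs of walks but those with equal labels.\<close>

lemma Cv_nonneg:
  assumes "x \<in> walks" "y \<in> walks" "x' \<in> walks" "y' \<in> walks" "Q \<subseteq> rows" "Q' \<subseteq> rows"
  shows "0 \<le> Cv (gmono (pos (two x y)) Q) (gmono (pos (two x' y')) Q')"
proof -
  have "finite Q" by (intro finite_imageI finite_subset_rows assms)+
  then obtain xs where xs: "set xs = Q" "distinct xs" using finite_distinct_list[of Q] by blast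
  have sub: "Q \<union> shift2 ` Q' \<subseteq> all_rows" by (intro Un_least subset_all_rows assms)
  show ?thesis
    unfolding Cv_eq[OF assms xs]
  proof (intro sum_nonneg mult_nonneg_nonneg stein_coef_nonneg expectation_gmono_nonneg cov_nonneg)
    fix R assume "R \<in> Pow all_rows"
    then show "finite R" by (auto intro: finite_subset)
  qed (use sub xs four_in[OF assms(1-4)] in blast)+
qed

text \<open>Each expectation has at most 4p factors. The product of two expectations accounts for
  the exponent 8p, the two summands of the covariance for the factor 2.\<close>

lemma Cv_bound:
  assumes "x \<in> walks" "y \<in> walks" "x' \<in> walks" "y' \<in> walks" "Q \<subseteq> rows" "Q' \<subseteq> rows"
  shows "\<bar>Cv (gmono (pos (two x y)) Q) (gmono (pos (two x' y')) Q')\<bar> \<le> 2 * (B * real (4 * p)) ^ (8 * p)"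
proof -
  let ?e = "pos (four x y x' y')" and ?K = "B * real (4 * p)"
  have K: "1 \<le> ?K" using B_ge p_pos mult_mono[of 1 B 1 "real (4 * p)"] by simp
  have fin: "finite Q" "finite (shift2 ` Q')" by (intro finite_imageI finite_subset_rows assms)+
  have sub: "Q \<subseteq> all_rows" "shift2 ` Q' \<subseteq> all_rows" by (intro subset_all_rows assms)+
  have bd: "\<bar>expectation (gmono ?e S)\<bar> \<le> ?K ^ (4 * p)" if "S \<subseteq> all_rows" for S
  proof -
    have c: "card S \<le> 4 * p" using card_mono[OF _ that] by simp
    have "\<bar>expectation (gmono ?e S)\<bar> \<le> ?K ^ card S"
    proof (rule expectation_gmono_bound)
      show "finite S" using that finite_subset by blast
      show "?e t \<in> I" if "t \<in> S" for t using that \<open>S \<subseteq> all_rows\<close> assms by (intro four_in) auto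
      show "\<bar>cov (?e t) (?e u)\<bar> \<le> B" if "t \<in> S" "u \<in> S" for t u
        using that \<open>S \<subseteq> all_rows\<close> assms by (intro cov_bound four_in) auto
    qed (use c B_ge in auto)
    also have "\<dots> \<le> ?K ^ (4 * p)" using K c by (intro power_increasing) auto
    finally show ?thesis .
  qed
  have disj: "Q \<inter> shift2 ` Q' = {}" by (intro disjoint_shift2 assms)
  have "Cv (gmono (pos (two x y)) Q) (gmono (pos (two x' y')) Q') =
    expectation (gmono ?e (Q \<union> shift2 ` Q')) - expectation (gmono ?e Q) * expectation (gmono ?e (shift2 ` Q'))"
    unfolding Cv_def gmono_four(1)[OF assms(5), of x y x' y'] gmono_four(2)[OF assms(6), of x' y' x y]
    by (simp only: gmono_Un[OF fin disj, of ?e, abs_def])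
  also have "\<bar>\<dots>\<bar> \<le> ?K ^ (4 * p) + ?K ^ (4 * p) * ?K ^ (4 * p)"
    using bd[of "Q \<union> shift2 ` Q'"] mult_mono[OF bd[OF sub(1)] bd[OF sub(2)]] sub K
    by (simp add: abs_mult[symmetric])
  also have "\<dots> \<le> ?K ^ (8 * p) + ?K ^ (8 * p)"
    using K by (intro add_mono power_increasing) (auto simp flip: power_add)
  finally show ?thesis by simp
qed

text \<open>Four partial matchings are glued together: the contractions within the first term of T
  (\<open>\<sigma>1\<close>) and within the second (\<open>\<sigma>2\<close>), those made in
  expanding the covariance (\<open>\<sigma>3\<close>), and the pairs of Wick's formula in the rest
  (\<open>\<sigma>4\<close>). The joining pairs of the first three supply the three clauses of
  \<open>linked\<close>.\<close>

lemma Cv_linked: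
  assumes W: "x \<in> walks" "y \<in> walks" "x' \<in> walks" "y' \<in> walks" and Q: "Q \<subseteq> rows" "Q' \<subseteq> rows"
    and nz: "stein_coef (pairC x y) row0 (row 1) Q \<noteq> 0" "stein_coef (pairC x' y') row0 (row 1) Q' \<noteq> 0"
      "Cv (gmono (pos (two x y)) Q) (gmono (pos (two x' y')) Q') \<noteq> 0"
  shows "\<exists>\<sigma>. matching (lab \<circ> pos (four x y x' y')) \<sigma> all_rows \<and> linked p \<sigma>"
proof -
  let ?e = "pos (four x y x' y')"
  let ?lab = "lab \<circ> ?e"
  have eI: "?e t \<in> I" if "t \<in> all_rows" for t using four_in[OF W that] .
  have labe: "?lab t = lab (pos (two x y) t)" "?lab (shift2 t) = lab (pos (two x' y') t)" if "t \<in> rows" for t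
    using that by (auto simp: row_def pos_def two_def four_def shift2_def)
  have pm: "\<exists>\<sigma>. matching (lab \<circ> pos (two x y)) \<sigma> (rows - Q) \<and> (\<exists>t\<in>row 0 - Q. \<sigma> t \<in> row 1 - Q)"
    if "x \<in> walks" "y \<in> walks" "stein_coef (pairC x y) row0 (row 1) Q \<noteq> 0" for x y Q
  proof -
    have "Q \<subseteq> set row0 \<union> row 1 \<and> (\<exists>\<sigma>. matching (lab \<circ> pos (two x y)) \<sigma> (set row0 \<union> row 1 - Q) \<and>
        (\<exists>t\<in>set row0 - Q. \<sigma> t \<in> row 1 - Q))"
    proof (rule stein_coef_matching[OF that(3)])
      show "(lab \<circ> pos (two x y)) t = (lab \<circ> pos (two x y)) u"
        if "t \<in> set row0" "u \<in> set row0 \<union> row 1" "pairC x y t u \<noteq> 0" for t u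
        using cov_label[OF two_in two_in, of x y t x y u] that \<open>x \<in> walks\<close> \<open>y \<in> walks\<close>
        unfolding row0 pairC_def by simp
    qed (use row0 rows_disjoint in auto)
    then show ?thesis unfolding row0 by blast
  qed
  obtain \<sigma>1 where s1: "matching (lab \<circ> pos (two x y)) \<sigma>1 (rows - Q)" "\<exists>t\<in>row 0 - Q. \<sigma>1 t \<in> row 1 - Q"
    using pm[OF W(1,2) nz(1)] by blast
  obtain \<sigma>2 where s2: "matching (lab \<circ> pos (two x' y')) \<sigma>2 (rows - Q')" "\<exists>t\<in>row 0 - Q'. \<sigma>2 t \<in> row 1 - Q'"
    using pm[OF W(3,4) nz(2)] by blast
  define unshift where "unshift = (\<lambda>t :: nat \<times> nat. (fst t - 2, snd t))"
  have un: "unshift (shift2 t) = t" for t by (simp add: unshift_def shift2_def)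
  have m1: "matching ?lab \<sigma>1 (rows - Q)"
    by (rule matching_cong[OF _ s1(1)]) (simp add: labe(1)[unfolded comp_def] del: One_nat_def)
  have "matching (?lab \<circ> shift2) \<sigma>2 (rows - Q')"
    by (rule matching_cong[OF _ s2(1)]) (simp add: labe(2)[unfolded comp_def] del: One_nat_def)
  then have m2: "matching ?lab (shift2 \<circ> \<sigma>2 \<circ> unshift) (shift2 ` (rows - Q'))"
    by (rule matching_image) (rule un)
  have "finite Q" by (intro finite_imageI finite_subset_rows Q)+
  then obtain xs where xs: "set xs = Q" "distinct xs" using finite_distinct_list[of Q] by blast
  let ?C = "\<lambda>t u. cov (?e t) (?e u)"
  have "(\<Sum>R\<in>Pow all_rows. stein_coef ?C xs (shift2 ` Q') R * expectation (gmono ?e R)) \<noteq> 0"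
    using nz(3) unfolding Cv_eq[OF W Q xs] .
  then obtain R where R: "R \<in> Pow all_rows" "stein_coef ?C xs (shift2 ` Q') R * expectation (gmono ?e R) \<noteq> 0"
    by (rule sum.not_neutral_contains_not_neutral)
  have disj: "Q \<inter> shift2 ` Q' = {}" by (intro disjoint_shift2 Q)
  have sub: "Q \<subseteq> all_rows" "shift2 ` Q' \<subseteq> all_rows" by (intro subset_all_rows Q)+
  have "R \<subseteq> set xs \<union> shift2 ` Q' \<and> (\<exists>\<sigma>. matching ?lab \<sigma> (set xs \<union> shift2 ` Q' - R) \<and>
      (\<exists>t\<in>set xs - R. \<sigma> t \<in> shift2 ` Q' - R))"
  proof (rule stein_coef_matching)
    show "stein_coef ?C xs (shift2 ` Q') R \<noteq> 0" using R by auto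
    show "?lab t = ?lab u" if "t \<in> set xs" "u \<in> set xs \<union> shift2 ` Q'" "?C t u \<noteq> 0" for t u
      using that sub xs cov_label[OF eI eI, of t u] by auto
  qed (use xs disj in auto)
  then obtain \<sigma>3 where RQ: "R \<subseteq> Q \<union> shift2 ` Q'" and s3: "matching ?lab \<sigma>3 (Q \<union> shift2 ` Q' - R)"
    "\<exists>t\<in>Q - R. \<sigma>3 t \<in> shift2 ` Q' - R" unfolding xs by blast
  have "\<exists>\<sigma>. matching ?lab \<sigma> R"
  proof (rule expectation_gmono_matching)
    show "finite R" using R by (auto intro: finite_subset)
    show "?e t \<in> I" if "t \<in> R" for t using that R eI by auto
    show "?lab t = ?lab u" if "t \<in> R" "u \<in> R" "cov (?e t) (?e u) \<noteq> 0" for t u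
    proof -
      have "t \<in> all_rows" "u \<in> all_rows" using that R by auto
      then show ?thesis using that cov_label[OF eI eI, of t u] by simp
    qed
    show "expectation (gmono ?e R) \<noteq> 0" using R by auto
  qed
  then obtain \<sigma>4 where s4: "matching ?lab \<sigma>4 R" by blast
  let ?A = "rows - Q" and ?B = "shift2 ` (rows - Q')" and ?D = "Q \<union> shift2 ` Q' - R"
  have imd: "shift2 ` (rows - Q') = shift2 ` rows - shift2 ` Q'"
    by (rule image_set_diff[OF inj_shift2])
  have dj: "?A \<inter> (?B \<union> (?D \<union> R)) = {}" "?B \<inter> (?D \<union> R) = {}" "?D \<inter> R = {}"
    unfolding imd by (rule partition_by_subsets[OF rows_shift2_disjoint Q(1) image_mono[OF Q(2)] RQ])+
  define \<sigma> where "\<sigma> = (\<lambda>t. if t \<in> ?A then \<sigma>1 t else if t \<in> ?B then (shift2 \<circ> \<sigma>2 \<circ> unshift) t else if t \<in> ?D then \<sigma>3 t else \<sigma>4 t)"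
  have "matching ?lab \<sigma> (?A \<union> (?B \<union> (?D \<union> R)))"
    unfolding \<sigma>_def by (intro matching_Un m1 m2 s3(1) s4 dj)
  moreover have "?A \<union> (?B \<union> (?D \<union> R)) = all_rows"
    unfolding imd rows_shift2_Un[symmetric]
    by (rule partition_by_subsets[OF rows_shift2_disjoint Q(1) image_mono[OF Q(2)] RQ])
  moreover have "linked p \<sigma>"
    unfolding linked_def
  proof (intro conjI)
    obtain t where t: "t \<in> row 0 - Q" "\<sigma>1 t \<in> row 1 - Q" using s1(2) by blast
    then have "\<sigma> t = \<sigma>1 t" by (auto simp: \<sigma>_def)
    then show "\<exists>j<p. fst (\<sigma> (0, j)) = 1" using t by (auto simp: row_def)
    obtain u where u: "u \<in> row 0 - Q'" "\<sigma>2 u \<in> row 1 - Q'" using s2(2) by blast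
    then have "shift2 u \<in> ?B" by auto
    then have "\<sigma> (shift2 u) = shift2 (\<sigma>2 u)" using dj(1) by (auto simp: \<sigma>_def un)
    moreover obtain j where "u = (0, j)" "j < p" using u by (auto simp: row_def)
    moreover have "fst (shift2 (\<sigma>2 u)) = 3" using u by (auto simp: row_def shift2_def)
    ultimately show "\<exists>j<p. fst (\<sigma> (2, j)) = 3" by (auto simp: shift2_def numeral_2_eq_2)
    obtain v where v: "v \<in> Q - R" "\<sigma>3 v \<in> shift2 ` Q' - R" using s3(2) by blast
    then have "\<sigma> v = \<sigma>3 v" using dj by (auto simp: \<sigma>_def)
    moreover have "fst v \<in> {0, 1}" "snd v < p" using v Q by (auto simp: row_def)
    moreover have "fst (\<sigma>3 v) \<in> {2, 3}" 
    proof -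
      have "\<sigma>3 v \<in> {2, 3} \<times> {..<p}" using v(2) image_mono[OF Q(2), of shift2] unfolding shift2_rows by blast
      then show ?thesis by auto
    qed
    ultimately show "\<exists>i\<in>{0, 1}. \<exists>j<p. fst (\<sigma> (i, j)) \<in> {2, 3}"
      by (intro bexI[of _ "fst v"] exI[of _ "snd v"]) simp_all
  qed
  ultimately show ?thesis by auto
qed

definition linked_walks :: "((nat \<Rightarrow> nat) \<times> (nat \<Rightarrow> nat) \<times> (nat \<Rightarrow> nat) \<times> (nat \<Rightarrow> nat)) set" where
  "linked_walks = {(x, y, x', y') \<in> walks \<times> walks \<times> walks \<times> walks.
     \<exists>\<sigma>. matching (lab \<circ> pos (four x y x' y')) \<sigma> all_rows \<and> linked p \<sigma>}"

text \<open>A union bound over matchings. These live on 4p positions, so their number is bounded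
  independently of n, here crudely by that of all self-maps of the positions.\<close>

lemma card_linked_walks:
  "card linked_walks \<le> card (all_rows \<rightarrow>\<^sub>E all_rows) * (n ^ (2 * p + 1) * 2 ^ (2 * p - 1))"
proof -
  define L where "L = (\<lambda>a b. lab (ent a b))"
  define \<Phi> where "\<Phi> = (\<lambda>(x, y, x', y'). \<lambda>t\<in>all_rows. four x y x' y' (fst t) (snd t))"
  define S where "S = (\<lambda>\<sigma>. {z \<in> (\<Pi>\<^sub>E v\<in>all_rows. {1..n}). \<forall>t\<in>all_rows. step_label p L z (\<sigma> t) = step_label p L z t})"
  define \<Sigma> where "\<Sigma> = {\<sigma> \<in> all_rows \<rightarrow>\<^sub>E all_rows. (\<forall>t\<in>all_rows. \<sigma> t \<in> all_rows \<and> \<sigma> t \<noteq> t \<and> \<sigma> (\<sigma> t) = t) \<and> linked p \<sigma>}"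
  have finS: "finite (S \<sigma>)" for \<sigma> unfolding S_def by (rule finite_subset[of _ "\<Pi>\<^sub>E v\<in>all_rows. {1..n}"]) (auto intro!: finite_PiE)
  have finE: "finite (all_rows \<rightarrow>\<^sub>E all_rows)" by (intro finite_PiE) auto
  then have fin\<Sigma>: "finite \<Sigma>" unfolding \<Sigma>_def by simp
  have inj: "inj_on \<Phi> linked_walks"
  proof (rule inj_onI)
    fix u v assume uv: "u \<in> linked_walks" "v \<in> linked_walks" "\<Phi> u = \<Phi> v"
    obtain x y x' y' where u: "u = (x, y, x', y')" by (cases u)
    obtain a b a' b' where v: "v = (a, b, a', b')" by (cases v)
    have w: "x \<in> walks" "y \<in> walks" "x' \<in> walks" "y' \<in> walks" "a \<in> walks" "b \<in> walks" "a' \<in> walks" "b' \<in> walks"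
      using uv(1,2) unfolding u v linked_walks_def by auto
    have eq: "four x y x' y' i j = four a b a' b' i j" if "i < 4" "j < p" for i j
      using fun_cong[OF uv(3), of "(i, j)"] that unfolding u v \<Phi>_def by simp
    have ext: "f = g" if "f \<in> walks" "g \<in> walks" "\<And>j. j < p \<Longrightarrow> f j = g j" for f g
      using that unfolding walks_def by (intro PiE_ext) auto
    have "x = a" by (rule ext[OF w(1) w(5)]) (use eq[of 0] in \<open>simp add: four_def\<close>)
    moreover have "y = b" by (rule ext[OF w(2) w(6)]) (use eq[of 1] in \<open>simp add: four_def\<close>)
    moreover have "x' = a'" by (rule ext[OF w(3) w(7)]) (use eq[of 2] in \<open>simp add: four_def\<close>)
    moreover have "y' = b'" by (rule ext[OF w(4) w(8)]) (use eq[of 3] in \<open>simp add: four_def\<close>)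
    ultimately show "u = v" by (simp add: u v)
  qed
  have sub: "\<Phi> ` linked_walks \<subseteq> (\<Union>\<sigma>\<in>\<Sigma>. S \<sigma>)"
  proof
    fix z assume "z \<in> \<Phi> ` linked_walks"
    then obtain x y x' y' \<sigma> where w: "x \<in> walks" "y \<in> walks" "x' \<in> walks" "y' \<in> walks"
      and z: "z = \<Phi> (x, y, x', y')"
      and s: "matching (lab \<circ> pos (four x y x' y')) \<sigma> all_rows" "linked p \<sigma>"
      unfolding linked_walks_def by auto
    define \<tau> where "\<tau> = restrict \<sigma> all_rows"
    have t: "matching (lab \<circ> pos (four x y x' y')) \<tau> all_rows"
      unfolding \<tau>_def by (rule matching_restrict[OF s(1)])
    have zz: "z t = four x y x' y' (fst t) (snd t)" if "t \<in> all_rows" for t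
      using that by (simp add: z \<Phi>_def)
    have lab: "step_label p L z t = (lab \<circ> pos (four x y x' y')) t" if t: "t \<in> all_rows" for t
    proof -
      have "step_next p t \<in> all_rows" using t p_pos by (auto simp: step_next_def)
      then show ?thesis
        unfolding step_label_def L_def pos_def comp_def zz[OF t] by (simp add: zz step_next_def)
    qed
    have m: "\<tau> t \<in> all_rows \<and> \<tau> t \<noteq> t \<and> \<tau> (\<tau> t) = t \<and>
        (lab \<circ> pos (four x y x' y')) (\<tau> t) = (lab \<circ> pos (four x y x' y')) t" if "t \<in> all_rows" for t
      using t that unfolding matching_def by blast
    have tt: "\<tau> t \<in> all_rows \<and> \<tau> t \<noteq> t \<and> \<tau> (\<tau> t) = t \<and> step_label p L z (\<tau> t) = step_label p L z t" if "t \<in> all_rows" for t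
    proof -
      have "\<tau> t \<in> all_rows" using m[OF that] by blast
      from lab[OF this] lab[OF that] m[OF that] show ?thesis by presburger
    qed
    have "\<tau> (0, j) = \<sigma> (0, j)" "\<tau> (Suc 0, j) = \<sigma> (Suc 0, j)" "\<tau> (2, j) = \<sigma> (2, j)" if "j < p" for j
      using that by (simp_all add: \<tau>_def)
    then have lk: "linked p \<tau>" using s(2) unfolding linked_def by (simp cong: conj_cong)
    have PE: "\<tau> \<in> all_rows \<rightarrow>\<^sub>E all_rows"
    proof (rule PiE_I)
      show "\<tau> t \<in> all_rows" if "t \<in> all_rows" for t using tt[OF that] by blast
      show "\<tau> t = undefined" if "t \<notin> all_rows" for t using that by (simp only: \<tau>_def restrict_apply if_False)
    qed
    have "\<tau> \<in> \<Sigma>" unfolding \<Sigma>_def mem_Collect_eq using tt lk PE by blast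
    moreover have "z \<in> S \<tau>"
    proof -
      have "four x y x' y' i \<in> walks" for i using w by (simp add: four_def)
      then have "four x y x' y' i j \<in> {1..n}" if "j < p" for i j
        using that unfolding walks_def by (auto simp: PiE_iff)
      then have "z \<in> (\<Pi>\<^sub>E v\<in>all_rows. {1..n})" unfolding z \<Phi>_def by auto
      then show ?thesis unfolding S_def using tt by blast
    qed
    ultimately show "z \<in> (\<Union>\<sigma>\<in>\<Sigma>. S \<sigma>)" by blast
  qed
  have "card linked_walks = card (\<Phi> ` linked_walks)" using card_image[OF inj] by simp
  also have "\<dots> \<le> card (\<Union>\<sigma>\<in>\<Sigma>. S \<sigma>)" by (rule card_mono[OF _ sub]) (use fin\<Sigma> finS in auto)
  also have "\<dots> \<le> (\<Sum>\<sigma>\<in>\<Sigma>. card (S \<sigma>))" by (rule card_UN_le[OF fin\<Sigma>])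
  also have "\<dots> \<le> (\<Sum>\<sigma>\<in>\<Sigma>. n ^ (2 * p + 1) * 2 ^ (2 * p - 1))"
  proof (rule sum_mono)
    fix \<sigma> assume s: "\<sigma> \<in> \<Sigma>"
    show "card (S \<sigma>) \<le> n ^ (2 * p + 1) * 2 ^ (2 * p - 1)"
      unfolding S_def
    proof (rule card_matched_walks[OF p_pos])
      show "card {b \<in> {1..n}. L a b = l} \<le> 2" if "a \<in> {1..n}" for a l
        unfolding L_def by (rule label_fibre[OF that])
    qed (use s in \<open>unfold \<Sigma>_def, blast+\<close>)
  qed
  also have "\<dots> = card \<Sigma> * (n ^ (2 * p + 1) * 2 ^ (2 * p - 1))" by simp
  also have "\<dots> \<le> card (all_rows \<rightarrow>\<^sub>E all_rows) * (n ^ (2 * p + 1) * 2 ^ (2 * p - 1))"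
    by (intro mult_right_mono card_mono[OF finE]) (auto simp: \<Sigma>_def)
  finally show ?thesis .
qed

text \<open>Bounds two Stein coefficients times one covariance. It depends on B and p but not on
  n.\<close>

definition term_bound :: real where
  "term_bound = (B * real (4 * p)) ^ p * (B * real (4 * p)) ^ p * (2 * (B * real (4 * p)) ^ (8 * p))"

text \<open>A summand vanishes unless its four walks are linked. The factor
  \<open>4 ^ (2 * p)\<close> counts the pairs of sets Q, Q' of uncontracted positions, each a subset
  of 2p positions.\<close>

lemma variance_T_le_card:
  "variance T \<le> \<kappa> ^ 4 * term_bound * (real (card linked_walks) * 4 ^ (2 * p))"
proof -
  define A where "A = walks \<times> walks \<times> Pow rows"
  define c where "c = (\<lambda>(x, y, Q). \<kappa>\<^sup>2 * stein_coef (pairC x y) row0 (row 1) Q)"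
  define m where "m = (\<lambda>(x, y, Q). gmono (pos (two x y)) Q)"
  define lk where "lk = (\<lambda>(x :: nat \<Rightarrow> nat, y :: nat \<Rightarrow> nat, Q :: (nat \<times> nat) set) (x', y', Q' :: (nat \<times> nat) set). (x, y, x', y') \<in> linked_walks)"
  have finA: "finite A" unfolding A_def using finite_walks by auto
  have T: "T = (\<lambda>\<omega>. \<Sum>a\<in>A. c a * m a \<omega>)"
    unfolding T_def A_def c_def m_def sum.cartesian_product' case_prod_conv sum_distrib_left mult.assoc ..
  have mom: "all_moments (m a)" if "a \<in> A" for a
    using that unfolding A_def m_def by (auto intro!: pair_moments)
  have K: "1 \<le> B * real (4 * p)" using B_ge p_pos mult_mono[of 1 B 1 "real (4 * p)"] by simp
  then have tb: "0 \<le> term_bound" unfolding term_bound_def by simp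
  have le: "c a * c b * Cv (m a) (m b) \<le> (if lk a b then \<kappa> ^ 4 * term_bound else 0)" if ab: "a \<in> A" "b \<in> A" for a b
  proof -
    obtain x y Q where a: "a = (x, y, Q)" by (cases a)
    obtain x' y' Q' where b: "b = (x', y', Q')" by (cases b)
    have w: "x \<in> walks" "y \<in> walks" "x' \<in> walks" "y' \<in> walks" and Q: "Q \<subseteq> rows" "Q' \<subseteq> rows"
      using ab unfolding a b A_def by auto
    show ?thesis
    proof (cases "lk a b")
      case True
      have "\<bar>stein_coef (pairC x y) row0 (row 1) Q * stein_coef (pairC x' y') row0 (row 1) Q' * Cv (m a) (m b)\<bar> \<le> term_bound"
        unfolding term_bound_def abs_mult a b m_def case_prod_conv
        by (intro mult_mono pair_stein_coef_bound Cv_bound w Q) (use K in auto)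
      then have "stein_coef (pairC x y) row0 (row 1) Q * stein_coef (pairC x' y') row0 (row 1) Q' * Cv (m a) (m b) \<le> term_bound"
        by linarith
      then have "\<kappa> ^ 4 * (stein_coef (pairC x y) row0 (row 1) Q * stein_coef (pairC x' y') row0 (row 1) Q' * Cv (m a) (m b)) \<le> \<kappa> ^ 4 * term_bound"
        by (intro mult_left_mono) auto
      moreover have "c a * c b * Cv (m a) (m b) = \<kappa> ^ 4 * (stein_coef (pairC x y) row0 (row 1) Q * stein_coef (pairC x' y') row0 (row 1) Q' * Cv (m a) (m b))"
        unfolding c_def a b case_prod_conv by (simp add: power2_eq_square power4_eq_xxxx)
      ultimately have "c a * c b * Cv (m a) (m b) \<le> \<kappa> ^ 4 * term_bound" by (simp only:)
      then show ?thesis by (simp only: True if_True)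
    next
      case False
      then have "stein_coef (pairC x y) row0 (row 1) Q = 0 \<or> stein_coef (pairC x' y') row0 (row 1) Q' = 0 \<or> Cv (m a) (m b) = 0"
        using Cv_linked[OF w Q] w unfolding a b m_def lk_def linked_walks_def by auto
      then have "c a * c b * Cv (m a) (m b) = 0" unfolding c_def a b by auto
      then show ?thesis by (simp only: False if_False order_refl)
    qed
  qed
  have "variance T = (\<Sum>a\<in>A. \<Sum>b\<in>A. c a * c b * Cv (m a) (m b))"
    unfolding T Cv_def by (rule variance_sum_moments[OF mom])
  also have "\<dots> \<le> (\<Sum>a\<in>A. \<Sum>b\<in>A. if lk a b then \<kappa> ^ 4 * term_bound else 0)"
    by (intro sum_mono le)
  also have "\<dots> = (\<Sum>ab\<in>A \<times> A. if lk (fst ab) (snd ab) then \<kappa> ^ 4 * term_bound else 0)"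
    by (simp add: sum.cartesian_product case_prod_beta')
  also have "\<dots> = real (card {ab \<in> A \<times> A. lk (fst ab) (snd ab)}) * (\<kappa> ^ 4 * term_bound)"
    using finA by (simp add: sum.If_cases Int_def)
  also have "\<dots> \<le> real (card (linked_walks \<times> Pow rows \<times> Pow rows)) * (\<kappa> ^ 4 * term_bound)"
  proof (intro mult_right_mono of_nat_mono)
    define g where "g = (\<lambda>((x :: nat \<Rightarrow> nat, y :: nat \<Rightarrow> nat, Q :: (nat \<times> nat) set), (x' :: nat \<Rightarrow> nat, y' :: nat \<Rightarrow> nat, Q' :: (nat \<times> nat) set)). ((x, y, x', y'), Q, Q'))"
    have "linked_walks \<subseteq> walks \<times> walks \<times> walks \<times> walks" unfolding linked_walks_def by auto
    then have fl: "finite linked_walks" using finite_walks by (auto intro: finite_subset)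
    show "card {ab \<in> A \<times> A. lk (fst ab) (snd ab)} \<le> card (linked_walks \<times> Pow rows \<times> Pow rows)"
    proof (rule card_inj_on_le[of g])
      show "inj_on g {ab \<in> A \<times> A. lk (fst ab) (snd ab)}" by (auto simp: inj_on_def g_def)
      show "g ` {ab \<in> A \<times> A. lk (fst ab) (snd ab)} \<subseteq> linked_walks \<times> Pow rows \<times> Pow rows"
        by (auto simp: g_def A_def lk_def)
      show "finite (linked_walks \<times> Pow rows \<times> Pow rows)" using fl by simp
    qed
    show "0 \<le> \<kappa> ^ 4 * term_bound" using tb by simp
  qed
  also have "card (linked_walks \<times> Pow rows \<times> Pow rows) = card linked_walks * (2 ^ (2 * p) * 2 ^ (2 * p))"
  proof -
    have "card (Pow rows) = 2 ^ (2 * p)" by (subst card_Pow) (simp_all only: card_rows finite_Un finite_row)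
    then show ?thesis unfolding card_cartesian_product by (simp only:)
  qed
  also have "(2 :: nat) ^ (2 * p) * 2 ^ (2 * p) = 4 ^ (2 * p)"
    by (simp flip: power_mult_distrib)
  finally show ?thesis by (simp add: mult_ac)
qed

section \<open>Lower bound for the variance of the walk sum\<close>

definition same_labels :: "((nat \<Rightarrow> nat) \<times> (nat \<Rightarrow> nat)) set" where
  "same_labels = {(x, y) \<in> walks \<times> walks. \<forall>j<p. lab (ent (x j) (x (Suc j mod p))) = lab (ent (y j) (y (Suc j mod p)))}"

text \<open>Since all terms are nonnegative, one of them suffices: the first steps of the two walks
  are contracted with each other, and in the expectation that remains the j-th step of x is paired
  with the j-th step of y.\<close>

lemma Cv_same_labels:
  assumes "(x, y) \<in> same_labels"
  shows "\<gamma> ^ p \<le> Cv (gmono (pos (two x x)) (row 0)) (gmono (pos (two y y)) (row 0))"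
proof -
  have w: "x \<in> walks" "y \<in> walks"
    and l: "\<And>j. j < p \<Longrightarrow> lab (pos (two x y) (0, j)) = lab (pos (two x y) (1, j))"
    using assms by (auto simp: same_labels_def pos_def two_def)
  let ?e = "pos (two x y)"
  define E where "E = (\<lambda>Q. expectation (gmono ?e Q))"
  define ys where "ys = map (Pair (0::nat)) [1..<p]"
  have r0: "row0 = (0, 0) # ys"
    unfolding row0_def ys_def using p_pos by (simp add: upt_conv_Cons)
  have sys: "set ys = {0} \<times> {1..<p}" by (auto simp: ys_def)
  have eI: "?e t \<in> I" if "t \<in> rows" for t using w that by (rule two_in)
  have 1: "gmono (pos (two x x)) (row 0) = gmono ?e (row 0)"
    by (intro ext gmono_cong) (auto simp: row_def pos_def two_def)
  have 2: "gmono (pos (two y y)) (row 0) = gmono ?e (row 1)"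
    using gmono_row1 by (intro ext) simp
  have "Cv (gmono (pos (two x x)) (row 0)) (gmono (pos (two y y)) (row 0)) =
    expectation (gmono ?e (row 0 \<union> row 1)) - expectation (gmono ?e (row 0)) * expectation (gmono ?e (row 1))"
    unfolding Cv_def 1 2 by (simp only: gmono_Un[OF finite_row finite_row rows_disjoint, of ?e, abs_def])
  also have "\<dots> = (\<Sum>Q\<in>Pow rows. stein_coef (pairC x y) row0 (row 1) Q * E Q)"
    unfolding E_def pairC_def row0(1)[symmetric]
    by (rule expectation_gmono_Un) (use row0 rows_disjoint eI in auto)
  also have "\<dots> = (\<Sum>t\<in>row 1. pairC x y (0, 0) t * E (set ys \<union> (row 1 - {t}))) +
      (\<Sum>t\<in>set ys. pairC x y (0, 0) t * (\<Sum>Q\<in>Pow rows. stein_coef (pairC x y) (remove1 t ys) (row 1) Q * E Q))"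
    unfolding r0 by (rule stein_coef_sum_Cons) (auto simp: sys row_def)
  also have "\<dots> \<ge> pairC x y (0, 0) (1, 0) * E (set ys \<union> (row 1 - {(1, 0)})) + 0"
  proof (rule add_mono)
    have E0: "0 \<le> E Q" if "Q \<subseteq> rows" for Q
      unfolding E_def
    proof (rule expectation_gmono_nonneg)
      show "finite Q" using that by (rule finite_subset_rows)
    qed (use that eI cov_nonneg in blast)+
    have z: "(0, 0) \<in> rows" using p_pos by (auto simp: row_def)
    have ysr: "set ys \<subseteq> rows" by (auto simp: sys row_def)
    show "pairC x y (0, 0) (1, 0) * E (set ys \<union> (row 1 - {(1, 0)})) \<le>
        (\<Sum>t\<in>row 1. pairC x y (0, 0) t * E (set ys \<union> (row 1 - {t})))"
    proof (rule member_le_sum)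
      show "(1, 0) \<in> row 1" using p_pos by (simp add: row_def)
      show "0 \<le> pairC x y (0, 0) t * E (set ys \<union> (row 1 - {t}))" if "t \<in> row 1 - {(1, 0)}" for t
        using that z ysr w by (intro mult_nonneg_nonneg pairC_bound E0) auto
    qed simp
    show "0 \<le> (\<Sum>t\<in>set ys. pairC x y (0, 0) t * (\<Sum>Q\<in>Pow rows. stein_coef (pairC x y) (remove1 t ys) (row 1) Q * E Q))"
    proof (intro sum_nonneg mult_nonneg_nonneg stein_coef_nonneg)
      show "0 \<le> pairC x y (0, 0) t" if "t \<in> set ys" for t using that z ysr w by (intro pairC_bound) auto
      show "0 \<le> E Q" if "Q \<in> Pow rows" for Q using that by (intro E0) auto
      fix t u v assume "u \<in> set (remove1 t ys)" "v \<in> set (remove1 t ys) \<union> row 1"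
      then show "0 \<le> pairC x y u v" using ysr w set_remove1_subset[of t ys] by (intro pairC_bound) auto
    qed
  qed
  finally have ge: "pairC x y (0, 0) (1, 0) * E (set ys \<union> (row 1 - {(1, 0)})) \<le>
      Cv (gmono (pos (two x x)) (row 0)) (gmono (pos (two y y)) (row 0))" by simp
  define \<pi> where "\<pi> = (\<lambda>t :: nat \<times> nat. (1 :: nat, snd t))"
  have img: "\<pi> ` set ys = row 1 - {(1, 0)}"
  proof -
    have "\<pi> ` set ys = {1} \<times> {1..<p}" unfolding sys by (auto simp: \<pi>_def image_iff)
    then show ?thesis by (auto simp: row_def)
  qed
  have "\<gamma> ^ card (set ys) \<le> expectation (gmono ?e (set ys \<union> \<pi> ` set ys))"
  proof (rule expectation_gmono_paired)
    show "inj_on \<pi> (set ys)" by (auto simp: sys \<pi>_def inj_on_def)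
    show "set ys \<inter> \<pi> ` set ys = {}" by (auto simp: sys \<pi>_def)
    have ysr: "set ys \<union> \<pi> ` set ys \<subseteq> rows" unfolding img by (auto simp: sys row_def)
    show "?e t \<in> I" if "t \<in> set ys \<union> \<pi> ` set ys" for t using that ysr eI by blast
    show "0 \<le> cov (?e t) (?e u)" if "t \<in> set ys \<union> \<pi> ` set ys" "u \<in> set ys \<union> \<pi> ` set ys" for t u
      using that ysr eI cov_nonneg by blast
    show "\<gamma> \<le> cov (?e t) (?e (\<pi> t))" if "t \<in> set ys" for t
    proof (rule cov_same)
      show "?e t \<in> I" "?e (\<pi> t) \<in> I" using that ysr eI by blast+
      show "lab (?e t) = lab (?e (\<pi> t))" using that l[of "snd t"] by (auto simp: sys \<pi>_def)
    qed
  qed (use gamma_pos in auto)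
  also have "card (set ys) = p - 1" by (simp add: sys)
  finally have E: "\<gamma> ^ (p - 1) \<le> E (set ys \<union> (row 1 - {(1, 0)}))" unfolding E_def img .
  have C: "\<gamma> \<le> pairC x y (0, 0) (1, 0)"
    unfolding pairC_def using p_pos l[of 0] by (intro cov_same eI) (auto simp: row_def)
  have "\<gamma> ^ p = \<gamma> * \<gamma> ^ (p - 1)" using p_pos by (simp add: power_eq_if)
  also have "\<dots> \<le> pairC x y (0, 0) (1, 0) * E (set ys \<union> (row 1 - {(1, 0)}))"
    using C E gamma_pos by (intro mult_mono) auto
  finally show ?thesis using ge by linarith
qed

lemma variance_W_ge:
  "\<kappa>\<^sup>2 * \<gamma> ^ p * real (card same_labels) \<le> variance W"
proof -
  let ?m = "\<lambda>x. gmono (pos (two x x)) (row 0)"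
  have mom: "all_moments (?m x)" if "x \<in> walks" for x using that by (intro pair_moments) auto
  have W: "W = (\<lambda>\<omega>. \<Sum>x\<in>walks. \<kappa> * ?m x \<omega>)" unfolding W_def sum_distrib_left ..
  have "variance W = (\<Sum>x\<in>walks. \<Sum>y\<in>walks. \<kappa> * \<kappa> * Cv (?m x) (?m y))"
    unfolding W Cv_def by (rule variance_sum_moments[OF mom])
  also have "\<dots> \<ge> (\<Sum>x\<in>walks. \<Sum>y\<in>walks. if (x, y) \<in> same_labels then \<kappa> * \<kappa> * \<gamma> ^ p else 0)"
  proof (intro sum_mono)
    fix x y assume w: "x \<in> walks" "y \<in> walks"
    have "0 \<le> Cv (?m x) (?m y)" using w by (intro Cv_nonneg) auto
    then show "(if (x, y) \<in> same_labels then \<kappa> * \<kappa> * \<gamma> ^ p else 0) \<le> \<kappa> * \<kappa> * Cv (?m x) (?m y)"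
      using Cv_same_labels[of x y] kappa_pos by (auto intro!: mult_left_mono)
  qed
  also have "(\<Sum>x\<in>walks. \<Sum>y\<in>walks. if (x, y) \<in> same_labels then \<kappa> * \<kappa> * \<gamma> ^ p else 0) =
      (\<Sum>xy\<in>walks \<times> walks. if xy \<in> same_labels then \<kappa> * \<kappa> * \<gamma> ^ p else 0)"
    by (simp add: sum.cartesian_product)
  also have "\<dots> = real (card same_labels) * (\<kappa> * \<kappa> * \<gamma> ^ p)"
  proof -
    have "walks \<times> walks \<inter> {xy. xy \<in> same_labels} = same_labels" by (auto simp: same_labels_def)
    then show ?thesis using finite_walks by (simp add: sum.If_cases)
  qed
  finally show ?thesis by (simp add: power2_eq_square mult_ac)
qed

end

section \<open>The matrix models\<close>

text \<open>The formula for the characteristic function also holds for an almost surely vanishing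
  variable, whose second moment is 0. Degenerate combinations therefore need no separate treatment
  from here on.\<close>

lemma (in prob_space) centered_gaussian_facts:
  assumes "centered_gaussian M Z"
  shows "all_moments Z" "expectation Z = 0"
    "(\<integral>\<omega>. iexp (Z \<omega>) \<partial>M) = complex_of_real (exp (- expectation (\<lambda>\<omega>. (Z \<omega>)\<^sup>2) / 2))"
proof -
  have meas [measurable]: "Z \<in> borel_measurable M" using assms by (simp add: centered_gaussian_def)
  consider (1) \<sigma> where "0 < \<sigma>" "distributed M lborel Z (normal_density 0 \<sigma>)" | (2) "AE \<omega> in M. Z \<omega> = 0"
    using assms unfolding centered_gaussian_def by blast
  then have "all_moments Z \<and> expectation Z = 0 \<and>
    (\<integral>\<omega>. iexp (Z \<omega>) \<partial>M) = complex_of_real (exp (- expectation (\<lambda>\<omega>. (Z \<omega>)\<^sup>2) / 2))"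
  proof cases
    case 1
    have e0: "expectation Z = 0" by (rule normal_distributed_expectation[OF 1])
    have "variance Z = \<sigma>\<^sup>2" by (rule normal_distributed_variance[OF 1])
    then have v: "expectation (\<lambda>\<omega>. (Z \<omega>)\<^sup>2) = \<sigma>\<^sup>2" by (simp add: e0)
    have "distributed M lborel (\<lambda>\<omega>. (Z \<omega> - 0) / \<sigma>) std_normal_density"
      using 1 by (subst (asm) normal_standard_normal_convert) auto
    then have d: "distr M lborel (\<lambda>\<omega>. Z \<omega> / \<sigma>) = std_normal_distribution"
      by (simp add: distributed_def)
    have "complex_of_real (exp (- \<sigma>\<^sup>2 / 2)) = char std_normal_distribution \<sigma>"
      by (simp add: char_std_normal_distribution)
    also have "\<dots> = (\<integral>\<omega>. iexp (\<sigma> * (Z \<omega> / \<sigma>)) \<partial>M)"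
      unfolding d[symmetric] char_def by (rule integral_distr) auto
    also have "\<dots> = (\<integral>\<omega>. iexp (Z \<omega>) \<partial>M)" using 1 by simp
    finally show ?thesis using all_moments_normal[OF 1] e0 v by simp
  next
    case 2
    have am: "all_moments Z"
      unfolding all_moments_def
    proof safe
      fix k
      have "integrable M (\<lambda>\<omega>. \<bar>Z \<omega>\<bar> ^ k) \<longleftrightarrow> integrable M (\<lambda>\<omega>. \<bar>0::real\<bar> ^ k)"
        by (rule integrable_cong_AE) (use 2 in auto)
      then show "integrable M (\<lambda>\<omega>. \<bar>Z \<omega>\<bar> ^ k)" by simp
    qed measurable
    have "expectation Z = (\<integral>\<omega>. 0 \<partial>M)" by (rule integral_cong_AE) (use 2 in auto)
    moreover have "expectation (\<lambda>\<omega>. (Z \<omega>)\<^sup>2) = (\<integral>\<omega>. 0 \<partial>M)" by (rule integral_cong_AE) (use 2 in auto)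
    moreover have "(\<integral>\<omega>. iexp (Z \<omega>) \<partial>M) = (\<integral>\<omega>. 1 \<partial>M)" by (rule integral_cong_AE) (use 2 in auto)
    ultimately show ?thesis using am by (simp add: prob_space)
  qed
  then show "all_moments Z" "expectation Z = 0"
    "(\<integral>\<omega>. iexp (Z \<omega>) \<partial>M) = complex_of_real (exp (- expectation (\<lambda>\<omega>. (Z \<omega>)\<^sup>2) / 2))"
    by auto
qed

lemma finite_vector_labels: "finite (vector_labels T n)"
proof (cases T)
  case Symmetric_Circulant
  have "{k. 2 * k \<le> n} \<subseteq> {..n}" by auto
  then show ?thesis using Symmetric_Circulant by (auto intro: finite_subset)
qed auto

locale gaussian_matrix_model =
  fixes T :: matrix_type and n :: nat and M :: "'a measure" and X :: "nat \<Rightarrow> nat \<Rightarrow> 'a \<Rightarrow> real"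
  assumes model: "gaussian_model T n M X"
begin

sublocale prob_space M
  using model by (simp add: gaussian_model_def)

text \<open>Linear combinations are grouped by k to fit the hypotheses of the model: a single block
  is Gaussian, and different blocks are independent.\<close>

definition block :: "(nat \<times> nat \<Rightarrow> real) \<Rightarrow> nat \<Rightarrow> 'a \<Rightarrow> real" where
  "block a k \<omega> = (\<Sum>l\<in>{1..vector_dim T n k}. a (k, l) * X k l \<omega>)"

lemma block_gaussian: "k \<in> vector_labels T n \<Longrightarrow> centered_gaussian M (block a k)"
  using model unfolding gaussian_model_def centered_gaussian_vector_def block_def by auto

lemma block_indep: "indep_vars (\<lambda>_. borel) (block a) (vector_labels T n)"
proof -
  have "indep_vars (\<lambda>_. borel)
      (\<lambda>k. (\<lambda>v. \<Sum>l\<in>{1..vector_dim T n k}. a (k, l) * v l) \<circ> (\<lambda>\<omega>. \<lambda>l\<in>{1..vector_dim T n k}. X k l \<omega>)) (vector_labels T n)"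
  proof (rule indep_vars_compose)
    show "indep_vars (\<lambda>k. \<Pi>\<^sub>M l\<in>{1..vector_dim T n k}. borel) (\<lambda>k \<omega>. \<lambda>l\<in>{1..vector_dim T n k}. X k l \<omega>) (vector_labels T n)"
      using model by (simp add: gaussian_model_def)
    show "(\<lambda>v. \<Sum>l\<in>{1..vector_dim T n k}. a (k, l) * v l) \<in> borel_measurable (\<Pi>\<^sub>M l\<in>{1..vector_dim T n k}. borel)" for k
      by measurable
  qed
  moreover have "(\<lambda>v. \<Sum>l\<in>{1..vector_dim T n k}. a (k, l) * v l) \<circ> (\<lambda>\<omega>. \<lambda>l\<in>{1..vector_dim T n k}. X k l \<omega>) = block a k" for k
    by (auto simp: block_def fun_eq_iff intro!: sum.cong)
  ultimately show ?thesis by simp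
qed

lemma block_uncorrelated:
  assumes "k \<in> vector_labels T n" "k' \<in> vector_labels T n" "k \<noteq> k'"
  shows "expectation (\<lambda>\<omega>. block a k \<omega> * block a k' \<omega>) = 0"
proof -
  have "indep_vars (\<lambda>_. borel) (block a) {k, k'}"
    using indep_vars_subset[OF block_indep, of "{k, k'}" a] assms by auto
  moreover have "integrable M (block a i)" if "i \<in> {k, k'}" for i
    using that assms centered_gaussian_facts(1)[OF block_gaussian] by (auto intro!: all_moments_integrable)
  ultimately have "expectation (\<lambda>\<omega>. \<Prod>i\<in>{k, k'}. block a i \<omega>) = (\<Prod>i\<in>{k, k'}. expectation (block a i))"
    by (intro indep_vars_lebesgue_integral) auto
  then show ?thesis using assms centered_gaussian_facts(2)[OF block_gaussian] by simp
qed

text \<open>Independence makes the characteristic function a product and the second moments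
  additive. Hence all coordinates together are jointly Gaussian, not merely those of one
  vector.\<close>

lemma sum_block_char:
  "(\<integral>\<omega>. iexp (\<Sum>k\<in>vector_labels T n. block a k \<omega>) \<partial>M) =
    complex_of_real (exp (- expectation (\<lambda>\<omega>. (\<Sum>k\<in>vector_labels T n. block a k \<omega>)\<^sup>2) / 2))"
proof -
  let ?K = "vector_labels T n"
  note fin = finite_vector_labels[of T n]
  have am: "all_moments (block a k)" if "k \<in> ?K" for k
    using centered_gaussian_facts(1)[OF block_gaussian[OF that]] .
  have "expectation (\<lambda>\<omega>. (\<Sum>k\<in>?K. block a k \<omega>)\<^sup>2) = expectation (\<lambda>\<omega>. \<Sum>k\<in>?K. \<Sum>k'\<in>?K. block a k \<omega> * block a k' \<omega>)"
    by (simp add: power2_eq_square sum_product)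
  also have "\<dots> = (\<Sum>k\<in>?K. expectation (\<lambda>\<omega>. \<Sum>k'\<in>?K. block a k \<omega> * block a k' \<omega>))"
    by (rule Bochner_Integration.integral_sum) (intro all_moments_integrable all_moments_intros am)
  also have "\<dots> = (\<Sum>k\<in>?K. \<Sum>k'\<in>?K. expectation (\<lambda>\<omega>. block a k \<omega> * block a k' \<omega>))"
    by (intro sum.cong refl Bochner_Integration.integral_sum all_moments_integrable all_moments_intros am)
  also have "\<dots> = (\<Sum>k\<in>?K. \<Sum>k'\<in>?K. if k' = k then expectation (\<lambda>\<omega>. (block a k \<omega>)\<^sup>2) else 0)"
    by (intro sum.cong refl) (auto simp: power2_eq_square block_uncorrelated)
  also have "\<dots> = (\<Sum>k\<in>?K. expectation (\<lambda>\<omega>. (block a k \<omega>)\<^sup>2))" using fin by simp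
  finally have sq: "expectation (\<lambda>\<omega>. (\<Sum>k\<in>?K. block a k \<omega>)\<^sup>2) = (\<Sum>k\<in>?K. expectation (\<lambda>\<omega>. (block a k \<omega>)\<^sup>2))" .
  have ind: "indep_vars (\<lambda>_. borel) (\<lambda>k \<omega>. iexp (block a k \<omega>)) ?K"
    using indep_vars_compose[OF block_indep, of "\<lambda>_ x. iexp x" "\<lambda>_. borel" a] by (simp add: comp_def)
  have "(\<integral>\<omega>. iexp (\<Sum>k\<in>?K. block a k \<omega>) \<partial>M) = (\<integral>\<omega>. (\<Prod>k\<in>?K. iexp (block a k \<omega>)) \<partial>M)"
    using fin by (simp add: exp_sum sum_distrib_left)
  also have "\<dots> = (\<Prod>k\<in>?K. \<integral>\<omega>. iexp (block a k \<omega>) \<partial>M)"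
  proof (rule indep_vars_lebesgue_integral[OF fin ind])
    fix k assume k: "k \<in> ?K"
    have [measurable]: "block a k \<in> borel_measurable M" by (rule all_moments_measurable[OF am[OF k]])
    show "integrable M (\<lambda>\<omega>. iexp (block a k \<omega>))"
      by (rule integrable_const_bound[where B=1]) auto
  qed
  also have "\<dots> = (\<Prod>k\<in>?K. complex_of_real (exp (- expectation (\<lambda>\<omega>. (block a k \<omega>)\<^sup>2) / 2)))"
    by (intro prod.cong refl centered_gaussian_facts(3) block_gaussian)
  also have "\<dots> = complex_of_real (exp (\<Sum>k\<in>?K. - expectation (\<lambda>\<omega>. (block a k \<omega>)\<^sup>2) / 2))"
    using fin by (simp add: exp_sum)
  also have "(\<Sum>k\<in>?K. - expectation (\<lambda>\<omega>. (block a k \<omega>)\<^sup>2) / 2) = - (\<Sum>k\<in>?K. expectation (\<lambda>\<omega>. (block a k \<omega>)\<^sup>2)) / 2"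
    by (simp add: sum_negf sum_divide_distrib)
  finally show ?thesis unfolding sq .
qed

text \<open>Taken as the image of the matrix positions, because the upper bound on second moments is
  stated for matrix entries.\<close>

definition indices :: "(nat \<times> nat) set" where
  "indices = (\<lambda>(i, j). entry_index T n i j) ` ({1..n} \<times> {1..n})"

definition coord :: "nat \<times> nat \<Rightarrow> 'a \<Rightarrow> real" where
  "coord x = X (fst x) (snd x)"

lemma finite_indices: "finite indices"
  by (simp add: indices_def)

lemma indices_admissible:
  assumes "x \<in> indices"
  shows "fst x \<in> vector_labels T n" "snd x \<in> {1..vector_dim T n (fst x)}"
proof -
  obtain i j where ij: "i \<in> {1..n}" "j \<in> {1..n}" "x = entry_index T n i j"
    using assms by (auto simp: indices_def)
  from entry_index_admissible[OF ij(1,2), of "fst x" "snd x" T] ij(3)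
  show "fst x \<in> vector_labels T n" "snd x \<in> {1..vector_dim T n (fst x)}" by auto
qed

lemma coord_block:
  assumes "x \<in> indices"
  shows "coord x = block (\<lambda>y. if y = x then 1 else 0) (fst x)"
proof
  fix \<omega>
  have "block (\<lambda>y. if y = x then 1 else 0) (fst x) \<omega> =
    (\<Sum>l\<in>{1..vector_dim T n (fst x)}. if l = snd x then X (fst x) l \<omega> else 0)"
    unfolding block_def by (intro sum.cong refl) (auto simp: prod_eq_iff)
  then show "coord x \<omega> = block (\<lambda>y. if y = x then 1 else 0) (fst x) \<omega>"
    using indices_admissible(2)[OF assms] by (simp add: coord_def)
qed

lemma sum_coord_block:
  "(\<Sum>x\<in>indices. a x * coord x \<omega>) = (\<Sum>k\<in>vector_labels T n. block (\<lambda>x. if x \<in> indices then a x else 0) k \<omega>)"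
proof -
  let ?S = "Sigma (vector_labels T n) (\<lambda>k. {1..vector_dim T n k})"
  have "(\<Sum>x\<in>indices. a x * coord x \<omega>) = (\<Sum>x\<in>?S. (if x \<in> indices then a x else 0) * coord x \<omega>)"
  proof (rule sum.mono_neutral_cong_left)
    show "finite ?S" using finite_vector_labels by auto
    show "indices \<subseteq> ?S"
    proof
      fix x assume "x \<in> indices"
      from indices_admissible[OF this] show "x \<in> ?S" by (cases x) auto
    qed
  qed auto
  also have "\<dots> = (\<Sum>k\<in>vector_labels T n. block (\<lambda>x. if x \<in> indices then a x else 0) k \<omega>)"
    unfolding block_def coord_def by (subst sum.Sigma) (auto simp: finite_vector_labels case_prod_beta' cong: if_cong)
  finally show ?thesis .
qed

lemma coord_gaussian: "x \<in> indices \<Longrightarrow> centered_gaussian M (coord x)"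
  using block_gaussian[OF indices_admissible(1)] by (simp add: coord_block)

lemma coord_moments: "x \<in> indices \<Longrightarrow> all_moments (coord x)"
  by (rule centered_gaussian_facts(1)[OF coord_gaussian])

lemma coord_uncorrelated:
  assumes "x \<in> indices" "y \<in> indices" "fst x \<noteq> fst y"
  shows "expectation (\<lambda>\<omega>. coord x \<omega> * coord y \<omega>) = 0"
proof -
  \<comment> \<open>A single coefficient function must produce both coordinates, as
    \<open>block_uncorrelated\<close> uses the same \<open>a\<close> in its two blocks. It selects x
    in one block and y in the other, since their labels differ.\<close>
  let ?a = "\<lambda>z. if z = x \<or> z = y then 1 else 0 :: real"
  have "coord x = block ?a (fst x)" "coord y = block ?a (fst y)"
    unfolding coord_block[OF assms(1)] coord_block[OF assms(2)] block_def
    using assms(3) by (auto simp: fun_eq_iff intro!: sum.cong)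
  then show ?thesis
    using block_uncorrelated[OF indices_admissible(1)[OF assms(1)] indices_admissible(1)[OF assms(2)] assms(3)] by simp
qed

text \<open>The lower bound \<gamma>, applied with equal indices, rules out degenerate entries. The
  bound B on covariances follows from that on second moments by the inequality between |u v| and
  (u^2 + v^2) / 2.\<close>

lemma walk_model:
  assumes p: "0 < p" and g: "0 < \<gamma>" and "0 < \<kappa>"
    and second_moment: "\<And>i j. i \<in> {1..n} \<Longrightarrow> j \<in> {1..n} \<Longrightarrow> expectation (\<lambda>\<omega>. (Y_entry T n X i j \<omega>)\<^sup>2) \<le> B"
    and B: "1 \<le> B"
    and cov_lower: "\<And>k i j. k \<in> vector_labels T n \<Longrightarrow> i \<in> {1..vector_dim T n k} \<Longrightarrow>
      j \<in> {1..vector_dim T n k} \<Longrightarrow> \<gamma> \<le> coord_cov M X k i j"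
    and fibre: "\<And>a l. a \<in> {1..n} \<Longrightarrow> card {b \<in> {1..n}. fst (entry_index T n a b) = l} \<le> 2"
  shows "walk_model M indices coord (entry_index T n) fst n p B \<gamma> \<kappa>"
proof -
  have same: "\<gamma> \<le> expectation (\<lambda>\<omega>. coord x \<omega> * coord y \<omega>)" if "x \<in> indices" "y \<in> indices" "fst x = fst y" for x y
    using cov_lower[of "fst x" "snd x" "snd y"] indices_admissible[OF that(1)] indices_admissible[OF that(2)] that(3)
    by (simp add: coord_cov_def coord_def)
  interpret gauss_family M indices coord
  proof unfold_locales
    show "finite indices" by (rule finite_indices)
    show "\<exists>\<sigma>>0. distributed M lborel (coord x) (normal_density 0 \<sigma>)" if x: "x \<in> indices" for x
    proof -
      have "\<not> (AE \<omega> in M. coord x \<omega> = 0)"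
      proof
        assume "AE \<omega> in M. coord x \<omega> = 0"
        then have "expectation (\<lambda>\<omega>. coord x \<omega> * coord x \<omega>) = (\<integral>\<omega>. 0 \<partial>M)"
          using all_moments_measurable[OF coord_moments[OF x]] by (intro integral_cong_AE) auto
        then show False using same[OF x x refl] g by simp
      qed
      then show ?thesis using coord_gaussian[OF x] unfolding centered_gaussian_def by blast
    qed
    show "(\<integral>\<omega>. iexp (\<Sum>x\<in>indices. a x * coord x \<omega>) \<partial>M) =
      complex_of_real (exp (- (\<integral>\<omega>. (\<Sum>x\<in>indices. a x * coord x \<omega>)\<^sup>2 \<partial>M) / 2))" for a
      unfolding sum_coord_block by (rule sum_block_char)
  qed
  have sq: "expectation (\<lambda>\<omega>. (coord x \<omega>)\<^sup>2) \<le> B" if x: "x \<in> indices" for x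
  proof -
    obtain i j where "i \<in> {1..n}" "j \<in> {1..n}" "x = entry_index T n i j"
      using x by (auto simp: indices_def)
    then show ?thesis using second_moment[of i j] by (simp add: Y_entry_def coord_def case_prod_beta')
  qed
  show ?thesis
  proof unfold_locales
    show "entry_index T n a b \<in> indices" if "a \<in> {1..n}" "b \<in> {1..n}" for a b
      using that by (auto simp: indices_def)
    show "cov x y = 0" if "x \<in> indices" "y \<in> indices" "fst x \<noteq> fst y" for x y
      unfolding cov_def using that by (rule coord_uncorrelated)
    show "\<gamma> \<le> cov x y" if "x \<in> indices" "y \<in> indices" "fst x = fst y" for x y
      unfolding cov_def using that by (rule same)
    show "\<bar>cov x y\<bar> \<le> B" if "x \<in> indices" "y \<in> indices" for x y
    proof -
      have i: "integrable M (\<lambda>\<omega>. coord x \<omega> * coord y \<omega>)" "integrable M (\<lambda>\<omega>. (coord x \<omega>)\<^sup>2)" "integrable M (\<lambda>\<omega>. (coord y \<omega>)\<^sup>2)"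
        by (intro all_moments_integrable all_moments_intros coord_moments that)+
      have "\<bar>cov x y\<bar> \<le> expectation (\<lambda>\<omega>. \<bar>coord x \<omega> * coord y \<omega>\<bar>)"
        unfolding cov_def by (rule integral_abs_bound)
      also have "\<dots> \<le> expectation (\<lambda>\<omega>. ((coord x \<omega>)\<^sup>2 + (coord y \<omega>)\<^sup>2) / 2)"
      proof (rule integral_mono)
        show "integrable M (\<lambda>\<omega>. \<bar>coord x \<omega> * coord y \<omega>\<bar>)" using i(1) by simp
        show "integrable M (\<lambda>\<omega>. ((coord x \<omega>)\<^sup>2 + (coord y \<omega>)\<^sup>2) / 2)" using i(2,3) by simp
        show "\<bar>coord x \<omega> * coord y \<omega>\<bar> \<le> ((coord x \<omega>)\<^sup>2 + (coord y \<omega>)\<^sup>2) / 2" for \<omega>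
          using sum_squares_bound[of "\<bar>coord x \<omega>\<bar>" "\<bar>coord y \<omega>\<bar>"] by (simp add: abs_mult)
      qed
      also have "\<dots> = (expectation (\<lambda>\<omega>. (coord x \<omega>)\<^sup>2) + expectation (\<lambda>\<omega>. (coord y \<omega>)\<^sup>2)) / 2"
        using i(2,3) by simp
      also have "\<dots> \<le> B" using sq[OF that(1)] sq[OF that(2)] by simp
      finally show ?thesis .
    qed
    show "card {b \<in> {1..n}. fst (entry_index T n a b) = l} \<le> 2" if "a \<in> {1..n}" for a l
      using that by (rule fibre)
  qed (use assms in auto)
qed

end

section \<open>Labels of entries: rows and shifted walks\<close>

lemma card_residue_class:
  "card {b \<in> {1..n}. int b mod int n = c} \<le> 1"
proof -
  have "b = b'" if b: "b \<in> {1..n}" "b' \<in> {1..n}" and eq: "int b mod int n = int b' mod int n" for b b' :: nat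
  proof -
    have "int n dvd int b - int b'" using eq by (simp add: mod_eq_dvd_iff)
    moreover have "\<bar>int b - int b'\<bar> < int n" using b by auto
    ultimately have "int b - int b' = 0" using dvd_imp_le_int[of "int b - int b'" "int n"] by fastforce
    then show ?thesis by simp
  qed
  then show ?thesis by (auto simp: card_le_Suc0_iff_eq)
qed

lemma card_two_residue_classes:
  assumes "\<And>b. b \<in> {1..n} \<Longrightarrow> P b \<Longrightarrow> int b mod int n = c \<or> int b mod int n = d"
  shows "card {b \<in> {1..n}. P b} \<le> 2"
proof -
  have "{b \<in> {1..n}. P b} \<subseteq> {b \<in> {1..n}. int b mod int n = c} \<union> {b \<in> {1..n}. int b mod int n = d}"
    using assms by auto
  then have "card {b \<in> {1..n}. P b} \<le> card ({b \<in> {1..n}. int b mod int n = c} \<union> {b \<in> {1..n}. int b mod int n = d})"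
    by (rule card_mono[rotated]) simp
  also have "\<dots> \<le> card {b \<in> {1..n}. int b mod int n = c} + card {b \<in> {1..n}. int b mod int n = d}"
    by (rule card_Un_le)
  also have "\<dots> \<le> 1 + 1" by (intro add_mono card_residue_class)
  finally show ?thesis by simp
qed

text \<open>The row a and the label l determine the column modulo n, and {1..n} contains one element
  of each residue class. The absolute value of the difference in the Toeplitz and symmetric
  circulant types leaves two signs, hence two classes.\<close>

lemma label_fibre:
  assumes a: "a \<in> {1..n}"
  shows "card {b \<in> {1..n}. fst (entry_index T n a b) = l} \<le> 2"
proof (rule card_two_residue_classes[where c="(case T of Toeplitz \<Rightarrow> int a + int l | Circulant \<Rightarrow> int a + int l - 1 |
      Reverse_Circulant \<Rightarrow> int l + 1 - int a | Symmetric_Circulant \<Rightarrow> int a + int l | Hankel \<Rightarrow> int l + 1 - int a) mod int n"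
      and d="(int a - int l) mod int n"])
  fix b assume b: "b \<in> {1..n}" and l: "fst (entry_index T n a b) = l"
  have cong: "int b mod int n = e mod int n" if "int b - e = int n * q" for e q
    using that by (metis add_diff_cancel_left' diff_add_cancel mod_mult_self2 mult.commute add.commute)
  show "int b mod int n = (case T of Toeplitz \<Rightarrow> int a + int l | Circulant \<Rightarrow> int a + int l - 1 |
      Reverse_Circulant \<Rightarrow> int l + 1 - int a | Symmetric_Circulant \<Rightarrow> int a + int l | Hankel \<Rightarrow> int l + 1 - int a) mod int n \<or>
    int b mod int n = (int a - int l) mod int n"
  proof (cases T)
    case Toeplitz
    then have "int l = \<bar>int a - int b\<bar>" using l by auto
    then have "int b = int a + int l \<or> int b = int a - int l" by linarith
    then show ?thesis using Toeplitz by auto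
  next
    case Circulant
    then have "int l - 1 = (int n + int b - int a) mod int n"
      using l a b by (auto simp: of_nat_mod of_nat_diff)
    moreover have "int n + int b - int a = int n * ((int n + int b - int a) div int n) + (int n + int b - int a) mod int n"
      by simp
    ultimately have "int b - (int a + int l - 1) = int n * ((int n + int b - int a) div int n - 1)"
      by (simp add: algebra_simps)
    from cong[OF this] show ?thesis using Circulant by simp
  next
    case Reverse_Circulant
    then have "int l - 1 = (int a + int b - 2) mod int n"
      using l a b by (auto simp: of_nat_mod of_nat_diff)
    moreover have "int a + int b - 2 = int n * ((int a + int b - 2) div int n) + (int a + int b - 2) mod int n"
      by simp
    ultimately have "int b - (int l + 1 - int a) = int n * ((int a + int b - 2) div int n)"
      by (simp add: algebra_simps)
    from cong[OF this] show ?thesis using Reverse_Circulant by simp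
  next
    case Symmetric_Circulant
    define d where "d = max a b - min a b"
    have d: "int d = \<bar>int a - int b\<bar>" by (auto simp: d_def)
    have dn: "d \<le> n" using a b by (auto simp: d_def)
    have "l = (if 2 * d \<le> n then d else n - d)"
      using l Symmetric_Circulant by (auto simp: d_def Let_def)
    then consider "int l = int d" | "int l = int n - int d" using dn by (auto split: if_splits)
    \<comment> \<open>Four cases: the sign of b - a, and whether the label is the distance itself or
      n minus the distance. The last two differ from the first two by a multiple of n.\<close>
    then have "int b - (int a + int l) = int n * 0 \<or> int b - (int a - int l) = int n * 0 \<or>
        int b - (int a + int l) = int n * (- 1) \<or> int b - (int a - int l) = int n * 1"
      using d by cases (auto simp: abs_if split: if_splits)
    then show ?thesis
      using cong[of "int a + int l" 0] cong[of "int a - int l" 0] cong[of "int a + int l" "- 1"]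
        cong[of "int a - int l" 1] Symmetric_Circulant by auto
  next
    case Hankel
    then have "l = a + b - 1" using l by (simp split: if_splits)
    then have "int b = int l + 1 - int a" using a b by simp
    then show ?thesis using Hankel by simp
  qed
qed

text \<open>A sum label \<open>i + j\<close> is invariant only under shifts of alternating sign.\<close>

definition walk_shift :: "matrix_type \<Rightarrow> nat \<Rightarrow> nat \<Rightarrow> nat \<Rightarrow> nat" where
  "walk_shift T s j a = (if (T = Reverse_Circulant \<or> T = Hankel) \<and> odd j then a - s else a + s)"

text \<open>Differences are invariant under a common shift, sums under opposite shifts. The window
  from h + 1 to 2h leaves room for shifts by up to h both ways: a shifted vertex lies between 1 and
  3h, and subtraction of naturals is never truncated.\<close>

lemma entry_index_shift:
  assumes n: "4 * h \<le> n" and a: "a \<in> {h + 1..2 * h}" "b \<in> {h + 1..2 * h}" and s: "s \<in> {1..h}"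
    and j: "(T = Reverse_Circulant \<or> T = Hankel) \<Longrightarrow> odd j \<longleftrightarrow> even j'"
  shows "fst (entry_index T n (walk_shift T s j a) (walk_shift T s j' b)) = fst (entry_index T n a b)"
proof (cases T)
  case Toeplitz
  then show ?thesis by (simp add: walk_shift_def)
next
  case Circulant
  have "n + (b + s) - (a + s) = n + b - a" by simp
  then show ?thesis using Circulant by (simp add: walk_shift_def)
next
  case Symmetric_Circulant
  have "max (a + s) (b + s) - min (a + s) (b + s) = max a b - min a b" by (auto simp: max_def min_def)
  then show ?thesis using Symmetric_Circulant by (simp add: walk_shift_def Let_def)
next
  case Reverse_Circulant
  then have "walk_shift T s j a + walk_shift T s j' b = a + b"
    using a s j by (auto simp: walk_shift_def)
  then show ?thesis using Reverse_Circulant by simp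
next
  case Hankel
  then have "walk_shift T s j a + walk_shift T s j' b = a + b"
    using a s j by (auto simp: walk_shift_def)
  then show ?thesis using Hankel by simp
qed

text \<open>With h = n div 4, there are h^p walks inside the window and h shifts. Each choice gives
  a different pair consisting of a walk and its shifted copy, because the shift can be read off at
  vertex 0.\<close>

lemma card_same_label_walks:
  assumes p: "0 < p" and ev: "T = Reverse_Circulant \<or> T = Hankel \<Longrightarrow> even p"
  shows "(n div 4) ^ (p + 1) \<le> card {(x, y) \<in> (\<Pi>\<^sub>E j\<in>{..<p}. {1..n}) \<times> (\<Pi>\<^sub>E j\<in>{..<p}. {1..n}).
    \<forall>j<p. fst (entry_index T n (x j) (x (Suc j mod p))) = fst (entry_index T n (y j) (y (Suc j mod p)))}"
    (is "_ \<le> card ?S")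
proof -
  define h where "h = n div 4"
  have hn: "4 * h \<le> n" by (simp add: h_def)
  let ?X = "(\<Pi>\<^sub>E j\<in>{..<p}. {h + 1..2 * h}) \<times> {1..h}"
  define f where "f = (\<lambda>(x, s). (x, \<lambda>j\<in>{..<p}. walk_shift T s j (x j)))"
  have "card ?X = h ^ (p + 1)" by (simp add: card_cartesian_product card_PiE)
  moreover have "card ?X \<le> card ?S"
  proof (rule card_inj_on_le[of f])
    show "inj_on f ?X"
    proof (rule inj_onI)
      fix u v assume uv: "u \<in> ?X" "v \<in> ?X" "f u = f v"
      obtain x s where u: "u = (x, s)" by (cases u)
      obtain y t where v: "v = (y, t)" by (cases v)
      have "x = y" and eq: "(\<lambda>j\<in>{..<p}. walk_shift T s j (x j)) = (\<lambda>j\<in>{..<p}. walk_shift T t j (y j))"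
        using uv(3) unfolding u v f_def by auto
      moreover have "walk_shift T s 0 (x 0) = walk_shift T t 0 (y 0)"
        using fun_cong[OF eq, of 0] p by simp
      ultimately show "u = v" unfolding u v by (simp add: walk_shift_def)
    qed
    show "finite ?S"
      by (rule finite_subset[of _ "(\<Pi>\<^sub>E j\<in>{..<p}. {1..n}) \<times> (\<Pi>\<^sub>E j\<in>{..<p}. {1..n})"]) (auto intro!: finite_PiE)
    show "f ` ?X \<subseteq> ?S"
    proof
      fix w assume "w \<in> f ` ?X"
      then obtain x s where xs: "x \<in> (\<Pi>\<^sub>E j\<in>{..<p}. {h + 1..2 * h})" "s \<in> {1..h}"
        and w: "w = (x, \<lambda>j\<in>{..<p}. walk_shift T s j (x j))" by (auto simp: f_def)
      have xj: "x j \<in> {h + 1..2 * h}" if "j < p" for j using xs(1) that by (auto simp: PiE_iff)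
      have x1: "x j \<in> {1..n}" if "j < p" for j using xj[OF that] hn by auto
      have y1: "walk_shift T s j (x j) \<in> {1..n}" if "j < p" for j
        using xj[OF that] hn xs(2) by (auto simp: walk_shift_def)
      have "x \<in> (\<Pi>\<^sub>E j\<in>{..<p}. {1..n})"
        using xs(1) x1 by (auto simp: PiE_iff)
      moreover have "(\<lambda>j\<in>{..<p}. walk_shift T s j (x j)) \<in> (\<Pi>\<^sub>E j\<in>{..<p}. {1..n})"
        using y1 by auto
      moreover have "fst (entry_index T n (walk_shift T s j (x j)) (walk_shift T s (Suc j mod p) (x (Suc j mod p)))) =
          fst (entry_index T n (x j) (x (Suc j mod p)))" if "j < p" for j
      proof (rule entry_index_shift[OF hn xj[OF that] xj xs(2)])
        show "Suc j mod p < p" using p by simp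
        \<comment> \<open>At the closing step, from p - 1 back to 0, the signs alternate because p
          is even.\<close>
        show "odd j \<longleftrightarrow> even (Suc j mod p)" if "T = Reverse_Circulant \<or> T = Hankel"
          using ev[OF that] \<open>j < p\<close> by (cases "Suc j = p") auto
      qed
      ultimately show "w \<in> ?S" using p unfolding w by (auto simp del: entry_index.simps)
    qed
  qed
  ultimately show ?thesis by (simp add: h_def)
qed

section \<open>Traces of matrix powers as sums over closed walks\<close>

lemma mat_power_walks:
  fixes a :: "nat \<Rightarrow> nat \<Rightarrow> 'b :: comm_semiring_1" and n :: nat
  defines "A \<equiv> Matrix.mat n n (\<lambda>(i, j). a (i + 1) (j + 1))"
  assumes "i < n" "j < n"
  shows "(A ^\<^sub>m Suc p) $$ (i, j) = (\<Sum>x\<in>(\<Pi>\<^sub>E t\<in>{..p}. {1..n}).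
    (if x 0 = i + 1 then 1 else 0) * (\<Prod>t<p. a (x t) (x (Suc t))) * a (x p) (j + 1))"
  using assms(3)
\<comment> \<open>The start of the path is one of the summed vertices and is pinned to i + 1 by an
  indicator. The index set is thus a plain function space, and raising p appends one more vertex to
  it.\<close>
proof (induction p arbitrary: j)
  case 0
  have A: "A \<in> carrier_mat n n" by (simp add: A_def)
  have "(\<Sum>x\<in>(\<Pi>\<^sub>E t\<in>{..0::nat}. {1..n}). (if x 0 = i + 1 then 1 else 0) * a (x 0) (j + 1)) =
    (\<Sum>k\<in>{1..n}. (if k = i + 1 then 1 else 0) * a k (j + 1))"
    by (rule sum.reindex_bij_witness[where i="\<lambda>k. \<lambda>t\<in>{..0}. k" and j="\<lambda>x. x 0"]) (auto simp: PiE_iff extensional_def fun_eq_iff)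
  also have "\<dots> = a (i + 1) (j + 1)"
    using assms(2) by (simp add: if_distrib[of "\<lambda>c. c * _"] cong: if_cong)
  finally show ?case using A 0 assms(2) by (simp add: A_def)
next
  case (Suc p)
  have A: "A \<in> carrier_mat n n" by (simp add: A_def)
  have P: "A ^\<^sub>m Suc p \<in> carrier_mat n n" using A by (rule pow_carrier_mat)
  let ?w = "\<lambda>x. (if x 0 = i + 1 then 1 else 0) * (\<Prod>t<p. a (x t) (x (Suc t)))"
  have "(A ^\<^sub>m Suc (Suc p)) $$ (i, j) = (\<Sum>k<n. (A ^\<^sub>m Suc p) $$ (i, k) * A $$ (k, j))"
    using A P assms(2) Suc.prems unfolding pow_mat.simps(2)[of A "Suc p"]
    by (auto simp: scalar_prod_def lessThan_atLeast0 simp del: pow_mat.simps intro!: sum.cong)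
  also have "\<dots> = (\<Sum>k<n. (\<Sum>x\<in>(\<Pi>\<^sub>E t\<in>{..p}. {1..n}). ?w x * a (x p) (k + 1)) * a (k + 1) (j + 1))"
    by (intro sum.cong refl arg_cong2[where f="(*)"] Suc.IH) (use Suc.prems in \<open>auto simp: A_def\<close>)
  also have "\<dots> = (\<Sum>k\<in>{1..n}. (\<Sum>x\<in>(\<Pi>\<^sub>E t\<in>{..p}. {1..n}). ?w x * a (x p) k) * a k (j + 1))"
    by (rule sum.reindex_bij_witness[where i="\<lambda>k. k - 1" and j="\<lambda>k. k + 1"]) auto
  also have "\<dots> = (\<Sum>k\<in>{1..n}. \<Sum>x\<in>(\<Pi>\<^sub>E t\<in>{..p}. {1..n}). ?w x * a (x p) k * a k (j + 1))"
    by (simp add: sum_distrib_right)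
  also have "\<dots> = (\<Sum>(k, x)\<in>{1..n} \<times> (\<Pi>\<^sub>E t\<in>{..p}. {1..n}). ?w x * a (x p) k * a k (j + 1))"
    by (simp add: sum.cartesian_product)
  also have "\<dots> = (\<Sum>x\<in>(\<Pi>\<^sub>E t\<in>{..Suc p}. {1..n}).
      (if x 0 = i + 1 then 1 else 0) * (\<Prod>t<Suc p. a (x t) (x (Suc t))) * a (x (Suc p)) (j + 1))"
  proof (rule sum.reindex_bij_witness[where i="\<lambda>x. (x (Suc p), restrict x {..p})" and j="\<lambda>(k, x). x(Suc p := k)"])
    fix kx assume "kx \<in> {1..n} \<times> (\<Pi>\<^sub>E t\<in>{..p}. {1..n})"
    then obtain k x where kx: "kx = (k, x)" "k \<in> {1..n}" "x \<in> (\<Pi>\<^sub>E t\<in>{..p}. {1..n})" by auto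
    show "((case kx of (k, x) \<Rightarrow> x(Suc p := k)) (Suc p), restrict (case kx of (k, x) \<Rightarrow> x(Suc p := k)) {..p}) = kx"
      using kx by (auto simp: fun_eq_iff PiE_iff extensional_def)
    show "(case kx of (k, x) \<Rightarrow> x(Suc p := k)) \<in> (\<Pi>\<^sub>E t\<in>{..Suc p}. {1..n})"
      using kx by (auto simp: PiE_iff extensional_def)
    have "(\<Prod>t<p. a ((x(Suc p := k)) t) ((x(Suc p := k)) (Suc t))) = (\<Prod>t<p. a (x t) (x (Suc t)))"
      by (intro prod.cong) auto
    then show "(if (case kx of (k, x) \<Rightarrow> x(Suc p := k)) 0 = i + 1 then 1 else 0) *
        (\<Prod>t<Suc p. a ((case kx of (k, x) \<Rightarrow> x(Suc p := k)) t) ((case kx of (k, x) \<Rightarrow> x(Suc p := k)) (Suc t))) *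
        a ((case kx of (k, x) \<Rightarrow> x(Suc p := k)) (Suc p)) (j + 1) =
      (case kx of (k, x) \<Rightarrow> ?w x * a (x p) k * a k (j + 1))"
      unfolding kx(1) by (simp add: mult.assoc)
  next
    fix x assume x: "x \<in> (\<Pi>\<^sub>E t\<in>{..Suc p}. {1..n})"
    then show "(case (x (Suc p), restrict x {..p}) of (k, x) \<Rightarrow> x(Suc p := k)) = x"
      by (auto simp: fun_eq_iff PiE_iff extensional_def)
    show "(x (Suc p), restrict x {..p}) \<in> {1..n} \<times> (\<Pi>\<^sub>E t\<in>{..p}. {1..n})"
      using x by (auto simp: PiE_iff)
  qed
  finally show ?case .
qed

text \<open>Summing over the diagonal index i absorbs the indicator that pinned the first vertex.
  The last step then returns to that vertex, which is what \<open>Suc t mod p\<close> expresses at t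
  = p - 1.\<close>

lemma mat_trace_power_walks:
  fixes a :: "nat \<Rightarrow> nat \<Rightarrow> 'b :: comm_semiring_1"
  assumes p: "0 < p"
  shows "mat_trace (Matrix.mat n n (\<lambda>(i, j). a (i + 1) (j + 1)) ^\<^sub>m p) =
    (\<Sum>x\<in>(\<Pi>\<^sub>E t\<in>{..<p}. {1..n}). \<Prod>t<p. a (x t) (x (Suc t mod p)))"
proof -
  obtain q where q: "p = Suc q" using p by (cases p) auto
  let ?A = "Matrix.mat n n (\<lambda>(i, j). a (i + 1) (j + 1))"
  have dim: "dim_row (?A ^\<^sub>m p) = n"
    using pow_carrier_mat[of ?A n p] by (metis carrier_matD(1) mat_carrier)
  have "mat_trace (?A ^\<^sub>m p) = (\<Sum>i<n. \<Sum>x\<in>(\<Pi>\<^sub>E t\<in>{..q}. {1..n}).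
      (if x 0 = i + 1 then 1 else 0) * (\<Prod>t<q. a (x t) (x (Suc t))) * a (x q) (i + 1))"
    unfolding mat_trace_def dim unfolding q
    by (intro sum.cong refl mat_power_walks) auto
  also have "\<dots> = (\<Sum>x\<in>(\<Pi>\<^sub>E t\<in>{..q}. {1..n}). \<Sum>i<n.
      (if x 0 = i + 1 then (\<Prod>t<q. a (x t) (x (Suc t))) * a (x q) (x 0) else 0))"
    by (subst sum.swap) (intro sum.cong refl, auto)
  also have "\<dots> = (\<Sum>x\<in>(\<Pi>\<^sub>E t\<in>{..q}. {1..n}). (\<Prod>t<q. a (x t) (x (Suc t))) * a (x q) (x 0))"
  proof (intro sum.cong refl)
    fix x assume "x \<in> (\<Pi>\<^sub>E t\<in>{..q}. {1..n})"
    then have x0: "x 0 \<in> {1..n}" by (auto simp: PiE_iff)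
    then have "(\<Sum>i<n. if x 0 = i + 1 then c else 0) = (\<Sum>i<n. if i = x 0 - 1 then c else 0)" for c :: 'b
      by (intro sum.cong refl) auto
    then show "(\<Sum>i<n. if x 0 = i + 1 then (\<Prod>t<q. a (x t) (x (Suc t))) * a (x q) (x 0) else 0) =
        (\<Prod>t<q. a (x t) (x (Suc t))) * a (x q) (x 0)"
      using x0 by auto
  qed
  also have "\<dots> = (\<Sum>x\<in>(\<Pi>\<^sub>E t\<in>{..<p}. {1..n}). \<Prod>t<p. a (x t) (x (Suc t mod p)))"
    unfolding q lessThan_Suc_atMost by (intro sum.cong refl) (simp flip: lessThan_Suc_atMost)
  finally show ?thesis .
qed

section \<open>The central limit theorem\<close>

lemma trace_power_eq_walk_sum:
  assumes p: "0 < p"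
  shows "trace_power T n X p \<omega> = (1 / sqrt (real n)) ^ p *
    (\<Sum>x\<in>(\<Pi>\<^sub>E t\<in>{..<p}. {1..n}). \<Prod>t<p. Y_entry T n X (x t) (x (Suc t mod p)) \<omega>)"
proof -
  define a where "a = (\<lambda>i j. (1 / sqrt (real n)) * Y_entry T n X i j \<omega>)"
  have "X_mat T n X \<omega> = Matrix.mat n n (\<lambda>(i, j). a (i + 1) (j + 1))"
    by (auto simp: X_mat_def Y_mat_def a_def)
  then have "trace_power T n X p \<omega> = (\<Sum>x\<in>(\<Pi>\<^sub>E t\<in>{..<p}. {1..n}). \<Prod>t<p. a (x t) (x (Suc t mod p)))"
    unfolding trace_power_def by (simp only: mat_trace_power_walks[OF p])
  then show ?thesis
    by (simp add: a_def prod.distrib sum_distrib_left prod_dividef power_one_over)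
qed

lemma (in walk_model) W_eq:
  "W \<omega> = \<kappa> * (\<Sum>x\<in>(\<Pi>\<^sub>E t\<in>{..<p}. {1..n}). \<Prod>t<p. G (ent (x t) (x (Suc t mod p))) \<omega>)"
proof -
  have "gmono (pos (two x x)) (row 0) \<omega> = (\<Prod>t<p. G (ent (x t) (x (Suc t mod p))) \<omega>)" for x
    unfolding gmono_def
    by (rule prod.reindex_bij_witness[where i="Pair 0" and j=snd]) (auto simp: row_def pos_def two_def)
  then show ?thesis by (simp add: W_def walks_def)
qed

text \<open>\<kappa> cancels, and so do the powers of n up to a remaining factor of the square root
  of n. The numerator of the bound is written out because it has to be recognizably the same for all
  n.\<close>

lemma (in walk_model) tv_dist_W_le:
  assumes n4: "4 \<le> n" and \<kappa>: "\<kappa> = (1 / sqrt (real n)) ^ p"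
    and same: "(n div 4) ^ (p + 1) \<le> card same_labels"
  shows "tv_dist M (standardized M W) std_normal_distribution (\<lambda>x. x) \<le>
    2 * (sqrt (term_bound * real (card (({..<4::nat} \<times> {..<p}) \<rightarrow>\<^sub>E ({..<4::nat} \<times> {..<p})) * 2 ^ (2 * p - 1) * 4 ^ (2 * p))) * 8 ^ (p + 1) / \<gamma> ^ p) / sqrt (real n)"
proof -
  define K where "K = term_bound * real (card (all_rows \<rightarrow>\<^sub>E all_rows) * 2 ^ (2 * p - 1) * 4 ^ (2 * p))"
  define h where "h = n div 4"
  have BK: "1 \<le> B * real (4 * p)" using B_ge p_pos mult_mono[of 1 B 1 "real (4 * p)"] by simp
  have tb: "0 \<le> term_bound" unfolding term_bound_def using BK by simp
  then have K: "0 \<le> K" unfolding K_def by simp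
  have n: "0 < real n" using n4 by simp
  \<comment> \<open>For n at least 4, rounding n / 4 down loses a factor of at most 2. This is the
    origin of the constant 8.\<close>
  have "n \<le> 8 * h" using n4 unfolding h_def by presburger
  then have h8: "real n / 8 \<le> real h" by simp
  have lower: "\<kappa>\<^sup>2 * \<gamma> ^ p * (real n / 8) ^ (p + 1) \<le> variance W"
  proof -
    have "(real n / 8) ^ (p + 1) \<le> real h ^ (p + 1)" using h8 n by (intro power_mono) auto
    also have "\<dots> \<le> real (card same_labels)"
      using same unfolding h_def by (metis of_nat_le_iff of_nat_power)
    finally have "\<kappa>\<^sup>2 * \<gamma> ^ p * (real n / 8) ^ (p + 1) \<le> \<kappa>\<^sup>2 * \<gamma> ^ p * real (card same_labels)"
      using gamma_pos by (intro mult_left_mono) auto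
    then show ?thesis using variance_W_ge by linarith
  qed
  have lpos: "0 < \<kappa>\<^sup>2 * \<gamma> ^ p * (real n / 8) ^ (p + 1)" using kappa_pos gamma_pos n by simp
  have upper: "variance T \<le> (\<kappa>\<^sup>2 * real n ^ p)\<^sup>2 * real n * K"
  proof -
    have "variance T \<le> \<kappa> ^ 4 * term_bound * (real (card linked_walks) * 4 ^ (2 * p))"
      by (rule variance_T_le_card)
    also have "\<dots> \<le> \<kappa> ^ 4 * term_bound * (real (card (all_rows \<rightarrow>\<^sub>E all_rows) * (n ^ (2 * p + 1) * 2 ^ (2 * p - 1))) * 4 ^ (2 * p))"
      using card_linked_walks tb by (intro mult_left_mono mult_right_mono) (simp_all only: of_nat_le_iff, auto)
    also have "\<dots> = (\<kappa>\<^sup>2 * real n ^ p)\<^sup>2 * real n * K"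
      unfolding K_def by (simp add: power_mult_distrib power_add power_mult power2_eq_square power4_eq_xxxx algebra_simps)
    finally show ?thesis .
  qed
  have "sqrt (variance T) \<le> sqrt ((\<kappa>\<^sup>2 * real n ^ p)\<^sup>2 * real n * K)" using upper by simp
  also have "\<dots> = \<kappa>\<^sup>2 * real n ^ p * sqrt (real n) * sqrt K"
    by (simp add: real_sqrt_mult)
  finally have sT: "sqrt (variance T) \<le> \<kappa>\<^sup>2 * real n ^ p * sqrt (real n) * sqrt K" .
  have "tv_dist M (standardized M W) std_normal_distribution (\<lambda>x. x) \<le> 2 * (sqrt (variance T) / variance W)"
    using lower lpos by (intro tv_dist_W) linarith
  also have "\<dots> \<le> 2 * (\<kappa>\<^sup>2 * real n ^ p * sqrt (real n) * sqrt K / (\<kappa>\<^sup>2 * \<gamma> ^ p * (real n / 8) ^ (p + 1)))"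
    using sT lower lpos K by (intro mult_left_mono frac_le) auto
  also have "\<dots> = 2 * (sqrt K * 8 ^ (p + 1) / \<gamma> ^ p) / sqrt (real n)"
  proof -
    define r where "r = sqrt (real n)"
    have r: "0 < r" "real n = r * r" using n by (auto simp: r_def)
    have "\<kappa>\<^sup>2 * real n ^ p * r * sqrt K / (\<kappa>\<^sup>2 * \<gamma> ^ p * (real n / 8) ^ (p + 1)) = sqrt K * 8 ^ (p + 1) / \<gamma> ^ p / r"
      using kappa_pos gamma_pos r(1) unfolding r(2) by (simp add: field_simps power_mult_distrib)
    then show ?thesis unfolding r_def by simp
  qed
  finally show ?thesis unfolding K_def .
qed

theorem theorem1p2:
  fixes T :: matrix_type
    and Omega :: "nat \<Rightarrow> 'a measure"
    and X :: "nat \<Rightarrow> nat \<Rightarrow> nat \<Rightarrow> 'a \<Rightarrow> real"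
    and m M \<gamma> :: real
    and p :: nat
  assumes model: "\<And>n. n \<ge> 1 \<Longrightarrow> gaussian_model T n (Omega n) (X n)"
    and m_pos: "0 < m"
    and M_pos: "0 < M"
    and second_moment: "\<And>n i j. n \<ge> 1 \<Longrightarrow> i \<in> {1..n} \<Longrightarrow> j \<in> {1..n} \<Longrightarrow>
          m \<le> prob_space.expectation (Omega n) (\<lambda>\<omega>. (Y_entry T n (X n) i j \<omega>)\<^sup>2) \<and>
          prob_space.expectation (Omega n) (\<lambda>\<omega>. (Y_entry T n (X n) i j \<omega>)\<^sup>2) \<le> M"
    and gamma_pos: "0 < \<gamma>"
    and cov_lower: "\<And>n k i j. n \<ge> 1 \<Longrightarrow> k \<in> vector_labels T n \<Longrightarrow>
          i \<in> {1..vector_dim T n k} \<Longrightarrow> j \<in> {1..vector_dim T n k} \<Longrightarrow>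
          \<gamma> \<le> coord_cov (Omega n) (X n) k i j"
    and p_pos: "p > 0"
    and p_even: "T = Reverse_Circulant \<or> T = Hankel \<Longrightarrow> even p"
  shows "tv_tendsto_std_normal Omega
           (\<lambda>n. standardized (Omega n) (trace_power T n (X n) p))"
proof -
  \<comment> \<open>The estimates raise exponents freely and hence want a bound of at least
    1.\<close>
  define B where "B = max 1 M"
  \<comment> \<open>A copy of \<open>term_bound\<close> outside the locale, which is interpreted
    anew for each n. It makes visible that \<open>C\<close> does not depend on n.\<close>
  define tb where "tb = (B * real (4 * p)) ^ p * (B * real (4 * p)) ^ p * (2 * (B * real (4 * p)) ^ (8 * p))"
  define C where "C = 2 * (sqrt (tb * real (card (({..<4::nat} \<times> {..<p}) \<rightarrow>\<^sub>E ({..<4::nat} \<times> {..<p})) * 2 ^ (2 * p - 1) * 4 ^ (2 * p))) * 8 ^ (p + 1) / \<gamma> ^ p)"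
  let ?d = "\<lambda>n. tv_dist (Omega n) (standardized (Omega n) (trace_power T n (X n) p)) std_normal_distribution (\<lambda>x. x)"
  \<comment> \<open>From n = 4 on, n div 4 is positive and the lower bound for the variance is not
    void. Smaller n do not affect the limit.\<close>
  have bound: "?d n \<le> C / sqrt (real n)" if n: "4 \<le> n" for n
  proof -
    have n1: "n \<ge> 1" using n by simp
    interpret gm: gaussian_matrix_model T n "Omega n" "X n"
      by unfold_locales (rule model[OF n1])
    interpret w: walk_model "Omega n" gm.indices gm.coord "entry_index T n" fst n p B \<gamma> "(1 / sqrt (real n)) ^ p"
    proof (rule gm.walk_model[OF p_pos gamma_pos])
      show "0 < (1 / sqrt (real n)) ^ p" using n by simp
      show "gm.expectation (\<lambda>\<omega>. (Y_entry T n (X n) i j \<omega>)\<^sup>2) \<le> B" if "i \<in> {1..n}" "j \<in> {1..n}" for i j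
        using second_moment[OF n1 that] unfolding B_def by linarith
      show "1 \<le> B" by (simp add: B_def)
      show "\<gamma> \<le> coord_cov (Omega n) (X n) k i j"
        if "k \<in> vector_labels T n" "i \<in> {1..vector_dim T n k}" "j \<in> {1..vector_dim T n k}" for k i j
        using cov_lower[OF n1 that] .
      show "card {b \<in> {1..n}. fst (entry_index T n a b) = l} \<le> 2" if "a \<in> {1..n}" for a l
        by (rule label_fibre[OF that])
    qed
    have "trace_power T n (X n) p = w.W"
      unfolding fun_eq_iff trace_power_eq_walk_sum[OF p_pos] w.W_eq
      by (simp add: Y_entry_def gm.coord_def case_prod_beta')
    moreover have "(n div 4) ^ (p + 1) \<le> card w.same_labels"
      using card_same_label_walks[OF p_pos p_even, of T n] unfolding w.same_labels_def w.walks_def by simp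
    from w.tv_dist_W_le[OF n refl this] have "tv_dist (Omega n) (standardized (Omega n) w.W) std_normal_distribution (\<lambda>x. x) \<le> C / sqrt (real n)"
      unfolding C_def tb_def w.term_bound_def .
    ultimately show ?thesis by simp
  qed
  have nonneg: "0 \<le> ?d n" if "4 \<le> n" for n
  proof (rule tv_dist_nonneg)
    show "prob_space (Omega n)" using model[of n] that by (simp add: gaussian_model_def)
    show "prob_space std_normal_distribution" by (rule prob_space_normal_density) simp
  qed
  have "(\<lambda>n. C / sqrt (real n)) \<longlonglongrightarrow> 0" by real_asymp
  then have "?d \<longlonglongrightarrow> 0"
    by (rule tendsto_sandwich[where f="\<lambda>_. 0", rotated 3])
       (use bound nonneg in \<open>auto intro!: eventually_sequentiallyI[of 4]\<close>)
  then show ?thesis unfolding tv_tendsto_std_normal_def .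
qed

end
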